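(* Let $n\ge 2$, $k\ge 1$ be integers, $\alpha\in\mathbb{R}$, $p>1$, and assume that the best constant $c_{\alpha,k,p}$ is positive. If $q>p$ and $j\in\{0,1,\dots,k-1\}$, then $$S_{k,q,j}(\alpha)=\inf_{\substack{u\in\mathcal D^{k,p}_{\rm r}(\mathbb{R}^n;|x|^\alpha dx)\\ u\ne 0}}\frac{\displaystyle\int_{\mathbb{R}^n}|x|^{\alpha}|\nabla^k u|^p\,dx}{\left(\displaystyle\int_{\mathbb{R}^n}|x|^{-\beta_{k-j,q}}|\nabla^j u|^q\,dx\right)^{p/q}}$$ is positive and achieved in $\mathcal D^{k,p}_{\rm r}(\mathbb{R}^n;|x|^\alpha dx)$.
   Context: $C^k_{c,r}(\mathbb{R}^n\setminus\{0\})$ is the space of radially symmetric functions in $C^k_c(\mathbb{R}^n\setminus\{0\})$. $\nabla^k=\Delta^m$ if $k=2m$ is even, $\nabla^k=\nabla\Delta^m$ if $k=2m+1$ is odd, and $\nabla^0u=u$. $c_{\alpha,k,p}$ is the largest constant $c\ge0$ such that $\int_{\mathbb{R}^n}|x|^{\alpha}|\nabla^k u|^p\,dx\ge c\int_{\mathbb{R}^n}|x|^{\alpha-kp}|u|^p\,dx$ for all $u\in C^k_{c,r}(\mathbb{R}^n\setminus\{0\})$. With $H_\alpha=\frac{n+\alpha}{p}-1$ and $\gamma_{\alpha,h}=\left(\frac{n+\alpha}{p}-h\right)\left(n-2+h-\frac{n+\alpha}{p}\right)$, the condition $c_{\alpha,k,p}>0$ means: $\gamma_{\alpha,2h}\ne0$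 for all $h=1,\dots,m$ if $k=2m$; $H_\alpha\neq 0$ and $\gamma_{\alpha,2h+1}\ne0$ for all $h=1,\dots,m$ if $k=2m+1$. When $c_{\alpha,k,p}>0$, $\mathcal D^{k,p}_{\rm r}(\mathbb{R}^n;|x|^\alpha dx)$ is the completion of $C^k_{c,r}(\mathbb{R}^n\setminus\{0\})$ with respect to the norm $\|u\|_{k,\alpha}=\left(\int_{\mathbb{R}^n}|x|^\alpha|\nabla^k u|^p\,dx\right)^{1/p}$; it is continuously embedded in $L^p(\mathbb{R}^n;|x|^{\alpha-kp}dx)$, so its elements are radial functions on $\mathbb{R}^n\setminus\{0\}$ (derivatives being understood in the weak sense on $\mathbb{R}^n\setminus\{0\}$). Finally $\beta_{k-j,q}=n-q\,\frac{n-(k-j)p+\alpha}{p}$. *)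

theory Defs
  imports "HOL-Analysis.Analysis"
begin

definition partial :: "'a::euclidean_space \<Rightarrow> ('a \<Rightarrow> real) \<Rightarrow> 'a \<Rightarrow> real" where
  "partial b f x = frechet_derivative f (at x) b"

fun Ck :: "nat \<Rightarrow> ('a::euclidean_space \<Rightarrow> real) \<Rightarrow> bool" where
  "Ck 0 f \<longleftrightarrow> continuous_on UNIV f"
| "Ck (Suc k) f \<longleftrightarrow> (\<forall>x. f differentiable (at x)) \<and> (\<forall>b\<in>Basis. Ck k (partial b f))"

definition laplacian :: "('a::euclidean_space \<Rightarrow> real) \<Rightarrow> 'a \<Rightarrow> real" where
  "laplacian f x = (\<Sum>b\<in>Basis. partial b (partial b f) x)"

definition gradient :: "('a::euclidean_space \<Rightarrow> real) \<Rightarrow> 'a \<Rightarrow> 'a" where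
  "gradient f x = (\<Sum>b\<in>Basis. partial b f x *\<^sub>R b)"

text \<open>
  The derivative \<open>\<nabla>\<^sup>k\<close> is scalar for even \<open>k\<close> and a vector field for odd \<open>k\<close>.
  Both are placed in \<open>\<real> \<times> \<real>\<^sup>n\<close>, with the unused component zero, so that
  the norm of the pair is the Euclidean norm of \<open>\<nabla>\<^sup>k u\<close>.
\<close>

definition nabla :: "nat \<Rightarrow> ('a::euclidean_space \<Rightarrow> real) \<Rightarrow> 'a \<Rightarrow> real \<times> 'a" where
  "nabla k u x =
     (if even k then ((laplacian ^^ (k div 2)) u x, 0)
      else (0, gradient ((laplacian ^^ (k div 2)) u) x))"

text \<open>
  A function in \<open>C\<^sup>k\<^sub>c(\<real>\<^sup>n - {0})\<close> is represented by its extension by zero to \<open>\<real>\<^sup>n\<close>;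
  the extension is \<open>C\<^sup>k\<close> because the support is compact and misses the origin.
\<close>

definition Ckc :: "nat \<Rightarrow> ('a::euclidean_space \<Rightarrow> real) set" where
  "Ckc k = {u. Ck k u \<and> compact (closure {x. u x \<noteq> 0}) \<and> 0 \<notin> closure {x. u x \<noteq> 0}}"

definition radial :: "('a::euclidean_space \<Rightarrow> real) \<Rightarrow> bool" where
  "radial u \<longleftrightarrow> (\<forall>x y. x \<noteq> 0 \<and> norm x = norm y \<longrightarrow> u x = u y)"

definition Ckcr :: "nat \<Rightarrow> ('a::euclidean_space \<Rightarrow> real) set" where
  "Ckcr k = {u \<in> Ckc k. radial u}"

definition test_functions :: "('a::euclidean_space \<Rightarrow> real) set" where
  "test_functions = (\<Inter>k. Ckc k)"

definition locally_integrable_punctured ::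
    "('a::euclidean_space \<Rightarrow> 'b::{banach, second_countable_topology}) \<Rightarrow> bool" where
  "locally_integrable_punctured f \<longleftrightarrow>
     (\<forall>K. compact K \<and> 0 \<notin> K \<longrightarrow> set_integrable lborel K f)"

definition has_weak_nabla ::
    "nat \<Rightarrow> ('a::euclidean_space \<Rightarrow> real) \<Rightarrow> ('a \<Rightarrow> real \<times> 'a) \<Rightarrow> bool" where
  "has_weak_nabla k u G \<longleftrightarrow>
     locally_integrable_punctured u \<and> locally_integrable_punctured G \<and>
     (if even k then
        (\<forall>x. snd (G x) = 0) \<and>
        (\<forall>\<phi>\<in>test_functions.
           (LINT x|lborel. u x * (laplacian ^^ (k div 2)) \<phi> x) =
           (LINT x|lborel. fst (G x) * \<phi> x))
      else
        (\<forall>x. fst (G x) = 0) \<and>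
        (\<forall>b\<in>Basis. \<forall>\<phi>\<in>test_functions.
           (LINT x|lborel. u x * (laplacian ^^ (k div 2)) (partial b \<phi>) x) =
           - (LINT x|lborel. (snd (G x) \<bullet> b) * \<phi> x)))"

text \<open>
  The weak derivative is unique up to null sets, and only integrals of it are used below.
\<close>

definition weak_nabla :: "nat \<Rightarrow> ('a::euclidean_space \<Rightarrow> real) \<Rightarrow> 'a \<Rightarrow> real \<times> 'a" where
  "weak_nabla k u = (SOME G. has_weak_nabla k u G)"

definition weighted_int ::
    "real \<Rightarrow> real \<Rightarrow> ('a::euclidean_space \<Rightarrow> 'b::real_normed_vector) \<Rightarrow> real" where
  "weighted_int a p f = (LINT x|lborel. norm x powr a * norm (f x) powr p)"

text \<open>
  The admissible constants form a closed bounded set containing \<open>0\<close>, so the supremum is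
  the largest of them.
\<close>

definition best_constant :: "'a::euclidean_space itself \<Rightarrow> real \<Rightarrow> nat \<Rightarrow> real \<Rightarrow> real" where
  "best_constant T \<alpha> k p =
     Sup {c. 0 \<le> c \<and> (\<forall>u \<in> (Ckcr k :: ('a \<Rightarrow> real) set).
                c * weighted_int (\<alpha> - real k * p) p u \<le> weighted_int \<alpha> p (nabla k u))}"

definition sobolev_norm :: "real \<Rightarrow> nat \<Rightarrow> real \<Rightarrow> ('a::euclidean_space \<Rightarrow> real) \<Rightarrow> real" where
  "sobolev_norm \<alpha> k p u = weighted_int \<alpha> p (nabla k u) powr (1 / p)"

definition weighted_Lp :: "real \<Rightarrow> real \<Rightarrow> ('a::euclidean_space \<Rightarrow> real) set" where
  "weighted_Lp a p =
     {u \<in> borel_measurable lborel. integrable lborel (\<lambda>x. norm x powr a * norm (u x) powr p)}"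

text \<open>
  When the best constant is positive, the completion embeds in \<open>L\<^sup>p(|x|\<^bsup>\<alpha>-kp\<^esup> dx)\<close>.  An
  element of the completion, i.e. a class of Cauchy sequences in \<open>C\<^sup>k\<^bsub>c,r\<^esub>\<close>, is identified with
  its image, the \<open>L\<^sup>p\<close> limit of any such sequence.  Functions agreeing almost everywhere
  represent the same element, and each element has radial representatives.
\<close>

definition D_space :: "real \<Rightarrow> nat \<Rightarrow> real \<Rightarrow> ('a::euclidean_space \<Rightarrow> real) set" where
  "D_space \<alpha> k p =
     {u \<in> weighted_Lp (\<alpha> - real k * p) p. radial u \<and>
        (\<exists>v. (\<forall>i::nat. v i \<in> Ckcr k) \<and>
             (\<forall>e>0. \<exists>N. \<forall>i\<ge>N. \<forall>l\<ge>N. sobolev_norm \<alpha> k p (\<lambda>x. v i x - v l x) < e) \<and>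
             (\<lambda>i. weighted_int (\<alpha> - real k * p) p (\<lambda>x. v i x - u x)) \<longlonglongrightarrow> 0)}"

definition D_nonzero :: "real \<Rightarrow> nat \<Rightarrow> real \<Rightarrow> ('a::euclidean_space \<Rightarrow> real) set" where
  "D_nonzero \<alpha> k p = {u \<in> D_space \<alpha> k p. \<not> (AE x in lborel. u x = 0)}"

definition beta :: "nat \<Rightarrow> real \<Rightarrow> real \<Rightarrow> nat \<Rightarrow> real \<Rightarrow> real" where
  "beta n \<alpha> p i q = real n - q * ((real n - real i * p + \<alpha>) / p)"

text \<open>
  The integrals are Bochner integrals, with value \<open>0\<close> if they diverge, and \<open>t / 0 = 0\<close>.
  Hence positivity of the infimum below includes that both integrals are finite and nonzero
  for every \<open>u \<noteq> 0\<close>.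
\<close>

definition sobolev_quotient ::
    "real \<Rightarrow> nat \<Rightarrow> real \<Rightarrow> real \<Rightarrow> nat \<Rightarrow> ('a::euclidean_space \<Rightarrow> real) \<Rightarrow> real" where
  "sobolev_quotient \<alpha> k p q j u =
     weighted_int \<alpha> p (weak_nabla k u) /
     weighted_int (- beta DIM('a) \<alpha> p (k - j) q) q (weak_nabla j u) powr (p / q)"

definition S_const ::
    "'a::euclidean_space itself \<Rightarrow> real \<Rightarrow> nat \<Rightarrow> real \<Rightarrow> real \<Rightarrow> nat \<Rightarrow> real" where
  "S_const T \<alpha> k p q j =
     (INF u \<in> (D_nonzero \<alpha> k p :: ('a \<Rightarrow> real) set). sobolev_quotient \<alpha> k p q j u)"

end

(*
  Write u(x) = |x|^(-a) w(ln |x|) with a = (n + alpha) / p - k. In the variable s = ln |x| the operators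
  nabla^k and nabla^j become constant coefficient operators P_k(D) and P_j(D) that are products of first
  order factors D - mu with real mu, the weighted integrals become the norms of P_k(D) w in L^p(R) and of
  P_j(D) w in L^q(R), and P_j divides P_k. Dilating w shows that a zero root mu contradicts the positivity
  of the best constant. Hence P_k(D) is invertible on L^p(R), the completion corresponds to all
  f = P_k(D) w in L^p(R), and P_j(D) w = +-G * f, where G is a convolution of one-sided exponentials and
  therefore nonnegative. What remains is to maximise ||G * f||_q for f >= 0 and ||f||_p <= 1 on the line.

  Take a maximising sequence f_i, translated so that (G * f_i)(0) stays away from 0. The functions G * f_i
  are equicontinuous, so a subsequence converges pointwise to some g. The duals
  h_i = G' * (G * f_i)^(q-1) / M, where G'(t) = G(-t) and M is the supremum of ||G * f||_q^q, have norm
  at most 1 in the dual exponent, converge pointwise, and satisfy int f_i h_i -> 1. So the defect in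
  Young's inequality for f_i and h_i tends to 0 in L^1, and its equality case forces f_i -> f almost
  everywhere, where f^(p-1) = lim h_i. The limit solves the Euler-Lagrange equation
  M f^(p-1) = G' * (G * f)^(q-1), so M ||f||_p^p = ||G * f||_q^q <= M ||f||_p^q; as q > p and f is not 0,
  the norm of f is 1 and f is a maximiser.
*)
theory Submission
  imports Defs "HOL-Complex_Analysis.Great_Picard"
begin

section \<open>Functions of class \<open>C\<^sup>k\<close> and integration by parts\<close>

text \<open>The obstacle is the dilation invariance of the quotient in x, that is, translation
  invariance on the line: maximising sequences may drift away or flatten out, and all limits below
  are only pointwise. Since q > p, g = G * f satisfies ||g||_q^q <= (sup g)^(q-p) ||g||_p^p, so a
  near-maximiser must have a value bounded away from 0 somewhere; this rules out flattening and is
  what makes the translation to 0 possible. A partial escape of mass is never discussed: it would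
  show up as a limit of norm less than 1, which the inequality at the end excludes. One may assume f
  >= 0 because |G * f| <= G * |f|. A zero denominator in the quotient is evaluated as 0. Positivity
  therefore also needs that P_j(D) w = 0 forces u = 0, which follows by inverting P_j(D).\<close>

lemma partial_eqI: "(f has_derivative f') (at x) \<Longrightarrow> partial b f x = f' b"
  unfolding partial_def by (metis frechet_derivative_at)

lemma Ck_SucI:
  assumes "\<And>x. (f has_derivative D x) (at x)" and "\<And>b. b \<in> Basis \<Longrightarrow> Ck k (\<lambda>x. D x b)"
  shows "Ck (Suc k) f"
proof -
  have "partial b f = (\<lambda>x. D x b)" for b
    using partial_eqI[OF assms(1)] by auto
  with assms show ?thesis
    by (auto simp: differentiable_def)
qed

lemma Ck_Suc_has_derivative:
  "Ck (Suc k) f \<Longrightarrow> (f has_derivative frechet_derivative f (at x)) (at x)"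
  by (simp add: frechet_derivative_works)

lemma Ck_partial: "Ck (Suc k) f \<Longrightarrow> b \<in> Basis \<Longrightarrow> Ck k (partial b f)"
  by simp

lemma Ck_imp_continuous: "Ck k f \<Longrightarrow> continuous_on UNIV f"
  by (cases k) (auto intro!: differentiable_imp_continuous_on simp: differentiable_on_def
      intro: differentiable_at_withinI)

lemma Ck_SucD: "Ck (Suc k) f \<Longrightarrow> Ck k f"
proof (induction k arbitrary: f)
  case 0
  then show ?case using Ck_imp_continuous[OF 0] by simp
next
  case (Suc k)
  then show ?case by simp
qed

lemma Ck_mono: "Ck k f \<Longrightarrow> j \<le> k \<Longrightarrow> Ck j f"
  by (induction k) (auto simp del: Ck.simps dest: Ck_SucD simp: le_Suc_eq)

lemma Ck_const: "Ck k (\<lambda>x. c)"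
proof (induction k arbitrary: c)
  case (Suc k)
  show ?case by (rule Ck_SucI[where D="\<lambda>x h. 0"]) (auto intro: Suc)
qed auto

lemma Ck_bounded_linear: "bounded_linear f \<Longrightarrow> Ck k f"
  by (cases k) (auto intro!: Ck_SucI[where D="\<lambda>x. f"] Ck_const bounded_linear_imp_has_derivative
      linear_continuous_on simp del: Ck.simps(2))

lemma Ck_add: "Ck k f \<Longrightarrow> Ck k g \<Longrightarrow> Ck k (\<lambda>x. f x + g x)"
proof (induction k arbitrary: f g)
  case 0
  then show ?case by (auto intro: continuous_on_add)
next
  case (Suc k)
  show ?case
  proof (rule Ck_SucI)
    show "((\<lambda>x. f x + g x) has_derivative
        (\<lambda>h. frechet_derivative f (at x) h + frechet_derivative g (at x) h)) (at x)" for x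
      by (intro has_derivative_add Ck_Suc_has_derivative[OF Suc.prems(1)] Ck_Suc_has_derivative[OF Suc.prems(2)])
    show "Ck k (\<lambda>x. frechet_derivative f (at x) b + frechet_derivative g (at x) b)" if "b \<in> Basis" for b
      using Suc that by (auto simp: partial_def[abs_def])
  qed
qed

lemma Ck_mult: "Ck k f \<Longrightarrow> Ck k g \<Longrightarrow> Ck k (\<lambda>x. f x * g x)"
proof (induction k arbitrary: f g)
  case 0
  then show ?case by (auto intro: continuous_on_mult)
next
  case (Suc k)
  show ?case
  proof (rule Ck_SucI)
    show "((\<lambda>x. f x * g x) has_derivative
        (\<lambda>h. f x * frechet_derivative g (at x) h + frechet_derivative f (at x) h * g x)) (at x)" for x
      by (intro has_derivative_mult Ck_Suc_has_derivative[OF Suc.prems(1)] Ck_Suc_has_derivative[OF Suc.prems(2)])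
    show "Ck k (\<lambda>x. f x * frechet_derivative g (at x) b + frechet_derivative f (at x) b * g x)"
      if "b \<in> Basis" for b
      using Suc.prems that Suc.IH Ck_SucD[OF Suc.prems(1)] Ck_SucD[OF Suc.prems(2)]
      by (intro Ck_add Suc.IH) (auto simp: partial_def[abs_def])
  qed
qed

lemma Ck_cmult: "Ck k f \<Longrightarrow> Ck k (\<lambda>x. c * f x)"
  by (intro Ck_mult Ck_const)

lemma Ck_diff: "Ck k f \<Longrightarrow> Ck k g \<Longrightarrow> Ck k (\<lambda>x. f x - g x)"
  using Ck_add[OF _ Ck_cmult[of k g "-1"]] by simp

lemma Ck_sum: "(\<And>i. i \<in> I \<Longrightarrow> Ck k (f i)) \<Longrightarrow> Ck k (\<lambda>x. \<Sum>i\<in>I. f i x)"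
  by (induction I rule: infinite_finite_induct) (auto intro: Ck_add Ck_const)

lemma Ck_prod: "(\<And>i. i \<in> I \<Longrightarrow> Ck k (f i)) \<Longrightarrow> Ck k (\<lambda>x. \<Prod>i\<in>I. f i x)"
  by (induction I rule: infinite_finite_induct) (auto intro: Ck_mult Ck_const)

lemma Ck_power: "Ck k f \<Longrightarrow> Ck k (\<lambda>x. f x ^ m)"
  by (induction m) (auto intro: Ck_mult Ck_const)

lemma Ck_real_SucI:
  fixes f :: "real \<Rightarrow> real"
  assumes "\<And>x. (f has_real_derivative f' x) (at x)" and "Ck k f'"
  shows "Ck (Suc k) f"
  by (rule Ck_SucI[where D="\<lambda>x h. f' x * h"])
    (use assms in \<open>auto simp: has_field_derivative_def\<close>)

lemma partial_real: "(f has_real_derivative d) (at x) \<Longrightarrow> partial 1 f x = d"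
  using partial_eqI[of f "\<lambda>h. d * h" x 1] by (simp add: has_field_derivative_def)

lemma Ck_real_derivative:
  fixes f :: "real \<Rightarrow> real"
  assumes "Ck (Suc k) f"
  shows "(f has_real_derivative partial 1 f x) (at x)"
proof -
  have "f differentiable at x" using assms by auto
  then obtain d where "(f has_real_derivative d) (at x)"
    using real_differentiable_def by blast
  with partial_real[OF this] show ?thesis by simp
qed

lemma Ck_compose:
  fixes g :: "real \<Rightarrow> real"
  assumes "Ck k g" "Ck k h"
  shows "Ck k (\<lambda>x. g (h x))"
  using assms
proof (induction k arbitrary: g h)
  case 0
  then show ?case by (auto intro: continuous_on_compose2[of UNIV g])
next
  case (Suc k)
  show ?case
  proof (rule Ck_SucI)
    show "((\<lambda>x. g (h x)) has_derivative (\<lambda>v. partial 1 g (h x) * frechet_derivative h (at x) v)) (at x)" for x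
      using Ck_real_derivative[OF Suc.prems(1), of "h x"]
        has_derivative_compose[OF Ck_Suc_has_derivative[OF Suc.prems(2)], of g _ x]
      by (auto simp: has_field_derivative_def)
    show "Ck k (\<lambda>x. partial 1 g (h x) * frechet_derivative h (at x) b)" if "b \<in> Basis" for b
      using Ck_mult[OF Suc.IH[OF Ck_partial[OF Suc.prems(1), of 1] Ck_SucD[OF Suc.prems(2)]]
          Ck_partial[OF Suc.prems(2) that]] by (simp add: partial_def)
  qed
qed

lemma Ck_laplacian: "Ck (Suc (Suc k)) f \<Longrightarrow> Ck k (laplacian f)"
  unfolding laplacian_def[abs_def] by (intro Ck_sum) simp

lemma Ck_laplacian_iter: "Ck (k + 2 * m) f \<Longrightarrow> Ck k ((laplacian ^^ m) f)"
proof (induction m arbitrary: k)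
  case (Suc m)
  then have "Ck (Suc (Suc k) + 2 * m) f" by (simp add: add.commute)
  from Ck_laplacian[OF Suc.IH[OF this]] show ?case by simp
qed simp

lemma partial_mult:
  "Ck (Suc k) f \<Longrightarrow> Ck (Suc k) g \<Longrightarrow>
    partial b (\<lambda>x. f x * g x) x = f x * partial b g x + partial b f x * g x"
  using partial_eqI[OF has_derivative_mult[OF Ck_Suc_has_derivative[of k f x] Ck_Suc_has_derivative[of k g x]], of b]
  by (simp add: partial_def)

text \<open>\<open>frechet_derivative\<close> chooses among all derivatives, so it is enough that
  both functions have the same derivative relation at x. This covers points where neither is
  differentiable.\<close>

lemma partial_local:
  assumes "open S" "x \<in> S" "\<And>y. y \<in> S \<Longrightarrow> f y = g y"
  shows "partial b f x = partial b g x"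
proof -
  have "(f has_derivative D) (at x) \<longleftrightarrow> (g has_derivative D) (at x)" for D
    using assms has_derivative_transform_within_open[of f D x UNIV S g]
      has_derivative_transform_within_open[of g D x UNIV S f] by auto
  then show ?thesis unfolding partial_def frechet_derivative_def by simp
qed

text \<open>Any set containing the support may be used, so that one fixed compact set serves a
  function, all its derivatives and its products. The closure in \<open>Ckc\<close> would change
  with each of them.\<close>

definition vanishes_off :: "'a set \<Rightarrow> ('a \<Rightarrow> 'b::zero) \<Rightarrow> bool" where
  "vanishes_off K f \<longleftrightarrow> (\<forall>x. x \<notin> K \<longrightarrow> f x = 0)"

lemma partial_zero: "partial b (\<lambda>x. 0) x = 0"
  by (rule partial_eqI[OF has_derivative_const])

lemma vanishes_off_partial:
  assumes "closed K" "vanishes_off K f"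
  shows "vanishes_off K (partial b f)"
  unfolding vanishes_off_def
proof (intro allI impI)
  fix x assume "x \<notin> K"
  then have "partial b f x = partial b (\<lambda>x. 0) x"
    using assms by (intro partial_local[of "- K"]) (auto simp: vanishes_off_def)
  then show "partial b f x = 0" by (simp add: partial_zero)
qed

lemma vanishes_off_laplacian:
  assumes "closed K" "vanishes_off K f"
  shows "vanishes_off K (laplacian f)"
proof -
  have "vanishes_off K (partial b (partial b f))" for b
    by (intro vanishes_off_partial assms)
  then show ?thesis unfolding vanishes_off_def laplacian_def by simp
qed

lemma vanishes_off_laplacian_iter:
  "closed K \<Longrightarrow> vanishes_off K f \<Longrightarrow> vanishes_off K ((laplacian ^^ m) f)"
  by (induction m) (auto intro: vanishes_off_laplacian)

lemma Ckc_iff: "u \<in> Ckc k \<longleftrightarrow> Ck k u \<and> (\<exists>K. compact K \<and> 0 \<notin> K \<and> vanishes_off K u)"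
proof
  assume "u \<in> Ckc k"
  moreover have "vanishes_off (closure {x. u x \<noteq> 0}) u"
    using closure_subset[of "{x. u x \<noteq> 0}"] by (auto simp: vanishes_off_def)
  ultimately show "Ck k u \<and> (\<exists>K. compact K \<and> 0 \<notin> K \<and> vanishes_off K u)"
    unfolding Ckc_def by blast
next
  assume "Ck k u \<and> (\<exists>K. compact K \<and> 0 \<notin> K \<and> vanishes_off K u)"
  then obtain K where K: "Ck k u" "compact K" "0 \<notin> K" "vanishes_off K u" by auto
  then have "closure {x. u x \<noteq> 0} \<subseteq> K"
    by (intro closure_minimal) (auto simp: vanishes_off_def compact_imp_closed)
  moreover from this have "compact (closure {x. u x \<noteq> 0})"
    using K(2) by (metis closed_closure compact_Int_closed inf.absorb_iff2)
  ultimately show "u \<in> Ckc k"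
    using K unfolding Ckc_def by auto
qed

lemma test_function_iff:
  "\<phi> \<in> test_functions \<longleftrightarrow> (\<forall>k. Ck k \<phi>) \<and> (\<exists>K. compact K \<and> 0 \<notin> K \<and> vanishes_off K \<phi>)"
  unfolding test_functions_def by (auto simp: Ckc_iff)

lemma integrable_compact_support:
  fixes f :: "'a::euclidean_space \<Rightarrow> 'b::{banach, second_countable_topology}"
  assumes "continuous_on UNIV f" "compact K" "vanishes_off K f"
  shows "integrable lborel f"
proof -
  have "integrable lborel (\<lambda>x. indicator K x *\<^sub>R f x)"
    using assms by (intro borel_integrable_compact) (auto intro: continuous_on_subset)
  moreover have "(\<lambda>x. indicator K x *\<^sub>R f x) = f"
    using assms(3) by (auto simp: vanishes_off_def indicator_def)
  ultimately show ?thesis by simp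
qed

text \<open>By translation invariance the difference quotients have integral zero.\<close>

lemma integral_partial_eq_0:
  fixes f :: "'a::euclidean_space \<Rightarrow> real"
  assumes f: "Ck (Suc k) f" and K: "compact K" "vanishes_off K f" and b: "b \<in> Basis"
  shows "(LINT x|lborel. partial b f x) = 0"
proof -
  define h :: "nat \<Rightarrow> real" where "h i = 1 / (real i + 1)" for i
  have h: "h i > 0" "h i \<le> 1" for i by (auto simp: h_def)
  have h0: "h \<longlonglongrightarrow> 0"
    using LIMSEQ_inverse_real_of_nat by (simp add: h_def[abs_def] inverse_eq_divide add.commute)
  define Q where "Q i x = (f (x + h i *\<^sub>R b) - f x) / h i" for i x
  \<comment> \<open>The steps \<open>h i\<close> are at most 1, so this thickening of K contains the
    supports of all difference quotients and carries one dominating function.\<close>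
  define K' where "K' = {x + y | x y. x \<in> K \<and> y \<in> cball 0 1}"
  have K': "compact K'" unfolding K'_def using K(1) by (intro compact_sums) auto
  have fc: "continuous_on UNIV f" using f by (rule Ck_imp_continuous)
  have pc: "continuous_on UNIV (partial b f)" using Ck_partial[OF f b] by (rule Ck_imp_continuous)
  have pK: "vanishes_off K (partial b f)" using K by (intro vanishes_off_partial) (auto simp: compact_imp_closed)
  have "bounded (partial b f ` K)"
    using K(1) pc by (intro compact_imp_bounded compact_continuous_image) (auto intro: continuous_on_subset)
  then obtain B where "\<And>x. x \<in> K \<Longrightarrow> \<bar>partial b f x\<bar> \<le> B"
    unfolding bounded_iff by auto
  then have B: "\<bar>partial b f x\<bar> \<le> \<bar>B\<bar>" for x
    using pK unfolding vanishes_off_def by (cases "x \<in> K") fastforce+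
  have line: "((\<lambda>t. f (x + t *\<^sub>R b)) has_real_derivative partial b f (x + t *\<^sub>R b)) (at t)" for x t
  proof -
    have "((\<lambda>t. f (x + t *\<^sub>R b)) has_derivative (\<lambda>s. frechet_derivative f (at (x + t *\<^sub>R b)) (s *\<^sub>R b))) (at t)"
      by (rule has_derivative_compose[OF _ Ck_Suc_has_derivative[OF f]]) (auto intro!: derivative_eq_intros)
    moreover have "frechet_derivative f (at y) (s *\<^sub>R b) = partial b f y * s" for y s
      using has_derivative_linear[OF Ck_Suc_has_derivative[OF f, of y]]
      by (simp add: linear_cmul partial_def)
    ultimately show ?thesis by (simp add: has_field_derivative_def)
  qed
  have Qb: "norm (Q i x) \<le> \<bar>B\<bar> * indicator K' x" for i x
  proof (cases "x \<in> K'")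
    case True
    obtain z where z: "f (x + h i *\<^sub>R b) - f (x + 0 *\<^sub>R b) = (h i - 0) * partial b f (x + z *\<^sub>R b)"
      using MVT2[of 0 "h i" "\<lambda>t. f (x + t *\<^sub>R b)" "\<lambda>t. partial b f (x + t *\<^sub>R b)"] h(1) line by metis
    then show ?thesis using True B[of "x + z *\<^sub>R b"] h(1)[of i] by (simp add: Q_def)
  next
    case False
    have "x \<notin> K"
    proof
      assume "x \<in> K"
      then have "x + 0 \<in> K'" unfolding K'_def by (intro CollectI exI conjI refl) auto
      with False show False by simp
    qed
    moreover have "x + h i *\<^sub>R b \<notin> K"
    proof
      assume "x + h i *\<^sub>R b \<in> K"
      moreover have "norm (h i *\<^sub>R b) \<le> 1" using h[of i] b by simp
      ultimately have "(x + h i *\<^sub>R b) + (- (h i *\<^sub>R b)) \<in> K'"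
        unfolding K'_def
        by (intro CollectI exI[of _ "x + h i *\<^sub>R b"] exI[of _ "- (h i *\<^sub>R b)"]) auto
      with False show False by simp
    qed
    ultimately show ?thesis using K(2) by (simp add: Q_def vanishes_off_def)
  qed
  have Qlim: "(\<lambda>i. Q i x) \<longlonglongrightarrow> partial b f x" for x
  proof -
    have "((\<lambda>t. (f (x + t *\<^sub>R b) - f (x + 0 *\<^sub>R b)) / (t - 0)) \<longlongrightarrow> partial b f (x + 0 *\<^sub>R b)) (at 0)"
      using line[of x 0] by (simp add: has_field_derivative_iff)
    moreover have "filterlim h (at 0) sequentially"
      using h0 h(1) by (auto simp: filterlim_at intro!: always_eventually) (metis less_irrefl)
    ultimately show ?thesis
      unfolding Q_def by (auto dest: filterlim_compose)
  qed
  have fi: "integrable lborel f" by (rule integrable_compact_support[OF fc K])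
  have "(LINT x|lborel. f (x + c)) = (LINT x|lborel. f x)" and ft: "integrable lborel (\<lambda>x. f (x + c))" for c
  proof -
    have [measurable]: "f \<in> borel_measurable borel" using fc by (rule borel_measurable_continuous_onI)
    have "(LINT x|lborel. f x) = (LINT x|distr lborel borel ((+) c). f x)"
      by (simp add: lborel_distr_plus)
    also have "\<dots> = (LINT x|lborel. f (c + x))"
      by (subst integral_distr) auto
    finally show "(LINT x|lborel. f (x + c)) = (LINT x|lborel. f x)" by (simp add: add.commute)
    have "integrable (distr lborel borel ((+) c)) f" using fi by (simp add: lborel_distr_plus)
    then show "integrable lborel (\<lambda>x. f (x + c))"
      by (subst (asm) integrable_distr_eq) (auto simp: add.commute)
  qed
  then have Q0: "(LINT x|lborel. Q i x) = 0" for i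
    using fi unfolding Q_def by simp
  have "(\<lambda>i. LINT x|lborel. Q i x) \<longlonglongrightarrow> (LINT x|lborel. partial b f x)"
  proof (rule integral_dominated_convergence[where w="\<lambda>x. \<bar>B\<bar> * indicator K' x"])
    show "integrable lborel (\<lambda>x. \<bar>B\<bar> * indicator K' x :: real)"
      using K' emeasure_compact_finite[OF K'] by (intro integrable_mult_right integrable_real_indicator)
        (auto simp: compact_imp_closed borel_closed)
    show "partial b f \<in> borel_measurable lborel"
      using pc by (simp add: borel_measurable_continuous_onI)
    show "Q i \<in> borel_measurable lborel" for i
      unfolding Q_def using fc by (auto intro!: borel_measurable_continuous_onI continuous_intros
          continuous_on_compose2[OF fc] simp: h_def)
  qed (use Qlim Qb in auto)
  with Q0 show ?thesis by (simp add: LIMSEQ_const_iff)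
qed

text \<open>Both terms come from the product rule for f * g, and this product has compact support as
  soon as g has. Hence f needs regularity but no decay.\<close>

lemma integral_by_parts:
  fixes f g :: "'a::euclidean_space \<Rightarrow> real"
  assumes f: "Ck (Suc k) f" and g: "Ck (Suc k) g" and K: "compact K" "vanishes_off K g" and b: "b \<in> Basis"
  shows "(LINT x|lborel. f x * partial b g x) = - (LINT x|lborel. partial b f x * g x)"
proof -
  note c = Ck_imp_continuous
  have pK: "vanishes_off K (partial b g)" using K by (intro vanishes_off_partial) (auto simp: compact_imp_closed)
  have 1: "integrable lborel (\<lambda>x. f x * partial b g x)"
    using K pK by (intro integrable_compact_support[of _ K] continuous_intros c[OF f] c[OF Ck_partial[OF g b]])
      (auto simp: vanishes_off_def)
  have 2: "integrable lborel (\<lambda>x. partial b f x * g x)"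
    using K by (intro integrable_compact_support[of _ K] continuous_intros c[OF g] c[OF Ck_partial[OF f b]])
      (auto simp: vanishes_off_def)
  have "0 = (LINT x|lborel. partial b (\<lambda>x. f x * g x) x)"
    using K by (intro integral_partial_eq_0[symmetric, OF Ck_mult[OF f g] K(1) _ b]) (auto simp: vanishes_off_def)
  also have "\<dots> = (LINT x|lborel. f x * partial b g x) + (LINT x|lborel. partial b f x * g x)"
    by (simp add: partial_mult[OF f g] Bochner_Integration.integral_add[OF 1 2])
  finally show ?thesis by simp
qed

lemma integral_laplacian_symmetric:
  fixes f g :: "'a::euclidean_space \<Rightarrow> real"
  assumes f: "Ck (Suc (Suc k)) f" and g: "Ck (Suc (Suc k)) g" and K: "compact K" "vanishes_off K g"
  shows "(LINT x|lborel. f x * laplacian g x) = (LINT x|lborel. laplacian f x * g x)"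
proof -
  note c = Ck_imp_continuous
  have cl: "closed K" using K by (simp add: compact_imp_closed)
  have int1: "integrable lborel (\<lambda>x. f x * partial b (partial b g) x)" if b: "b \<in> Basis" for b
    using K(1) vanishes_off_partial[OF cl vanishes_off_partial[OF cl K(2), of b], of b]
    by (intro integrable_compact_support[of _ K] continuous_intros c[OF f]
        c[OF Ck_partial[OF Ck_partial[OF g b] b]]) (auto simp: vanishes_off_def)
  have int2: "integrable lborel (\<lambda>x. partial b (partial b f) x * g x)" if b: "b \<in> Basis" for b
    using K by (intro integrable_compact_support[of _ K] continuous_intros c[OF g]
        c[OF Ck_partial[OF Ck_partial[OF f b] b]]) (auto simp: vanishes_off_def)
  have "(LINT x|lborel. f x * laplacian g x) = (\<Sum>b\<in>Basis. LINT x|lborel. f x * partial b (partial b g) x)"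
    unfolding laplacian_def sum_distrib_left by (rule Bochner_Integration.integral_sum[OF int1])
  also have "\<dots> = (\<Sum>b\<in>Basis. LINT x|lborel. partial b (partial b f) x * g x)"
  proof (rule sum.cong[OF refl])
    fix b :: 'a assume b: "b \<in> Basis"
    have "(LINT x|lborel. f x * partial b (partial b g) x) = - (LINT x|lborel. partial b f x * partial b g x)"
      by (rule integral_by_parts[OF Ck_SucD[OF f] Ck_partial[OF g b] K(1) vanishes_off_partial[OF cl K(2)] b])
    also have "\<dots> = (LINT x|lborel. partial b (partial b f) x * g x)"
      using integral_by_parts[OF Ck_partial[OF f b] Ck_SucD[OF g] K b] by simp
    finally show "(LINT x|lborel. f x * partial b (partial b g) x) = (LINT x|lborel. partial b (partial b f) x * g x)" .
  qed
  also have "\<dots> = (LINT x|lborel. laplacian f x * g x)"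
    unfolding laplacian_def sum_distrib_right by (rule Bochner_Integration.integral_sum[OF int2, symmetric])
  finally show ?thesis .
qed

text \<open>Laplacians are moved one at a time: the induction replaces g by its Laplacian, which
  keeps it smooth and supported in K, while f spends two derivatives per step. This is the situation
  of a C^k function tested with a test function.\<close>

lemma integral_laplacian_iter_symmetric:
  fixes f g :: "'a::euclidean_space \<Rightarrow> real"
  assumes "Ck (2 * m) f" "\<And>k. Ck k g" "compact K" "vanishes_off K g"
  shows "(LINT x|lborel. f x * (laplacian ^^ m) g x) = (LINT x|lborel. (laplacian ^^ m) f x * g x)"
  using assms
proof (induction m arbitrary: g)
  case (Suc m)
  have "(LINT x|lborel. f x * (laplacian ^^ Suc m) g x) = (LINT x|lborel. f x * (laplacian ^^ m) (laplacian g) x)"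
    by (simp add: funpow_swap1)
  also have "\<dots> = (LINT x|lborel. (laplacian ^^ m) f x * laplacian g x)"
    using Suc.prems by (intro Suc.IH Ck_mono[OF Suc.prems(1)])
      (auto intro: Ck_laplacian vanishes_off_laplacian compact_imp_closed)
  also have "\<dots> = (LINT x|lborel. laplacian ((laplacian ^^ m) f) x * g x)"
  proof (rule integral_laplacian_symmetric[of 0])
    show "Ck (Suc (Suc 0)) ((laplacian ^^ m) f)"
      using Suc.prems(1) by (intro Ck_laplacian_iter) (simp add: eval_nat_numeral)
  qed (use Suc.prems in auto)
  finally show ?case by simp
qed simp

section \<open>Classical derivatives as weak derivatives\<close>

lemma locally_integrable_continuous:
  "continuous_on UNIV f \<Longrightarrow> locally_integrable_punctured f"
  unfolding locally_integrable_punctured_def set_integrable_def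
  by (auto intro!: borel_integrable_compact intro: continuous_on_subset)

lemma continuous_nabla:
  assumes "Ck k v" "l \<le> k"
  shows "continuous_on UNIV (nabla l v)"
proof (cases "even l")
  case True
  then have "Ck (0 + 2 * (l div 2)) v" using assms by (auto intro: Ck_mono)
  from Ck_imp_continuous[OF Ck_laplacian_iter[OF this]] show ?thesis
    using True unfolding nabla_def[abs_def] by (auto intro!: continuous_intros)
next
  case False
  then have "Ck (Suc 0 + 2 * (l div 2)) v"
    using assms by (intro Ck_mono[OF assms(1)]) presburger
  from Ck_imp_continuous[OF Ck_partial[OF Ck_laplacian_iter[OF this]]] show ?thesis
    using False unfolding nabla_def[abs_def] gradient_def by (auto intro!: continuous_intros)
qed

lemma has_weak_nabla_nabla:
  assumes v: "v \<in> Ckc k" and l: "l \<le> k"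
  shows "has_weak_nabla l v (nabla l v)"
proof -
  have vk: "Ck k v" using v by (simp add: Ckc_iff)
  define m where "m = l div 2"
  have li: "locally_integrable_punctured v" "locally_integrable_punctured (nabla l v)"
    by (intro locally_integrable_continuous Ck_imp_continuous[OF vk] continuous_nabla[OF vk l])+
  show ?thesis
  proof (cases "even l")
    case True
    then have l2: "l = 2 * m" by (simp add: m_def)
    have "(LINT x|lborel. v x * (laplacian ^^ m) \<phi> x) = (LINT x|lborel. (laplacian ^^ m) v x * \<phi> x)"
      if "\<phi> \<in> test_functions" for \<phi>
      using that l l2 by (auto simp: test_function_iff intro!: integral_laplacian_iter_symmetric Ck_mono[OF vk])
    with li True show ?thesis by (simp add: has_weak_nabla_def nabla_def m_def)
  next
    case False
    then have l2: "l = Suc (2 * m)" by (simp add: m_def)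
    have "(LINT x|lborel. v x * (laplacian ^^ m) (partial b \<phi>) x) =
        - (LINT x|lborel. (gradient ((laplacian ^^ m) v) x \<bullet> b) * \<phi> x)"
      if \<phi>: "\<phi> \<in> test_functions" and b: "b \<in> Basis" for \<phi> b
    proof -
      obtain K where K: "compact K" "vanishes_off K \<phi>" and s: "\<And>k. Ck k \<phi>"
        using \<phi> by (auto simp: test_function_iff)
      have "(LINT x|lborel. v x * (laplacian ^^ m) (partial b \<phi>) x) =
          (LINT x|lborel. (laplacian ^^ m) v x * partial b \<phi> x)"
        using l l2 K b Ck_partial[OF s b]
        by (intro integral_laplacian_iter_symmetric[where K=K] Ck_mono[OF vk])
          (auto intro: vanishes_off_partial compact_imp_closed)
      also have "\<dots> = - (LINT x|lborel. partial b ((laplacian ^^ m) v) x * \<phi> x)"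
        using l l2 by (intro integral_by_parts[of 0, OF _ s K b] Ck_laplacian_iter Ck_mono[OF vk]) simp
      also have "(\<lambda>x. partial b ((laplacian ^^ m) v) x) = (\<lambda>x. gradient ((laplacian ^^ m) v) x \<bullet> b)"
        using b by (simp add: gradient_def inner_sum_left inner_Basis if_distrib sum.If_cases cong: if_cong)
      finally show ?thesis .
    qed
    with li False show ?thesis by (simp add: has_weak_nabla_def nabla_def m_def)
  qed
qed

section \<open>Test functions and uniqueness of weak derivatives\<close>

text \<open>The powers of t in the denominator make the family closed under differentiation: the
  derivative of the member m is a combination of the members m + 2 and m + 1. Smoothness then
  follows by an induction over the order for all m at once.\<close>

definition exp_bump :: "nat \<Rightarrow> real \<Rightarrow> real" where
  "exp_bump m t = (if t > 0 then exp (- 1 / t) / t ^ m else 0)"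

lemma tendsto_exp_bump_0: "(exp_bump m \<longlongrightarrow> 0) (at 0)"
proof -
  have "((\<lambda>t. inverse t ^ m / exp (inverse t)) \<longlongrightarrow> (0::real)) (at_right 0)"
    by (rule filterlim_compose[OF tendsto_power_div_exp_0 filterlim_inverse_at_top_right])
  then have "(exp_bump m \<longlongrightarrow> 0) (at_right 0)"
  proof (rule Lim_transform_eventually)
    show "\<forall>\<^sub>F t in at_right 0. inverse t ^ m / exp (inverse t) = exp_bump m t"
      by (auto simp: eventually_at_filter exp_bump_def exp_minus field_simps)
  qed
  moreover have "(exp_bump m \<longlongrightarrow> 0) (at_left 0)"
    by (rule Lim_transform_eventually[of "\<lambda>_. 0"]) (auto simp: eventually_at_filter exp_bump_def)
  ultimately show ?thesis by (simp add: filterlim_split_at)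
qed

lemma exp_bump_has_derivative:
  "(exp_bump m has_real_derivative (exp_bump (m + 2) t + - real m * exp_bump (m + 1) t)) (at t)"
proof -
  consider "t > 0" | "t < 0" | "t = 0" by linarith
  then show ?thesis
  proof cases
    case 1
    have "((\<lambda>t. exp (- 1 / t) / t ^ m) has_real_derivative
        (exp (- 1 / t) * (1 / t\<^sup>2) * t ^ m - exp (- 1 / t) * (real m * t ^ (m - 1))) / (t ^ m * t ^ m)) (at t)"
      using 1 by (auto intro!: derivative_eq_intros simp: power2_eq_square)
    moreover have "(exp (- 1 / t) * (1 / t\<^sup>2) * t ^ m - exp (- 1 / t) * (real m * t ^ (m - 1))) / (t ^ m * t ^ m)
        = exp_bump (m + 2) t + - real m * exp_bump (m + 1) t"
      using 1 by (cases m) (simp_all add: exp_bump_def field_simps power2_eq_square)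
    ultimately show ?thesis
      using 1 by (auto elim!: has_field_derivative_transform_within_open[where S="{0<..}"] simp: exp_bump_def)
  next
    case 2
    have "((\<lambda>_. 0) has_real_derivative 0) (at t)" by simp
    then have "(exp_bump m has_real_derivative 0) (at t)"
      using 2 by (elim has_field_derivative_transform_within_open[where S="{..<0}"]) (auto simp: exp_bump_def)
    with 2 show ?thesis by (simp add: exp_bump_def)
  next
    case 3
    \<comment> \<open>At the origin the difference quotient is again a member of the family, so its
      limit is already known.\<close>
    have "(exp_bump m y - exp_bump m 0) / (y - 0) = exp_bump (m + 1) y" for y
      by (simp add: exp_bump_def)
    moreover have "exp_bump (m + 2) 0 + - real m * exp_bump (m + 1) 0 = 0"
      by (simp add: exp_bump_def)
    ultimately show ?thesis
      using tendsto_exp_bump_0[of "m + 1"] 3 by (simp only: has_field_derivative_iff)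
  qed
qed

lemma Ck_exp_bump: "Ck k (exp_bump m)"
proof (induction k arbitrary: m)
  case 0
  show ?case
    using exp_bump_has_derivative by (auto intro!: continuous_at_imp_continuous_on DERIV_isCont)
next
  case (Suc k)
  show ?case
    by (rule Ck_real_SucI[OF exp_bump_has_derivative]) (intro Ck_add Ck_cmult Suc)
qed

lemma exp_bump_0_bounds: "0 \<le> exp_bump 0 t" "exp_bump 0 t \<le> 1" "exp_bump 0 t = 0 \<longleftrightarrow> t \<le> 0"
  by (auto simp: exp_bump_def)

text \<open>For a bump \<open>0 \<le> g < 1\<close> that is positive exactly on the box, the functions \<open>1 - (1 - g)\<^sup>m\<close>
  increase to the indicator of the box.\<close>

lemma box_cutoff:
  fixes l r :: "'a::euclidean_space"
  obtains \<theta> :: "nat \<Rightarrow> 'a \<Rightarrow> real"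
  where "\<And>m k. Ck k (\<theta> m)" "\<And>m x. 0 \<le> \<theta> m x" "\<And>m x. \<theta> m x \<le> 1"
    "\<And>m x. x \<notin> box l r \<Longrightarrow> \<theta> m x = 0" "\<And>x. (\<lambda>m. \<theta> m x) \<longlonglongrightarrow> indicator (box l r) x"
    "\<And>m x. m > 0 \<Longrightarrow> x \<in> box l r \<Longrightarrow> \<theta> m x > 0"
proof -
  define g :: "'a \<Rightarrow> real" where
    "g x = (1/2) * (\<Prod>b\<in>Basis. exp_bump 0 (x \<bullet> b - l \<bullet> b) * exp_bump 0 (r \<bullet> b - x \<bullet> b))" for x
  have Ckg: "Ck k g" for k
    unfolding g_def[abs_def]
    by (intro Ck_cmult Ck_prod Ck_mult Ck_compose[OF Ck_exp_bump] Ck_diff Ck_const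
        Ck_bounded_linear bounded_linear_inner_left)
  have g0: "0 \<le> g x" for x
    unfolding g_def by (intro mult_nonneg_nonneg prod_nonneg) (auto simp: exp_bump_0_bounds)
  have g1: "g x \<le> 1/2" for x
  proof -
    have "(\<Prod>b\<in>Basis. exp_bump 0 (x \<bullet> b - l \<bullet> b) * exp_bump 0 (r \<bullet> b - x \<bullet> b)) \<le> 1"
      by (intro prod_le_1) (auto simp: exp_bump_0_bounds mult_le_one)
    then show ?thesis by (simp add: g_def)
  qed
  have gz: "g x = 0 \<longleftrightarrow> x \<notin> box l r" for x
    by (auto simp: g_def exp_bump_0_bounds mem_box not_less)
  have gl: "(\<lambda>m. 1 - (1 - g x) ^ m) \<longlonglongrightarrow> indicator (box l r) x" for x
  proof (cases "x \<in> box l r")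
    case True
    then have "\<bar>1 - g x\<bar> < 1" using gz[of x] g0[of x] g1[of x] by auto
    then have "(\<lambda>m. 1 - (1 - g x) ^ m) \<longlonglongrightarrow> 1 - 0"
      by (intro tendsto_intros LIMSEQ_power_zero) simp
    with True show ?thesis by simp
  next
    case False
    then show ?thesis using gz[of x] by simp
  qed
  have gp: "(1 - g x) ^ m \<le> 1" "0 \<le> (1 - g x) ^ m" for x m
    using g0[of x] g1[of x] by (auto intro!: power_le_one)
  have "(1 - g x) ^ m < 1" if "m > 0" "x \<in> box l r" for x m
  proof -
    have "g x \<noteq> 0" using that gz by auto
    then show ?thesis using g0[of x] g1[of x] that by (intro power_less_one_iff[THEN iffD2]) auto
  qed
  then show thesis
    using gp gl gz[THEN iffD2] Ckg
    by (intro that[of "\<lambda>m x. 1 - (1 - g x) ^ m"] Ck_diff Ck_const Ck_power) auto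
qed

text \<open>The positive and the negative part of h are densities of two finite measures that agree
  on open boxes. Boxes generate the Borel sets and are stable under intersection, so the measures
  agree, and densities are unique almost everywhere.\<close>

lemma AE_zero_if_box_integrals_zero:
  fixes h :: "'a::euclidean_space \<Rightarrow> real"
  assumes h: "integrable lborel h" and z: "\<And>l r. (LINT x|lborel. indicator (box l r) x * h x) = 0"
  shows "AE x in lborel. h x = 0"
proof -
  \<comment> \<open>\<open>ennreal\<close> sends negative numbers to 0, so these are the positive
    and the negative part.\<close>
  define P N where "P x = ennreal (h x)" and "N x = ennreal (- h x)" for x
  have [measurable]: "h \<in> borel_measurable borel" using h by auto
  have meas [measurable]: "P \<in> borel_measurable borel" "N \<in> borel_measurable borel"
    unfolding P_def[abs_def] N_def[abs_def] by measurable
  have "density lborel P = density lborel N"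
  proof (rule measure_eqI_generator_eq)
    let ?E = "range (\<lambda>(a, b). box a b::'a set)"
    let ?A = "\<lambda>n::nat. box (- (real n *\<^sub>R One)) (real n *\<^sub>R One) :: 'a set"
    show "Int_stable ?E" by (auto simp: Int_stable_def box_Int_box)
    show "?E \<subseteq> Pow UNIV" "sets (density lborel P) = sigma_sets UNIV ?E"
      "sets (density lborel N) = sigma_sets UNIV ?E"
      by (simp_all add: borel_eq_box)
    show "range ?A \<subseteq> ?E" "(\<Union>i. ?A i) = UNIV" unfolding UN_box_eq_UNIV by auto
    have fin: "(\<integral>\<^sup>+x. P x * indicator X x \<partial>lborel) < \<infinity>"
      "(\<integral>\<^sup>+x. N x * indicator X x \<partial>lborel) < \<infinity>" if "X \<in> sets borel" for X
    proof -
      have "(\<integral>\<^sup>+x. P x * indicator X x \<partial>lborel) \<le> (\<integral>\<^sup>+x. norm (h x) \<partial>lborel)"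
        by (rule nn_integral_mono) (auto simp: P_def indicator_def intro!: ennreal_leI)
      moreover have "(\<integral>\<^sup>+x. N x * indicator X x \<partial>lborel) \<le> (\<integral>\<^sup>+x. norm (h x) \<partial>lborel)"
        by (rule nn_integral_mono) (auto simp: N_def indicator_def intro!: ennreal_leI)
      moreover have "(\<integral>\<^sup>+x. norm (h x) \<partial>lborel) < \<infinity>" using h by (simp add: integrable_iff_bounded)
      ultimately show "(\<integral>\<^sup>+x. P x * indicator X x \<partial>lborel) < \<infinity>"
        "(\<integral>\<^sup>+x. N x * indicator X x \<partial>lborel) < \<infinity>" by (meson le_less_trans)+
    qed
    show "emeasure (density lborel P) (?A i) \<noteq> \<infinity>" for i
      using fin(1)[of "?A i"] by (simp add: emeasure_density)
    show "emeasure (density lborel P) X = emeasure (density lborel N) X" if XE: "X \<in> ?E" for X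
    proof -
      obtain lr :: "'a \<times> 'a" where "X = (case lr of (a, b) \<Rightarrow> box a b)" using XE by (rule rangeE)
      then have X: "X = box (fst lr) (snd lr)" by (simp add: case_prod_beta)
      let ?f = "\<lambda>x. indicator X x * h x"
      have Xs: "X \<in> sets borel" using X by simp
      have i: "integrable lborel ?f" using integrable_mult_indicator[OF _ h, of X] Xs by simp
      have e: "ennreal (?f x) = P x * indicator X x" "ennreal (- ?f x) = N x * indicator X x" for x
        by (auto simp: P_def N_def indicator_def)
      have "enn2real (\<integral>\<^sup>+x. P x * indicator X x \<partial>lborel) - enn2real (\<integral>\<^sup>+x. N x * indicator X x \<partial>lborel) = 0"
        using z[of "fst lr" "snd lr"] real_lebesgue_integral_def[OF i] unfolding X[symmetric] e by simp
      then have "(\<integral>\<^sup>+x. P x * indicator X x \<partial>lborel) = (\<integral>\<^sup>+x. N x * indicator X x \<partial>lborel)"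
        using fin[OF Xs] ennreal_enn2real by (metis infinity_ennreal_def right_minus_eq)
      then show ?thesis using Xs by (simp add: emeasure_density)
    qed
  qed
  then have "AE x in lborel. P x = N x"
    by (intro sigma_finite_measure.density_unique[OF sigma_finite_lborel]) auto
  then show ?thesis
  proof (rule AE_mp, intro AE_I2 impI)
    fix x assume "P x = N x"
    then show "h x = 0" unfolding P_def N_def by (cases "h x \<ge> 0") (auto simp: ennreal_neg)
  qed
qed

text \<open>Smooth cutoffs converge boundedly to the indicator of a box, so h has integral zero over
  every open box whose closure misses the origin. On one such box this kills h almost everywhere,
  and countably many of them cover the punctured space.\<close>

lemma test_functions_separate:
  fixes h :: "'a::euclidean_space \<Rightarrow> real"
  assumes h: "locally_integrable_punctured h"
    and z: "\<And>\<phi>. \<phi> \<in> test_functions \<Longrightarrow> (LINT x|lborel. h x * \<phi> x) = 0"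
  shows "AE x in lborel. h x = 0"
proof -
  have int: "integrable lborel (\<lambda>x. indicator (cbox l r) x * h x)" if "0 \<notin> cbox l r" for l r :: 'a
    using h that by (auto simp: locally_integrable_punctured_def set_integrable_def)
  have box0: "(LINT x|lborel. indicator (box l r) x * h x) = 0" if "0 \<notin> cbox l r" for l r :: 'a
  proof -
    obtain \<theta> :: "nat \<Rightarrow> 'a \<Rightarrow> real" where \<theta>: "\<And>m k. Ck k (\<theta> m)" "\<And>m x. 0 \<le> \<theta> m x" "\<And>m x. \<theta> m x \<le> 1"
      "\<And>m x. x \<notin> box l r \<Longrightarrow> \<theta> m x = 0" "\<And>x. (\<lambda>m. \<theta> m x) \<longlonglongrightarrow> indicator (box l r) x"
      using box_cutoff[of l r] by metis
    have sub: "box l r \<subseteq> cbox l r" by (rule box_subset_cbox)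
    have "\<theta> m x = 0" if "x \<notin> cbox l r" for m x using \<theta>(4) sub that by blast
    then have t: "\<theta> m \<in> test_functions" for m
      unfolding test_function_iff vanishes_off_def
      using \<theta>(1) that by (intro conjI allI exI[of _ "cbox l r"]) auto
    have [measurable]: "\<theta> m \<in> borel_measurable borel" for m
      using Ck_imp_continuous[OF \<theta>(1)] by (rule borel_measurable_continuous_onI)
    have eq: "h x * \<theta> m x = (indicator (cbox l r) x * h x) * \<theta> m x" for m x
      using \<theta>(4)[of x m] sub by (auto simp: indicator_def)
    have "(\<lambda>m. LINT x|lborel. (indicator (cbox l r) x * h x) * \<theta> m x) \<longlonglongrightarrow>
        (LINT x|lborel. (indicator (cbox l r) x * h x) * indicator (box l r) x)"
    proof (rule integral_dominated_convergence[where w="\<lambda>x. norm (indicator (cbox l r) x * h x)"])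
      note [measurable] = borel_measurable_integrable[OF int[OF that], simplified]
      show "integrable lborel (\<lambda>x. norm (indicator (cbox l r) x * h x))"
        using int[OF that] by (rule integrable_norm)
      show "(\<lambda>x. indicator (cbox l r) x * h x * indicator (box l r) x) \<in> borel_measurable lborel"
        by measurable
      show "(\<lambda>x. indicator (cbox l r) x * h x * \<theta> m x) \<in> borel_measurable lborel" for m
        by measurable
      show "AE x in lborel. (\<lambda>m. indicator (cbox l r) x * h x * \<theta> m x) \<longlonglongrightarrow>
          indicator (cbox l r) x * h x * indicator (box l r) x"
        by (intro AE_I2 tendsto_mult_left \<theta>(5))
      show "AE x in lborel. norm (indicator (cbox l r) x * h x * \<theta> m x) \<le> norm (indicator (cbox l r) x * h x)" for m
        using \<theta>(2)[of m] \<theta>(3)[of m]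
        by (intro AE_I2, unfold norm_mult) (intro mult_left_le, auto)
    qed
    moreover have "(LINT x|lborel. (indicator (cbox l r) x * h x) * \<theta> m x) = 0" for m
      using z[OF t[of m]] by (simp only: eq)
    ultimately have "(LINT x|lborel. (indicator (cbox l r) x * h x) * indicator (box l r) x) = 0"
      by (simp add: LIMSEQ_const_iff)
    moreover have "(indicator (cbox l r) x * h x) * indicator (box l r) x = indicator (box l r) x * h x" for x
      using sub by (auto simp: indicator_def)
    ultimately show ?thesis by simp
  qed
  have AEbox: "AE x in lborel. x \<in> cbox l r \<longrightarrow> h x = 0" if 0: "0 \<notin> cbox l r" for l r :: 'a
  proof -
    have null: "AE x in lborel. x \<notin> cbox l r - box l r"
      by (rule AE_not_in) (auto simp: null_sets_def emeasure_Diff box_subset_cbox emeasure_lborel_cbox_eq emeasure_lborel_box_eq)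
    have ib: "integrable lborel (\<lambda>x. indicator (box l r) x * h x)"
    proof -
      have "integrable lborel (\<lambda>x. indicator (box l r) x *\<^sub>R (indicator (cbox l r) x * h x))"
        by (intro integrable_mult_indicator int 0) auto
      moreover have "indicator (box l r) x *\<^sub>R (indicator (cbox l r) x * h x) = indicator (box l r) x * h x" for x
        using box_subset_cbox[of l r] by (auto simp: indicator_def)
      ultimately show ?thesis by (simp only:)
    qed
    have "AE x in lborel. indicator (box l r) x * h x = 0"
    proof (rule AE_zero_if_box_integrals_zero[OF ib])
      fix l' r' :: 'a
      obtain l'' r'' where i: "box l' r' \<inter> box l r = box l'' r''" using box_Int_box by blast
      have "0 \<notin> box l r" using 0 box_subset_cbox[of l r] by auto
      show "(LINT x|lborel. indicator (box l' r') x * (indicator (box l r) x * h x)) = 0"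
      proof (cases "box l'' r'' = {}")
        \<comment> \<open>A closed box can be nonempty although the open box with the same corners
          is empty, and it could then contain the origin. So this case is kept apart from
          \<open>box0\<close>.\<close>
        case True
        then have "indicator (box l' r') x * (indicator (box l r) x * h x) = 0" for x
          using i by (auto simp: indicator_def)
        then show ?thesis by (simp only: integral_zero)
      next
        case False
        then have "cbox l'' r'' \<subseteq> cbox l r"
          using i box_subset_cbox[of l r] closure_minimal[of "box l'' r''" "cbox l r"] closure_box[of l'' r'']
          by (auto simp: closed_cbox)
        then have "0 \<notin> cbox l'' r''" using 0 by auto
        from box0[OF this] i show ?thesis
          by (simp add: indicator_inter_arith[symmetric] mult.assoc[symmetric])
      qed
    qed
    with null show ?thesis by eventually_elim (auto simp: indicator_def)
  qed
  obtain D where D: "countable D" "D \<subseteq> Pow (- {0::'a})" "\<And>X. X \<in> D \<Longrightarrow> \<exists>a b. X = cbox a b" "\<Union>D = - {0}"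
    using open_countable_Union_open_cbox[of "- {0::'a}"] by (auto simp: open_Compl)
  have "AE x in lborel. \<forall>X\<in>D. x \<in> X \<longrightarrow> h x = 0"
  proof (subst AE_ball_countable[OF D(1)], intro ballI)
    fix X assume X: "X \<in> D"
    then obtain a b where "X = cbox a b" using D(3) by blast
    with X D(2) AEbox[of a b] show "AE x in lborel. x \<in> X \<longrightarrow> h x = 0" by auto
  qed
  moreover have "AE x in lborel. x \<noteq> (0::'a)" by (rule AE_lborel_singleton)
  ultimately show ?thesis
  proof eventually_elim
    case (elim x)
    then have "x \<in> \<Union>D" using D(4) by auto
    with elim show ?case by auto
  qed
qed

lemma locally_integrable_bounded_linear:
  fixes f :: "'a::euclidean_space \<Rightarrow> 'b::{banach, second_countable_topology}"
    and T :: "'b \<Rightarrow> 'c::{banach, second_countable_topology}"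
  assumes "bounded_linear T" "locally_integrable_punctured f"
  shows "locally_integrable_punctured (\<lambda>x. T (f x))"
  unfolding locally_integrable_punctured_def set_integrable_def
proof (intro allI impI)
  fix K :: "'a set" assume "compact K \<and> 0 \<notin> K"
  then have "integrable lborel (\<lambda>x. indicator K x *\<^sub>R f x)"
    using assms(2) by (auto simp: locally_integrable_punctured_def set_integrable_def)
  from integrable_bounded_linear[OF assms(1) this]
  show "integrable lborel (\<lambda>x. indicator K x *\<^sub>R T (f x))"
    by (simp add: linear_cmul[OF bounded_linear.linear[OF assms(1)]])
qed

lemma locally_integrable_diff:
  fixes f g :: "'a::euclidean_space \<Rightarrow> 'b::{banach, second_countable_topology}"
  assumes "locally_integrable_punctured f" "locally_integrable_punctured g"
  shows "locally_integrable_punctured (\<lambda>x. f x - g x)"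
  using assms unfolding locally_integrable_punctured_def by (auto intro: set_integral_diff)

lemma integrable_locally_integrable_mult:
  fixes f \<phi> :: "'a::euclidean_space \<Rightarrow> real"
  assumes f: "locally_integrable_punctured f" and c: "continuous_on UNIV \<phi>"
    and K: "compact K" "0 \<notin> K" "vanishes_off K \<phi>"
  shows "integrable lborel (\<lambda>x. f x * \<phi> x)"
proof -
  have "bounded (\<phi> ` K)"
    using K(1) c by (intro compact_imp_bounded compact_continuous_image) (auto intro: continuous_on_subset)
  then obtain B where B: "\<And>x. x \<in> K \<Longrightarrow> \<bar>\<phi> x\<bar> \<le> B" unfolding bounded_iff by auto
  have i: "integrable lborel (\<lambda>x. indicator K x * f x)"
    using f K by (auto simp: locally_integrable_punctured_def set_integrable_def)
  have [measurable]: "\<phi> \<in> borel_measurable borel" using c by (rule borel_measurable_continuous_onI)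
  note [measurable] = borel_measurable_integrable[OF i, simplified]
  have "integrable lborel (\<lambda>x. (indicator K x * f x) * \<phi> x)"
  proof (rule Bochner_Integration.integrable_bound[OF integrable_mult_right[OF i, of "\<bar>B\<bar>"]])
    show "AE x in lborel. norm (indicator K x * f x * \<phi> x) \<le> norm (\<bar>B\<bar> * (indicator K x * f x))"
    proof (intro AE_I2)
      fix x
      show "norm (indicator K x * f x * \<phi> x) \<le> norm (\<bar>B\<bar> * (indicator K x * f x))"
        using mult_right_mono[of "\<bar>\<phi> x\<bar>" "\<bar>B\<bar>" "\<bar>f x\<bar>"] B[of x]
        by (cases "x \<in> K") (auto simp: abs_mult mult.commute)
    qed
  qed measurable
  moreover have "indicator K x * f x * \<phi> x = f x * \<phi> x" for x
    using K(3) by (auto simp: vanishes_off_def indicator_def)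
  ultimately show ?thesis by simp
qed

text \<open>\<open>weak_nabla\<close> is an arbitrary choice; uniqueness lets any weak derivative
  found by computation stand in for it under an integral. Linear functionals T reduce the vector
  case to scalar functions: the first component, or the inner product of the second with a basis
  vector.\<close>

lemma has_weak_nabla_unique:
  fixes u :: "'a::euclidean_space \<Rightarrow> real"
  assumes G: "has_weak_nabla l u G" and H: "has_weak_nabla l u H"
  shows "AE x in lborel. G x = H x"
proof -
  have li: "locally_integrable_punctured G" "locally_integrable_punctured H"
    using G H by (auto simp: has_weak_nabla_def)
  have sep: "AE x in lborel. T (G x) = T (H x)"
    if T: "bounded_linear T" and e: "\<And>\<phi>. \<phi> \<in> test_functions \<Longrightarrow>
      (LINT x|lborel. T (G x) * \<phi> x) = (LINT x|lborel. T (H x) * \<phi> x)" for T :: "real \<times> 'a \<Rightarrow> real"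
  proof -
    note lT = locally_integrable_bounded_linear[OF T li(1)] locally_integrable_bounded_linear[OF T li(2)]
    have "AE x in lborel. T (G x) - T (H x) = 0"
    proof (rule test_functions_separate[OF locally_integrable_diff[OF lT]])
      fix \<phi> :: "'a \<Rightarrow> real" assume \<phi>: "\<phi> \<in> test_functions"
      then obtain K where K: "compact K" "0 \<notin> K" "vanishes_off K \<phi>" and "Ck 0 \<phi>"
        unfolding test_function_iff by blast
      then have c: "continuous_on UNIV \<phi>" by simp
      show "(LINT x|lborel. (T (G x) - T (H x)) * \<phi> x) = 0"
        using e[OF \<phi>] Bochner_Integration.integral_diff[OF integrable_locally_integrable_mult[OF lT(1) c K]
          integrable_locally_integrable_mult[OF lT(2) c K]]
        by (simp add: left_diff_distrib)
    qed
    then show ?thesis by simp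
  qed
  show ?thesis
  proof (cases "even l")
    case True
    have "AE x in lborel. fst (G x) = fst (H x)"
      using G H True by (intro sep bounded_linear_fst) (auto simp: has_weak_nabla_def)
    then show ?thesis
      using G H True by (auto simp: has_weak_nabla_def prod_eq_iff)
  next
    case False
    have "AE x in lborel. snd (G x) \<bullet> b = snd (H x) \<bullet> b" if "b \<in> Basis" for b
    proof (rule sep)
      show "bounded_linear (\<lambda>y::real \<times> 'a. snd y \<bullet> b)"
        by (intro bounded_linear_compose[OF bounded_linear_inner_left bounded_linear_snd])
      show "(LINT x|lborel. (snd (G x) \<bullet> b) * \<phi> x) = (LINT x|lborel. (snd (H x) \<bullet> b) * \<phi> x)"
        if \<phi>: "\<phi> \<in> test_functions" for \<phi>
        using G H False \<phi> \<open>b \<in> Basis\<close> unfolding has_weak_nabla_def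
        by (metis (no_types, lifting) neg_equal_iff_equal)
    qed
    then have "AE x in lborel. \<forall>b\<in>Basis. snd (G x) \<bullet> b = snd (H x) \<bullet> b"
      by (simp add: AE_ball_countable countable_finite)
    then show ?thesis
    proof eventually_elim
      case (elim x)
      then have "snd (G x) = snd (H x)" by (auto intro: euclidean_eqI)
      with G H False show ?case by (auto simp: has_weak_nabla_def prod_eq_iff)
    qed
  qed
qed

section \<open>Radial functions in logarithmic coordinates\<close>

definition sphere_area :: "'a::euclidean_space itself \<Rightarrow> real" where
  "sphere_area _ = real DIM('a) * unit_ball_vol (real DIM('a))"

lemma sphere_area_pos: "sphere_area TYPE('a::euclidean_space) > 0"
  by (simp add: sphere_area_def)

text \<open>With the minus sign, the half-lines to the right pull back to balls, whose measures are
  finite and known. Two measures on the line with the same finite values on these half-lines are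
  equal, so integration in polar coordinates is obtained from the volume of balls alone.\<close>

lemma distr_neg_ln_norm:
  "distr lborel borel (\<lambda>x::'a::euclidean_space. - ln (norm x)) =
    density lborel (\<lambda>s. ennreal (sphere_area TYPE('a) * exp (- (real DIM('a) * s))))"
  (is "?L = ?R")
proof (rule measure_eqI_lessThan)
  let ?n = "real DIM('a)" and ?w = "unit_ball_vol (real DIM('a))"
  have n: "?n > 0" by simp
  have L: "emeasure ?L {s<..} = ennreal (?w * exp (- ?n * s))" for s
  proof -
    have "emeasure ?L {s<..} = emeasure lborel {x::'a. - ln (norm x) > s}"
      by (subst emeasure_distr) (auto simp: vimage_def)
    also have "\<dots> = emeasure lborel (ball (0::'a) (exp (- s)))"
    proof (rule emeasure_eq_AE)
      \<comment> \<open>The origin is left out: the default value of \<open>ln\<close> at 0 need not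
        fit the equivalence.\<close>
      show "AE x in lborel. (x \<in> {x::'a. - ln (norm x) > s}) = (x \<in> ball 0 (exp (- s)))"
        using AE_lborel_singleton[of "0::'a"]
      proof eventually_elim
        case (elim x)
        have "ln (norm x) < - s \<longleftrightarrow> norm x < exp (- s)"
          using elim by (metis exp_less_mono exp_ln zero_less_norm_iff exp_less_cancel_iff)
        then show ?case by (auto simp: dist_norm)
      qed
    qed auto
    also have "\<dots> = ennreal (measure lborel (ball (0::'a) (exp (- s))))"
      using emeasure_bounded_finite[of "ball (0::'a) (exp (- s))"]
      by (intro emeasure_eq_ennreal_measure) auto
    also have "measure lborel (ball (0::'a) (exp (- s))) = ?w * exp (- ?n * s)"
      by (simp add: content_ball exp_of_nat_mult[symmetric])
    finally show ?thesis .
  qed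
  have R: "emeasure ?R {s<..} = ennreal (?w * exp (- ?n * s))" for s
  proof -
    have "emeasure ?R {s<..} = (\<integral>\<^sup>+x. ennreal (?n * ?w * exp (- (?n * x))) * indicator {s<..} x \<partial>lborel)"
      by (subst emeasure_density) (auto simp: sphere_area_def)
    also have "\<dots> = (\<integral>\<^sup>+x. ennreal (?n * ?w * exp (- (?n * x))) * indicator {s..} x \<partial>lborel)"
      using AE_lborel_singleton[of s] by (intro nn_integral_cong_AE) (auto simp: indicator_def)
    also have "\<dots> = ennreal (0 - (- ?w * exp (- (?n * s))))"
    proof (rule nn_integral_FTC_atLeast)
      show "((\<lambda>x. - ?w * exp (- (?n * x))) has_real_derivative ?n * ?w * exp (- (?n * x))) (at x)" for x
        by (auto intro!: derivative_eq_intros)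
      have "filterlim (\<lambda>x. ?n * x) at_top at_top"
        using n by (intro filterlim_tendsto_pos_mult_at_top[OF tendsto_const]) (auto simp: filterlim_ident)
      then have "((\<lambda>x. exp (- (?n * x))) \<longlongrightarrow> 0) at_top"
        by (intro filterlim_compose[OF exp_at_bot]) (simp add: filterlim_uminus_at_top)
      then show "((\<lambda>x. - ?w * exp (- (?n * x))) \<longlongrightarrow> 0) at_top"
        by (rule tendsto_mult_right_zero)
    qed (auto intro!: mult_nonneg_nonneg)
    finally show ?thesis by simp
  qed
  show "emeasure ?L {s<..} < \<infinity>" for s using L by simp
  show "emeasure ?L {s<..} = emeasure ?R {s<..}" for s by (simp only: L R)
qed auto

lemma nn_integral_ln_norm:
  fixes f :: "real \<Rightarrow> ennreal"
  assumes [measurable]: "f \<in> borel_measurable borel"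
  shows "(\<integral>\<^sup>+x. f (ln (norm (x::'a::euclidean_space))) \<partial>lborel) =
    (\<integral>\<^sup>+s. ennreal (sphere_area TYPE('a) * exp (real DIM('a) * s)) * f s \<partial>lborel)"
proof -
  have "(\<integral>\<^sup>+x. f (ln (norm (x::'a))) \<partial>lborel) =
      (\<integral>\<^sup>+s. f (- s) \<partial>distr lborel borel (\<lambda>x::'a. - ln (norm x)))"
    by (subst nn_integral_distr) auto
  also have "\<dots> = (\<integral>\<^sup>+s. ennreal (sphere_area TYPE('a) * exp (- (real DIM('a) * s))) * f (- s) \<partial>lborel)"
    unfolding distr_neg_ln_norm by (subst nn_integral_density) auto
  also have "\<dots> = (\<integral>\<^sup>+s. ennreal (sphere_area TYPE('a) * exp (real DIM('a) * s)) * f s \<partial>lborel)"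
    by (subst nn_integral_real_affine[where c="-1" and t=0]) auto
  finally show ?thesis .
qed

text \<open>The relation between c, b and q is scale invariance: the powers of |x| multiply to
  |x|^(-n), which cancels the Jacobian exp (n s), and an unweighted integral over the line remains.
  Stated for nonnegative integrals, it gives both the value and the equivalence of
  integrability.\<close>

lemma nn_integral_radial_weight:
  fixes G :: "'a::euclidean_space \<Rightarrow> 'b::real_normed_vector"
  assumes [measurable]: "Z \<in> borel_measurable borel"
    and G: "AE x in lborel. norm (G x) = norm x powr (-b) * \<bar>Z (ln (norm x))\<bar>"
    and c: "c + real DIM('a) = b * q"
  shows "(\<integral>\<^sup>+x. ennreal (norm x powr c * norm (G x) powr q) \<partial>lborel) =
    ennreal (sphere_area TYPE('a)) * (\<integral>\<^sup>+s. ennreal (\<bar>Z s\<bar> powr q) \<partial>lborel)"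
proof -
  let ?f = "\<lambda>s. ennreal (exp (- (real DIM('a) * s)) * \<bar>Z s\<bar> powr q)"
  have "(\<integral>\<^sup>+x. ennreal (norm x powr c * norm (G x) powr q) \<partial>lborel) = (\<integral>\<^sup>+x. ?f (ln (norm (x::'a))) \<partial>lborel)"
  proof (rule nn_integral_cong_AE)
    show "AE x in lborel. ennreal (norm x powr c * norm (G x) powr q) = ?f (ln (norm (x::'a)))"
      using G AE_lborel_singleton[of "0::'a"]
    proof eventually_elim
      case (elim x)
      have "norm x powr c * norm (G x) powr q =
          norm x powr c * (norm x powr (-b)) powr q * \<bar>Z (ln (norm x))\<bar> powr q"
        using elim by (simp add: powr_mult)
      also have "norm x powr c * (norm x powr (-b)) powr q = norm x powr (c - b * q)"
        by (simp add: powr_powr powr_add[symmetric])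
      also have "c - b * q = - real DIM('a)" using c by simp
      also have "norm x powr (- real DIM('a)) = exp (- (real DIM('a) * ln (norm x)))"
        using elim by (simp add: powr_def)
      finally show ?case by simp
    qed
  qed
  also have "\<dots> = (\<integral>\<^sup>+s. ennreal (sphere_area TYPE('a) * exp (real DIM('a) * s)) * ?f s \<partial>lborel)"
    by (rule nn_integral_ln_norm) measurable
  also have "\<dots> = (\<integral>\<^sup>+s. ennreal (sphere_area TYPE('a)) * ennreal (\<bar>Z s\<bar> powr q) \<partial>lborel)"
  proof (rule nn_integral_cong)
    fix s
    have "exp (real DIM('a) * s) * exp (- (real DIM('a) * s)) = 1" by (simp add: exp_minus)
    then have "(sphere_area TYPE('a) * exp (real DIM('a) * s)) * (exp (- (real DIM('a) * s)) * \<bar>Z s\<bar> powr q)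
       = sphere_area TYPE('a) * \<bar>Z s\<bar> powr q" by (metis mult.assoc mult.left_commute mult.right_neutral)
    then show "ennreal (sphere_area TYPE('a) * exp (real DIM('a) * s)) * ?f s =
        ennreal (sphere_area TYPE('a)) * ennreal (\<bar>Z s\<bar> powr q)"
      using sphere_area_pos[where 'a='a] by (simp add: ennreal_mult'[symmetric])
  qed
  also have "\<dots> = ennreal (sphere_area TYPE('a)) * (\<integral>\<^sup>+s. ennreal (\<bar>Z s\<bar> powr q) \<partial>lborel)"
    by (rule nn_integral_cmult) measurable
  finally show ?thesis .
qed

lemma weighted_int_radial:
  fixes G :: "'a::euclidean_space \<Rightarrow> 'b::{real_normed_vector,second_countable_topology}"
  assumes Z: "Z \<in> borel_measurable borel" and [measurable]: "G \<in> borel_measurable borel"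
    and G: "AE x in lborel. norm (G x) = norm x powr (-b) * \<bar>Z (ln (norm x))\<bar>"
    and c: "c + real DIM('a) = b * q"
  shows "weighted_int c q G = sphere_area TYPE('a) * (LINT s|lborel. \<bar>Z s\<bar> powr q)"
    and "integrable lborel (\<lambda>x. norm x powr c * norm (G x) powr q) \<longleftrightarrow> integrable lborel (\<lambda>s. \<bar>Z s\<bar> powr q)"
proof -
  note [measurable] = Z
  note e = nn_integral_radial_weight[OF Z G c]
  have "weighted_int c q G = enn2real (\<integral>\<^sup>+x. ennreal (norm x powr c * norm (G x) powr q) \<partial>lborel)"
    unfolding weighted_int_def by (rule integral_eq_nn_integral) auto
  also have "\<dots> = sphere_area TYPE('a) * enn2real (\<integral>\<^sup>+s. ennreal (\<bar>Z s\<bar> powr q) \<partial>lborel)"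
    using sphere_area_pos[where 'a='a] by (simp add: e enn2real_mult)
  also have "enn2real (\<integral>\<^sup>+s. ennreal (\<bar>Z s\<bar> powr q) \<partial>lborel) = (LINT s|lborel. \<bar>Z s\<bar> powr q)"
    by (rule integral_eq_nn_integral[symmetric]) auto
  finally show "weighted_int c q G = sphere_area TYPE('a) * (LINT s|lborel. \<bar>Z s\<bar> powr q)" .
  have "integrable lborel (\<lambda>x. norm x powr c * norm (G x) powr q) \<longleftrightarrow>
      (\<integral>\<^sup>+x. ennreal (norm x powr c * norm (G x) powr q) \<partial>lborel) < \<infinity>"
    by (simp add: integrable_iff_bounded)
  also have "\<dots> \<longleftrightarrow> (\<integral>\<^sup>+s. ennreal (\<bar>Z s\<bar> powr q) \<partial>lborel) < \<infinity>"
    unfolding e using sphere_area_pos[where 'a='a] by (auto simp: ennreal_mult_less_top)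
  also have "\<dots> \<longleftrightarrow> integrable lborel (\<lambda>s. \<bar>Z s\<bar> powr q)"
    by (simp add: integrable_iff_bounded)
  finally show "integrable lborel (\<lambda>x. norm x powr c * norm (G x) powr q) \<longleftrightarrow> integrable lborel (\<lambda>s. \<bar>Z s\<bar> powr q)" .
qed

text \<open>In the coordinate \<open>s = ln |x|\<close>, applied to \<open>|x|\<^sup>-\<^sup>b w(s)\<close>, the Laplacian becomes
  \<open>(D - b) (D - b + n - 2)\<close> up to the factor \<open>|x|\<^sup>-\<^sup>b\<^sup>-\<^sup>2\<close>, and the gradient becomes \<open>D - b\<close>.
  The number \<open>ef_root n a l\<close> is the root of the factor that leads from \<open>\<nabla>\<^sup>l\<close> to \<open>\<nabla>\<^sup>l\<^sup>+\<^sup>1\<close>.\<close>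

definition ef_root :: "nat \<Rightarrow> real \<Rightarrow> nat \<Rightarrow> real" where
  "ef_root n a l = a + real l + (if even l then 0 else 1 - real n)"

primrec ef_chain :: "nat \<Rightarrow> real \<Rightarrow> nat \<Rightarrow> (real \<Rightarrow> real) \<Rightarrow> real \<Rightarrow> real" where
  "ef_chain n a 0 w = w"
| "ef_chain n a (Suc l) w = (\<lambda>s. deriv (ef_chain n a l w) s - ef_root n a l * ef_chain n a l w s)"

text \<open>The Emden-Fowler substitution. With the value 0 at the origin, a compactly supported
  profile gives a function that vanishes near the origin.\<close>

definition ef :: "real \<Rightarrow> (real \<Rightarrow> real) \<Rightarrow> 'a::euclidean_space \<Rightarrow> real" where
  "ef a w x = (if x = 0 then 0 else norm x powr (-a) * w (ln (norm x)))"

text \<open>The inverse of \<open>ef a\<close> on radial functions, read off along one fixed axis.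
  It is also applied to partial derivatives, which are not radial.\<close>

definition ef_profile :: "real \<Rightarrow> ('a::euclidean_space \<Rightarrow> real) \<Rightarrow> real \<Rightarrow> real" where
  "ef_profile a v s = exp (a * s) * v (exp s *\<^sub>R (SOME e. e \<in> Basis))"

text \<open>The unit vector of R x R^n along which the l-th derivative of a radial function points:
  the scalar axis for even l, the radial direction for odd l.\<close>

definition ef_dir :: "nat \<Rightarrow> 'a::euclidean_space \<Rightarrow> real \<times> 'a" where
  "ef_dir l x = (if even l then (1, 0) else (0, x /\<^sub>R norm x))"

section \<open>Derivatives of radial functions as operators in one variable\<close>

lemma some_Basis: "(SOME e. e \<in> Basis) \<in> (Basis :: 'a::euclidean_space set)"
  by (simp add: some_in_eq)

lemma norm_some_Basis: "norm (SOME e::'a::euclidean_space. e \<in> Basis) = 1"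
  by (simp add: some_Basis)

lemma ef_eq_iff_profile:
  fixes F :: "'a::euclidean_space \<Rightarrow> real"
  assumes "\<And>x. x \<noteq> 0 \<Longrightarrow> F x = ef a Z x"
  shows "Z = ef_profile a F"
proof
  fix s
  define e :: 'a where "e = (SOME e. e \<in> Basis)"
  have [simp]: "norm e = 1" by (simp add: e_def norm_some_Basis)
  then have [simp]: "e \<noteq> 0" by (metis norm_zero zero_neq_one)
  have "F (exp s *\<^sub>R e) = exp s powr (-a) * Z s"
    by (subst assms) (auto simp: ef_def)
  then show "Z s = ef_profile a F s"
    by (simp add: ef_profile_def e_def powr_def exp_minus field_simps)
qed

lemma radial_eq_ef:
  fixes F :: "'a::euclidean_space \<Rightarrow> real"
  assumes "radial F" "x \<noteq> 0"
  shows "F x = ef a (ef_profile a F) x"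
proof -
  define e :: 'a where "e = (SOME e. e \<in> Basis)"
  have [simp]: "norm e = 1" using norm_some_Basis[where 'a='a] by (auto simp: e_def)
  have "F x = F (norm x *\<^sub>R e)" using assms by (intro assms(1)[unfolded radial_def, rule_format]) auto
  with assms(2) show ?thesis
    by (simp add: ef_def ef_profile_def e_def powr_def exp_minus field_simps)
qed

text \<open>The chain rule applied to |x|^(-a) Z (ln |x|) produces the first order factor Z' - a Z.
  The exponent drops by 2 and not by 1 because the vector x in the inner product is not
  normalised.\<close>

lemma ef_has_derivative:
  fixes x :: "'a::euclidean_space"
  assumes "x \<noteq> 0" and Z: "(Z has_real_derivative Z') (at (ln (norm x)))"
  shows "(ef a Z has_derivative (\<lambda>h. (norm x powr (-(a+2)) * (Z' - a * Z (ln (norm x)))) * (x \<bullet> h))) (at x)"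
proof -
  have nx: "norm x > 0" using assms by simp
  have n: "(norm has_derivative (\<lambda>h. (x \<bullet> h) / norm x)) (at x)"
    using has_derivative_norm[OF assms(1)] by (simp add: sgn_div_norm inner_commute field_simps)
  have D: "((\<lambda>r. r powr (-a) * Z (ln r)) has_real_derivative
      (norm x powr (-(a+1)) * (Z' - a * Z (ln (norm x))))) (at (norm x))"
  proof -
    have "((\<lambda>r. r powr (-a)) has_real_derivative (-a) * norm x powr (-a - 1)) (at (norm x))"
      using nx by (rule has_real_derivative_powr)
    moreover have "((\<lambda>r. Z (ln r)) has_real_derivative Z' * (1 / norm x)) (at (norm x))"
      using nx by (intro DERIV_chain2[where f=Z and g=ln, OF Z]) (auto intro!: derivative_eq_intros)
    ultimately have "((\<lambda>r. r powr (-a) * Z (ln r)) has_real_derivative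
       (-a) * norm x powr (-a - 1) * Z (ln (norm x)) + Z' * (1 / norm x) * norm x powr (-a)) (at (norm x))"
      by (rule DERIV_mult)
    moreover have "norm x powr (-a) * (1 / norm x) = norm x powr (-a - 1)"
      using nx by (simp add: powr_diff)
    then have "Z' * (1 / norm x) * norm x powr (-a) = Z' * norm x powr (-a - 1)"
      by (metis mult.assoc mult.commute)
    moreover have "- a - 1 = - 1 - a" by simp
    ultimately show ?thesis by (simp add: algebra_simps)
  qed
  from has_derivative_compose[OF n D[unfolded has_field_derivative_def]]
  have "((\<lambda>y. norm y powr (-a) * Z (ln (norm y))) has_derivative
     (\<lambda>h. (norm x powr (-(a+1)) * (Z' - a * Z (ln (norm x)))) * ((x \<bullet> h) / norm x))) (at x)"
    by simp
  moreover have "norm x powr (-(a+2)) = norm x powr (-(a+1) - 1)" by (simp add: algebra_simps)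
  then have "norm x powr (-(a+1)) / norm x = norm x powr (-(a+2))"
    using nx by (simp only: powr_diff) simp
  then have "(norm x powr (-(a+1)) * c) * (d / norm x) = (norm x powr (-(a+2)) * c) * d" for c d
    by (metis (no_types, lifting) mult.assoc mult.commute times_divide_eq_right)
  ultimately have "((\<lambda>y. norm y powr (-a) * Z (ln (norm y))) has_derivative
     (\<lambda>h. (norm x powr (-(a+2)) * (Z' - a * Z (ln (norm x)))) * (x \<bullet> h))) (at x)"
    by simp
  then show ?thesis
    by (rule has_derivative_transform_within_open[of _ _ x UNIV "-{0}"]) (use assms in \<open>auto simp: ef_def open_Compl\<close>)
qed

lemma ef_profile_has_derivative:
  fixes F :: "'a::euclidean_space \<Rightarrow> real"
  assumes F: "Ck (Suc j) F"
  shows "(ef_profile a F has_real_derivative deriv (ef_profile a F) s) (at s)"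
proof -
  let ?e = "SOME e::'a. e \<in> Basis"
  have "((\<lambda>s. F (exp s *\<^sub>R ?e)) has_derivative
      (\<lambda>h. frechet_derivative F (at (exp s *\<^sub>R ?e)) ((exp s * h) *\<^sub>R ?e))) (at s)"
    by (rule has_derivative_compose[OF _ Ck_Suc_has_derivative[OF F]])
      (auto intro!: derivative_eq_intros)
  moreover have "frechet_derivative F (at y) (c *\<^sub>R ?e) = c * frechet_derivative F (at y) ?e" for y c
    using has_derivative_linear[OF Ck_Suc_has_derivative[OF F, of y]] by (simp add: linear_cmul)
  then have "(\<lambda>h. frechet_derivative F (at (exp s *\<^sub>R ?e)) ((exp s * h) *\<^sub>R ?e)) =
      (*) (exp s * frechet_derivative F (at (exp s *\<^sub>R ?e)) ?e)"
    by (auto simp: fun_eq_iff)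
  ultimately have "((\<lambda>s. F (exp s *\<^sub>R ?e)) has_real_derivative
      (exp s * frechet_derivative F (at (exp s *\<^sub>R ?e)) ?e)) (at s)"
    by (simp add: has_field_derivative_def)
  then have "\<exists>d. (ef_profile a F has_real_derivative d) (at s)"
    unfolding ef_profile_def[abs_def]
    by (intro exI) (rule DERIV_mult, auto intro!: derivative_eq_intros)
  then show ?thesis by (metis DERIV_imp_deriv)
qed

lemma partial_radial:
  fixes F :: "'a::euclidean_space \<Rightarrow> real"
  assumes F: "Ck (Suc j) F" and Z: "\<And>x. x \<noteq> 0 \<Longrightarrow> F x = ef a Z x" and x: "x \<noteq> 0"
  shows "partial b F x = (x \<bullet> b) * ef (a + 2) (\<lambda>s. deriv Z s - a * Z s) x"
proof -
  have "(Z has_real_derivative deriv Z (ln (norm x))) (at (ln (norm x)))"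
    using ef_profile_has_derivative[OF F] ef_eq_iff_profile[OF Z] by simp
  from ef_has_derivative[OF x this, of a]
  have "(F has_derivative (\<lambda>h. (norm x powr (-(a+2)) * (deriv Z (ln (norm x)) - a * Z (ln (norm x)))) * (x \<bullet> h))) (at x)"
    by (rule has_derivative_transform_within_open[of _ _ x UNIV "-{0}"]) (use x Z in \<open>auto simp: open_Compl\<close>)
  from partial_eqI[OF this, of b] x show ?thesis by (simp add: ef_def)
qed

text \<open>Along the chosen axis, the partial derivative in the direction of that axis is the whole
  gradient. So D - a maps a profile to the profile of a function with one derivative less, and the
  regularity of the new profile comes for free.\<close>

lemma ef_profile_partial:
  fixes F :: "'a::euclidean_space \<Rightarrow> real"
  assumes F: "Ck (Suc j) F" and Z: "\<And>x. x \<noteq> 0 \<Longrightarrow> F x = ef a Z x"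
  shows "(\<lambda>s. deriv Z s - a * Z s) = ef_profile (a + 1) (partial (SOME e. e \<in> Basis) F)"
proof
  fix s
  define e :: 'a where "e = (SOME e. e \<in> Basis)"
  have "e \<in> Basis" by (simp add: e_def some_Basis)
  then have e: "norm e = 1" "e \<noteq> 0" "e \<bullet> e = 1" by (auto dest: nonzero_Basis)
  have "partial e F (exp s *\<^sub>R e) = exp s * (exp s powr (-(a+2)) * (deriv Z s - a * Z s))"
    using partial_radial[OF F Z, of "exp s *\<^sub>R e" e] e by (simp add: ef_def)
  moreover have "exp ((a + 1) * s) * (exp s * exp s powr (-(a+2))) = 1"
    by (simp add: powr_def exp_add[symmetric] algebra_simps)
  ultimately show "deriv Z s - a * Z s = ef_profile (a + 1) (partial (SOME e. e \<in> Basis) F) s"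
    by (simp add: ef_profile_def e_def[symmetric] mult.assoc[symmetric])
qed

text \<open>Differentiate (x . b) * \<open>ef (a + 2) Z1 x\<close> in the direction b and sum over
  b. The first factor contributes n Z1, the second |x|^2 times the profile (D - a - 2) Z1 at the
  exponent a + 4. Together they form the factor D - (a + 2 - n).\<close>

lemma laplacian_radial:
  fixes F :: "'a::euclidean_space \<Rightarrow> real"
  assumes F: "Ck (Suc (Suc j)) F" and Z: "\<And>x. x \<noteq> 0 \<Longrightarrow> F x = ef a Z x" and x: "x \<noteq> 0"
  defines "Z1 \<equiv> \<lambda>s. deriv Z s - a * Z s"
  shows "laplacian F x = ef (a + 2) (\<lambda>s. deriv Z1 s - (a + 2 - real DIM('a)) * Z1 s) x"
proof -
  let ?s = "ln (norm x)"
  have Z1: "(Z1 has_real_derivative deriv Z1 ?s) (at ?s)"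
    using ef_profile_has_derivative[OF Ck_partial[OF F some_Basis]] ef_profile_partial[OF F Z]
    by (simp add: Z1_def)
  have pp: "partial b (partial b F) x = ef (a + 2) Z1 x +
      (x \<bullet> b) * (x \<bullet> b) * ef (a + 4) (\<lambda>s. deriv Z1 s - (a + 2) * Z1 s) x" if b: "b \<in> Basis" for b
  proof -
    have "((\<lambda>y. (y \<bullet> b) * ef (a + 2) Z1 y) has_derivative
       (\<lambda>h. (x \<bullet> b) * ((norm x powr (-(a+2+2)) * (deriv Z1 ?s - (a + 2) * Z1 ?s)) * (x \<bullet> h)) +
         (h \<bullet> b) * ef (a + 2) Z1 x)) (at x)"
      by (intro has_derivative_mult ef_has_derivative[OF x Z1] bounded_linear_imp_has_derivative bounded_linear_inner_left)
    then have "(partial b F has_derivative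
       (\<lambda>h. (x \<bullet> b) * ((norm x powr (-(a+2+2)) * (deriv Z1 ?s - (a + 2) * Z1 ?s)) * (x \<bullet> h)) +
         (h \<bullet> b) * ef (a + 2) Z1 x)) (at x)"
      by (rule has_derivative_transform_within_open[of _ _ x UNIV "-{0}"])
        (use x partial_radial[OF F Z] in \<open>auto simp: open_Compl Z1_def\<close>)
    moreover have "- 4 - a = - a - 4" by simp
    ultimately show ?thesis using partial_eqI[of "partial b F" _ x b] b x by (simp add: ef_def)
  qed
  have "laplacian F x = real DIM('a) * ef (a + 2) Z1 x +
      (\<Sum>b\<in>Basis. (x \<bullet> b) * (x \<bullet> b)) * ef (a + 4) (\<lambda>s. deriv Z1 s - (a + 2) * Z1 s) x"
    unfolding laplacian_def by (simp add: pp sum.distrib sum_distrib_right)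
  also have "(\<Sum>b\<in>Basis. (x \<bullet> b) * (x \<bullet> b)) = norm x powr 2"
    using x by (simp add: euclidean_inner[symmetric] powr_numeral power2_norm_eq_inner)
  also have "norm x powr 2 * ef (a + 4) (\<lambda>s. deriv Z1 s - (a + 2) * Z1 s) x =
      ef (a + 2) (\<lambda>s. deriv Z1 s - (a + 2) * Z1 s) x"
  proof -
    have "norm x powr 2 * norm x powr (-(a+4)) = norm x powr (2 + -(a+4))"
      by (simp only: powr_add)
    also have "2 + -(a+4) = -(a+2)" by simp
    finally show ?thesis using x unfolding ef_def by (simp only: mult.assoc[symmetric] if_False)
  qed
  finally show ?thesis using x by (simp add: ef_def algebra_simps)
qed

lemma gradient_radial:
  fixes F :: "'a::euclidean_space \<Rightarrow> real"
  assumes F: "Ck (Suc j) F" and Z: "\<And>x. x \<noteq> 0 \<Longrightarrow> F x = ef a Z x" and x: "x \<noteq> 0"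
  shows "gradient F x = ef (a + 1) (\<lambda>s. deriv Z s - a * Z s) x *\<^sub>R (x /\<^sub>R norm x)"
proof -
  have "gradient F x = (\<Sum>b\<in>Basis. ef (a + 2) (\<lambda>s. deriv Z s - a * Z s) x *\<^sub>R ((x \<bullet> b) *\<^sub>R b))"
    unfolding gradient_def by (simp add: partial_radial[OF F Z x] mult.commute)
  also have "\<dots> = ef (a + 2) (\<lambda>s. deriv Z s - a * Z s) x *\<^sub>R x"
    by (subst (3) euclidean_representation[of x, symmetric]) (simp only: scaleR_sum_right)
  also have "ef (a + 2) (\<lambda>s. deriv Z s - a * Z s) x = ef (a + 1) (\<lambda>s. deriv Z s - a * Z s) x / norm x"
  proof -
    have "norm x powr (-(a+2)) = norm x powr (-(a+1) - 1)" by (simp add: algebra_simps)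
    also have "\<dots> = norm x powr (-(a+1)) / norm x"
      using x by (subst powr_diff) simp_all
    finally show ?thesis using x by (simp add: ef_def)
  qed
  finally show ?thesis by (simp add: divide_inverse_commute)
qed


text \<open>Two links of the chain make one Laplacian: the roots at 2 m and 2 m + 1 are a + 2 m and
  a + 2 m + 2 - n, exactly the pair in \<open>laplacian_radial\<close>.\<close>

lemma ef_chain_even:
  fixes v :: "'a::euclidean_space \<Rightarrow> real"
  assumes v: "Ck k v" "radial v" and m: "2 * m \<le> k" and x: "x \<noteq> 0"
  shows "(laplacian ^^ m) v x = ef (a + real (2 * m)) (ef_chain DIM('a) a (2 * m) (ef_profile a v)) x"
  using m x
proof (induction m arbitrary: x)
  case 0
  then show ?case using radial_eq_ef[OF v(2)] by simp
next
  case (Suc m)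
  have F: "Ck (Suc (Suc 0)) ((laplacian ^^ m) v)"
    using Suc.prems by (intro Ck_laplacian_iter Ck_mono[OF v(1)]) simp
  have "laplacian ((laplacian ^^ m) v) x =
      ef (a + real (2 * m) + 2) (ef_chain DIM('a) a (Suc (Suc (2 * m))) (ef_profile a v)) x"
    using laplacian_radial[OF F Suc.IH, of x] Suc.prems
    by (simp add: ef_root_def algebra_simps)
  then show ?case by (simp add: algebra_simps)
qed

text \<open>Regularity of the chain is inherited from R^n: an even link is the profile of an
  iterated Laplacian, an odd one that of a partial derivative of it. Differentiability and
  continuity of the links follow from this.\<close>

lemma ef_chain_eq_profile:
  fixes v :: "'a::euclidean_space \<Rightarrow> real"
  assumes v: "Ck k v" "radial v" and l: "l \<le> k"
  shows "\<exists>F::'a \<Rightarrow> real. Ck (k - l) F \<and>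
    ef_chain DIM('a) a l (ef_profile a v) = ef_profile (a + real l) F"
proof (cases "even l")
  case True
  then obtain m where m: "l = 2 * m" by auto
  have "Ck (k - l) ((laplacian ^^ m) v)"
    using l m by (intro Ck_laplacian_iter Ck_mono[OF v(1)]) simp
  with ef_eq_iff_profile[OF ef_chain_even[OF v, of m]] m l show ?thesis by auto
next
  case False
  then obtain m where m: "l = Suc (2 * m)" by (auto elim: oddE)
  have F: "Ck (Suc (k - l)) ((laplacian ^^ m) v)"
    using l m by (intro Ck_laplacian_iter Ck_mono[OF v(1)]) simp
  have "ef_profile (a + real (2 * m) + 1) (partial (SOME e. e \<in> Basis) ((laplacian ^^ m) v)) =
      ef_chain DIM('a) a l (ef_profile a v)"
    using ef_profile_partial[OF F ef_chain_even[OF v, of m _ a]] m l by (simp add: ef_root_def)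
  moreover have "a + real (2 * m) + 1 = a + real l" using m by simp
  ultimately show ?thesis
    using Ck_partial[OF F some_Basis] by metis
qed

lemma ef_chain_has_derivative:
  fixes v :: "'a::euclidean_space \<Rightarrow> real"
  assumes v: "Ck k v" "radial v" and l: "l < k"
  shows "(ef_chain DIM('a) a l (ef_profile a v) has_real_derivative
    deriv (ef_chain DIM('a) a l (ef_profile a v)) s) (at s)"
proof -
  obtain F :: "'a \<Rightarrow> real" where F: "Ck (k - l) F"
    "ef_chain DIM('a) a l (ef_profile a v) = ef_profile (a + real l) F"
    using ef_chain_eq_profile[OF v, of l a] l by auto
  then have "Ck (Suc (k - l - 1)) F" using l by (metis Suc_diff_1 zero_less_diff)
  with F(2) ef_profile_has_derivative show ?thesis by metis
qed

lemma ef_chain_continuous: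
  fixes v :: "'a::euclidean_space \<Rightarrow> real"
  assumes v: "Ck k v" "radial v" and l: "l \<le> k"
  shows "continuous_on UNIV (ef_chain DIM('a) a l (ef_profile a v))"
proof -
  obtain F :: "'a \<Rightarrow> real" where F: "Ck (k - l) F"
    "ef_chain DIM('a) a l (ef_profile a v) = ef_profile (a + real l) F"
    using ef_chain_eq_profile[OF v, of l a] l by auto
  show ?thesis
    unfolding F(2) unfolding ef_profile_def[abs_def]
    by (intro continuous_intros continuous_on_compose2[OF Ck_imp_continuous[OF F(1)]]) auto
qed

lemma nabla_ef_chain:
  fixes v :: "'a::euclidean_space \<Rightarrow> real"
  assumes v: "Ck k v" "radial v" and l: "l \<le> k" and x: "x \<noteq> 0"
  shows "nabla l v x = (norm x powr (-(a + real l)) *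
    ef_chain DIM('a) a l (ef_profile a v) (ln (norm x))) *\<^sub>R ef_dir l x"
proof (cases "even l")
  case True
  then obtain m where m: "l = 2 * m" by auto
  show ?thesis
    using ef_chain_even[OF v, of m x a] m l x by (simp add: nabla_def ef_dir_def ef_def)
next
  case False
  then obtain m where m: "l = Suc (2 * m)" by (auto elim: oddE)
  have F: "Ck (Suc (k - l)) ((laplacian ^^ m) v)"
    using l m by (intro Ck_laplacian_iter Ck_mono[OF v(1)]) simp
  have e: "a + real l = a + real (2 * m) + 1" using m by simp
  show ?thesis
    using gradient_radial[OF F ef_chain_even[OF v, of m _ a] x] m l x
    unfolding e by (simp add: nabla_def ef_dir_def ef_def ef_root_def)
qed

lemma norm_ef_dir: "x \<noteq> 0 \<Longrightarrow> norm (ef_dir l x) = 1"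
  by (simp add: ef_dir_def norm_Pair)

lemma vanishes_off_nabla:
  assumes "closed K" "vanishes_off K v"
  shows "vanishes_off K (nabla l v)"
proof -
  have "vanishes_off K ((laplacian ^^ m) v)" for m
    by (rule vanishes_off_laplacian_iter[OF assms])
  moreover have "vanishes_off K (partial b ((laplacian ^^ m) v))" for m b
    by (intro vanishes_off_partial vanishes_off_laplacian_iter assms)
  ultimately show ?thesis
    unfolding vanishes_off_def nabla_def gradient_def by (auto simp: zero_prod_def)
qed

lemma compact_punctured_annulus:
  fixes K :: "'a::euclidean_space set"
  assumes "compact K" "0 \<notin> K"
  obtains M where "M > 0" "\<And>x. x \<in> K \<Longrightarrow> x \<noteq> 0 \<and> \<bar>ln (norm x)\<bar> \<le> M"
proof -
  obtain R where R: "R > 0" "\<And>x. x \<in> K \<Longrightarrow> norm x \<le> R"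
    using compact_imp_bounded[OF assms(1)] by (auto simp: bounded_pos)
  have "open (- K)" using assms(1) by (auto simp: compact_imp_closed open_Compl)
  with assms(2) obtain e where e: "e > 0" "ball 0 e \<subseteq> - K" by (auto elim: openE)
  show thesis
  proof (rule that[of "\<bar>ln R\<bar> + \<bar>ln e\<bar> + 1"])
    fix x assume x: "x \<in> K"
    then have "x \<noteq> 0" using assms(2) by auto
    moreover have "norm x \<le> R" "e \<le> norm x"
      using R(2)[OF x] e(2) x by (auto simp: subset_iff dist_norm not_less)
    then have "ln (norm x) \<le> ln R" "ln e \<le> ln (norm x)"
      using R(1) e(1) \<open>x \<noteq> 0\<close> by (auto intro!: ln_mono)
    ultimately show "x \<noteq> 0 \<and> \<bar>ln (norm x)\<bar> \<le> \<bar>ln R\<bar> + \<bar>ln e\<bar> + 1" by auto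
  qed auto
qed

text \<open>The vanishing is read off from \<open>nabla l v\<close> on R^n, which is 0 outside an
  annulus, through \<open>nabla_ef_chain\<close>.\<close>

lemma ef_chain_vanishes:
  fixes v :: "'a::euclidean_space \<Rightarrow> real"
  assumes v: "v \<in> Ckcr k"
  obtains M where "M > 0" "\<And>l s. l \<le> k \<Longrightarrow> \<bar>s\<bar> > M \<Longrightarrow> ef_chain DIM('a) a l (ef_profile a v) s = 0"
proof -
  have vk: "Ck k v" "radial v" using v by (auto simp: Ckcr_def Ckc_iff)
  obtain K where K: "compact K" "0 \<notin> K" "vanishes_off K v" using v by (auto simp: Ckcr_def Ckc_iff)
  obtain M where M: "M > 0" "\<And>x. x \<in> K \<Longrightarrow> x \<noteq> 0 \<and> \<bar>ln (norm x)\<bar> \<le> M"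
    using compact_punctured_annulus[OF K(1,2)] by blast
  have "ef_chain DIM('a) a l (ef_profile a v) s = 0" if l: "l \<le> k" and s: "\<bar>s\<bar> > M" for l s
  proof -
    define x :: 'a where "x = exp s *\<^sub>R (SOME e. e \<in> Basis)"
    have nx: "norm x = exp s" by (simp add: x_def norm_some_Basis)
    then have x0: "x \<noteq> 0" by auto
    have "x \<notin> K" using M(2)[of x] s nx by auto
    then have "nabla l v x = 0"
      using vanishes_off_nabla[OF compact_imp_closed[OF K(1)] K(3)] by (simp add: vanishes_off_def)
    then show ?thesis
      using nabla_ef_chain[OF vk l x0, of a] norm_ef_dir[OF x0, of l] nx by auto
  qed
  with M(1) show thesis by (rule that)
qed

text \<open>\<open>deriv\<close> has no meaning where the derivative does not exist, so linearity
  holds only along chains all of whose links are differentiable.\<close>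

lemma ef_chain_diff:
  assumes "\<And>l s. l < k \<Longrightarrow> (ef_chain n a l w has_real_derivative deriv (ef_chain n a l w) s) (at s)"
    and "\<And>l s. l < k \<Longrightarrow> (ef_chain n a l w' has_real_derivative deriv (ef_chain n a l w') s) (at s)"
    and "l \<le> k"
  shows "ef_chain n a l (\<lambda>s. w s - w' s) = (\<lambda>s. ef_chain n a l w s - ef_chain n a l w' s)"
  using assms(3)
proof (induction l)
  case (Suc l)
  have "deriv (\<lambda>s. ef_chain n a l w s - ef_chain n a l w' s) s =
      deriv (ef_chain n a l w) s - deriv (ef_chain n a l w') s" for s
    using Suc.prems by (intro DERIV_imp_deriv DERIV_diff assms) auto
  with Suc show ?case by (auto simp: algebra_simps)
qed simp

section \<open>Smooth compactly supported profiles\<close>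

definition smooth_cs :: "(real \<Rightarrow> real) set" where
  "smooth_cs = {w. (\<forall>k. Ck k w) \<and> (\<exists>M. \<forall>s. \<bar>s\<bar> > M \<longrightarrow> w s = 0)}"

lemma smooth_csD:
  assumes "w \<in> smooth_cs"
  shows "Ck k w" and "(w has_real_derivative deriv w s) (at s)"
    and "continuous_on UNIV w" and "deriv w \<in> smooth_cs"
proof -
  show c: "Ck k w" for k using assms by (auto simp: smooth_cs_def)
  show "continuous_on UNIV w" using c[of 0] by simp
  have d: "(w has_real_derivative partial 1 w s) (at s)" for s
    using Ck_real_derivative[OF c[of "Suc 0"]] .
  then have e: "deriv w = partial 1 w" using DERIV_imp_deriv by blast
  with d show "(w has_real_derivative deriv w s) (at s)" by simp
  obtain M where M: "\<And>s. \<bar>s\<bar> > M \<Longrightarrow> w s = 0" using assms by (auto simp: smooth_cs_def)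
  have "vanishes_off {-M..M} (partial 1 w)"
    using M by (intro vanishes_off_partial) (auto simp: vanishes_off_def)
  then have "partial 1 w s = 0" if "\<bar>s\<bar> > M" for s
    using that unfolding vanishes_off_def by (elim allE[of _ s]) auto
  then show "deriv w \<in> smooth_cs"
    using Ck_partial[OF c[of "Suc _"], of 1] unfolding e smooth_cs_def by auto
qed

lemma smooth_cs_diff:
  assumes "f \<in> smooth_cs" "g \<in> smooth_cs"
  shows "(\<lambda>s. f s - g s) \<in> smooth_cs"
proof -
  obtain M N where "\<And>s. \<bar>s\<bar> > M \<Longrightarrow> f s = 0" "\<And>s. \<bar>s\<bar> > N \<Longrightarrow> g s = 0"
    using assms by (auto simp: smooth_cs_def)
  then have "\<bar>s\<bar> > max M N \<longrightarrow> f s - g s = 0" for s by auto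
  then show ?thesis
    using assms unfolding smooth_cs_def by (blast intro: Ck_diff)
qed

lemma smooth_cs_cmult: "f \<in> smooth_cs \<Longrightarrow> (\<lambda>s. c * f s) \<in> smooth_cs"
  unfolding smooth_cs_def by (auto intro: Ck_cmult)

lemma smooth_cs_shift:
  assumes "f \<in> smooth_cs" and "c \<noteq> 0"
  shows "(\<lambda>s. f (c * s + d)) \<in> smooth_cs"
proof -
  obtain M where M: "\<And>s. \<bar>s\<bar> > M \<Longrightarrow> f s = 0"
    using assms by (auto simp: smooth_cs_def)
  have "Ck k (\<lambda>s. f (c * s + d))" for k
    by (intro Ck_compose[OF smooth_csD(1)[OF assms(1)]] Ck_add Ck_const Ck_bounded_linear bounded_linear_mult_right)
  moreover have "f (c * s + d) = 0" if "\<bar>s\<bar> > (\<bar>M\<bar> + \<bar>d\<bar>) / \<bar>c\<bar>" for s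
  proof (rule M)
    have "\<bar>M\<bar> + \<bar>d\<bar> < \<bar>c * s\<bar>" using that assms(2) by (simp add: field_simps abs_mult)
    then show "\<bar>c * s + d\<bar> > M" by linarith
  qed
  ultimately show ?thesis unfolding smooth_cs_def by blast
qed

lemma ef_chain_smooth_cs: "w \<in> smooth_cs \<Longrightarrow> ef_chain n a l w \<in> smooth_cs"
  by (induction l) (auto intro!: smooth_cs_diff smooth_cs_cmult smooth_csD(4))

text \<open>A partial derivative of \<open>ef a w\<close> is a linear function times
  \<open>ef (a + 2)\<close> of another profile of the same class, so the induction runs over all a
  and w. Near the origin the function is 0, because ln |x| leaves the support of w.\<close>

lemma Ck_ef:
  assumes "w \<in> smooth_cs"
  shows "Ck k (ef a w :: 'a::euclidean_space \<Rightarrow> real)"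
  using assms
proof (induction k arbitrary: a w)
  have D: "(ef a w has_derivative (\<lambda>h. ef (a + 2) (\<lambda>s. deriv w s - a * w s) x * (x \<bullet> h))) (at (x::'a))"
    if w: "w \<in> smooth_cs" for w a x
  proof (cases "x = 0")
    case False
    from ef_has_derivative[OF False smooth_csD(2)[OF w]] False show ?thesis by (simp add: ef_def)
  next
    case True
    obtain M where M: "\<And>s. \<bar>s\<bar> > M \<Longrightarrow> w s = 0" using w by (auto simp: smooth_cs_def)
    have z: "ef a w y = 0" if "y \<in> ball 0 (exp (- \<bar>M\<bar>))" for y :: 'a
    proof (cases "y = 0")
      case False
      then have "ln (norm y) < - \<bar>M\<bar>" using that by (metis dist_0_norm exp_less_cancel_iff exp_ln mem_ball zero_less_norm_iff)
      then show ?thesis using M[of "ln (norm y)"] by (simp add: ef_def)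
    qed (simp add: ef_def)
    have "(ef a w has_derivative (\<lambda>h. 0)) (at (x::'a))"
      by (rule has_derivative_transform_within_open[of "\<lambda>_. 0" _ x UNIV "ball 0 (exp (- \<bar>M\<bar>))"])
        (use True z in auto)
    with True show ?thesis by simp
  qed
  {
    case 0
    show ?case
      using has_derivative_continuous[OF D[OF 0]] by (auto intro: continuous_at_imp_continuous_on)
  next
    case (Suc k)
    show ?case
    proof (rule Ck_SucI[OF D[OF Suc.prems]])
      show "Ck k (\<lambda>x::'a. ef (a + 2) (\<lambda>s. deriv w s - a * w s) x * (x \<bullet> b))" for b
        using Suc.prems
        by (intro Ck_mult Suc.IH Ck_bounded_linear bounded_linear_inner_left smooth_cs_diff smooth_cs_cmult smooth_csD(4))
    qed
  }
qed

lemma ef_in_Ckcr: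
  assumes w: "w \<in> smooth_cs"
  shows "(ef a w :: 'a::euclidean_space \<Rightarrow> real) \<in> Ckcr k"
proof -
  obtain M where M: "\<And>s. \<bar>s\<bar> > M \<Longrightarrow> w s = 0" using w by (auto simp: smooth_cs_def)
  let ?K = "cball 0 (exp \<bar>M\<bar>) - ball 0 (exp (- \<bar>M\<bar>)) :: 'a set"
  have "ef a w y = 0" if "y \<notin> ?K" for y :: 'a
  proof (cases "y = 0")
    case False
    then have "norm y < exp (- \<bar>M\<bar>) \<or> norm y > exp \<bar>M\<bar>" using that by auto
    then have "ln (norm y) < - \<bar>M\<bar> \<or> ln (norm y) > \<bar>M\<bar>"
      using False by (metis exp_less_cancel_iff exp_ln zero_less_norm_iff)
    then show ?thesis using M[of "ln (norm y)"] by (auto simp: ef_def)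
  qed (simp add: ef_def)
  then have "vanishes_off ?K (ef a w)" by (auto simp: vanishes_off_def)
  moreover have "compact ?K" by (intro compact_diff) auto
  moreover have "0 \<notin> ?K" by simp
  ultimately show ?thesis
    using Ck_ef[OF w] unfolding Ckcr_def Ckc_iff by (auto simp: radial_def ef_def)
qed

lemma ef_profile_ef: "ef_profile a (ef a w :: 'a::euclidean_space \<Rightarrow> real) = w"
  using ef_eq_iff_profile[of "ef a w :: 'a \<Rightarrow> real" a w] by simp

section \<open>Extremals of convolution operators\<close>

text \<open>This inequality replaces Hoelder: for large \<open>N\<close> a function bounded in \<open>L\<^sup>p\<close> is at most \<open>N\<close>
  up to a small error in \<open>L\<^sup>1\<close>.\<close>

lemma le_truncation:
  fixes x N p :: real
  assumes "x \<ge> 0" "N > 0" "p > 1"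
  shows "x \<le> N + N powr (1 - p) * x powr p"
proof (cases "x \<le> N")
  case False
  then have "x = x powr (1 - p) * x powr p" using assms by (simp add: powr_add[symmetric])
  also have "\<dots> \<le> N powr (1 - p) * x powr p"
    using False assms by (intro mult_right_mono powr_mono2') auto
  finally show ?thesis using assms by linarith
qed (use assms in \<open>simp add: add_increasing2\<close>)

text \<open>With y^(p-1) in place of y, equality holds at x = y, and the inequality is reused for p
  and for q without naming conjugate exponents.\<close>

lemma Young_powr:
  fixes x y p :: real
  assumes "p > 1" "x \<ge> 0" "y \<ge> 0"
  shows "x * y powr (p - 1) \<le> x powr p / p + (p - 1) / p * y powr p"
proof -
  have "x * y powr (p - 1) \<le> x powr p / p + (y powr (p - 1)) powr (p / (p - 1)) / (p / (p - 1))"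
    using assms by (intro Youngs_inequality) (auto simp: field_simps)
  also have "(y powr (p - 1)) powr (p / (p - 1)) = y powr p" using assms by (simp add: powr_powr)
  finally show ?thesis by (simp add: mult.commute)
qed

definition conv :: "(real \<Rightarrow> real) \<Rightarrow> (real \<Rightarrow> real) \<Rightarrow> real \<Rightarrow> real" where
  "conv G f s = (LINT t|lborel. G (s - t) * f t)"

definition Lp :: "real \<Rightarrow> (real \<Rightarrow> real) \<Rightarrow> bool" where
  "Lp p f \<longleftrightarrow> f \<in> borel_measurable borel \<and> integrable lborel (\<lambda>s. \<bar>f s\<bar> powr p)"

section \<open>Convolution with a nonnegative integrable kernel\<close>

lemma integrable_reflect_shift:
  fixes f :: "real \<Rightarrow> real"
  assumes "integrable lborel f"
  shows "integrable lborel (\<lambda>t. f (s - t))"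
  using lborel_integrable_real_affine[OF assms, of "-1" s] by simp

lemma integral_reflect_shift:
  fixes f :: "real \<Rightarrow> real"
  shows "(LINT t|lborel. f (s - t)) = (LINT t|lborel. f t)"
  using lborel_integral_real_affine[of "-1" f s] by simp

lemma integrable_shift:
  fixes f :: "real \<Rightarrow> real"
  assumes "integrable lborel f"
  shows "integrable lborel (\<lambda>t. f (t + s))"
  using lborel_integrable_real_affine[OF assms, of 1 s] by (simp add: add.commute)

lemma integral_shift:
  fixes f :: "real \<Rightarrow> real"
  shows "(LINT t|lborel. f (t + s)) = (LINT t|lborel. f t)"
  using lborel_integral_real_affine[of 1 f s] by (simp add: add.commute)

lemma integrable_bounded_mult:
  fixes f g :: "real \<Rightarrow> real"
  assumes f: "integrable lborel f" and [measurable]: "g \<in> borel_measurable borel" and g: "\<And>t. \<bar>g t\<bar> \<le> B"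
  shows "integrable lborel (\<lambda>t. f t * g t)"
proof (rule Bochner_Integration.integrable_bound[OF integrable_mult_right[OF f, of B]])
  note [measurable] = borel_measurable_integrable[OF f, simplified]
  show "(\<lambda>t. f t * g t) \<in> borel_measurable lborel" by measurable
  show "AE t in lborel. norm (f t * g t) \<le> norm (B * f t)"
  proof (intro AE_I2)
    fix t
    have "\<bar>f t\<bar> * \<bar>g t\<bar> \<le> \<bar>f t\<bar> * \<bar>B\<bar>" using g[of t] by (intro mult_left_mono) auto
    then show "norm (f t * g t) \<le> norm (B * f t)" by (simp add: abs_mult mult.commute)
  qed
qed

text \<open>Interpolation between L^p and L^infinity: |f|^q = |f|^(q-p) |f|^p. The supremum D enters
  with a positive power when q > p, which later keeps near-maximisers from being uniformly
  small.\<close>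

lemma integrable_powr_mono:
  fixes f :: "real \<Rightarrow> real"
  assumes f: "Lp p f" and b: "\<And>s. \<bar>f s\<bar> \<le> D" and pq: "p \<le> q"
  shows "Lp q f" and "(LINT s|lborel. \<bar>f s\<bar> powr q) \<le> D powr (q - p) * (LINT s|lborel. \<bar>f s\<bar> powr p)"
proof -
  have [measurable]: "f \<in> borel_measurable borel" using f by (simp add: Lp_def)
  have i: "integrable lborel (\<lambda>s. D powr (q - p) * \<bar>f s\<bar> powr p)" using f by (simp add: Lp_def)
  have le: "\<bar>f s\<bar> powr q \<le> D powr (q - p) * \<bar>f s\<bar> powr p" for s
  proof -
    have "\<bar>f s\<bar> powr q = \<bar>f s\<bar> powr (q - p) * \<bar>f s\<bar> powr p" by (simp add: powr_add[symmetric])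
    also have "\<dots> \<le> D powr (q - p) * \<bar>f s\<bar> powr p"
      using b pq by (intro mult_right_mono powr_mono2) auto
    finally show ?thesis .
  qed
  have iq: "integrable lborel (\<lambda>s. \<bar>f s\<bar> powr q)"
    by (rule Bochner_Integration.integrable_bound[OF i]) (use le in \<open>auto simp: abs_mult\<close>)
  then show "Lp q f" by (simp add: Lp_def)
  show "(LINT s|lborel. \<bar>f s\<bar> powr q) \<le> D powr (q - p) * (LINT s|lborel. \<bar>f s\<bar> powr p)"
    using integral_mono[OF iq i le] by simp
qed

lemma Lp_shift: "Lp p f \<Longrightarrow> Lp p (\<lambda>t. f (t + s))"
  unfolding Lp_def using integrable_shift[of "\<lambda>s. \<bar>f s\<bar> powr p" s] by auto

text \<open>The mass A bounds the convolution on L^p, A and the supremum B bound it from L^p to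
  L^infinity, and C gives equicontinuity. Translations are controlled in L^1 and not pointwise,
  since the exponential kernels jump at 0.\<close>

locale kernel =
  fixes G :: "real \<Rightarrow> real" and A B C :: real
  assumes nonneg: "0 \<le> G t" and bounded: "G t \<le> B" and integrable: "integrable lborel G"
    and lipschitz: "(LINT t|lborel. \<bar>G (t + h) - G t\<bar>) \<le> C * \<bar>h\<bar>"
    and A_def: "A = (LINT t|lborel. G t)"
begin

lemma meas [measurable]: "G \<in> borel_measurable borel"
  using integrable by auto

lemma B_nonneg: "0 \<le> B" using nonneg[of 0] bounded[of 0] by linarith

lemma A_nonneg: "0 \<le> A" unfolding A_def by (intro integral_nonneg_AE AE_I2 nonneg)

lemma integrable_bounded:
  assumes "f \<in> borel_measurable borel" "\<And>t. \<bar>f t\<bar> \<le> D"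
  shows "integrable lborel (\<lambda>t. G (s - t) * f t)"
  using integrable_bounded_mult[OF integrable_reflect_shift[OF integrable] assms] .

lemma conv_bounded:
  assumes "f \<in> borel_measurable borel" "\<And>t. \<bar>f t\<bar> \<le> D"
  shows "\<bar>conv G f s\<bar> \<le> A * D"
proof -
  have "\<bar>conv G f s\<bar> \<le> (LINT t|lborel. \<bar>G (s - t) * f t\<bar>)"
    unfolding conv_def by (rule integral_abs_bound)
  also have "\<dots> \<le> (LINT t|lborel. G (s - t) * D)"
  proof (rule integral_mono)
    show "integrable lborel (\<lambda>t. \<bar>G (s - t) * f t\<bar>)"
      by (intro integrable_abs integrable_bounded[OF assms])
    show "integrable lborel (\<lambda>t. G (s - t) * D)"
      by (intro integrable_mult_left integrable_reflect_shift integrable)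
    show "\<bar>G (s - t) * f t\<bar> \<le> G (s - t) * D" for t
      using assms(2) nonneg by (auto simp: abs_mult intro!: mult_left_mono)
  qed
  also have "\<dots> = A * D" by (simp add: integral_reflect_shift A_def)
  finally show ?thesis .
qed

lemma integrable_Lp_left:
  assumes f: "Lp p f"
  shows "integrable lborel (\<lambda>t. G (s - t) * \<bar>f t\<bar> powr p)"
proof -
  have "\<bar>G (s - t)\<bar> \<le> B" for t using nonneg[of "s - t"] bounded[of "s - t"] by simp
  then have "integrable lborel (\<lambda>t. \<bar>f t\<bar> powr p * G (s - t))"
    using f by (intro integrable_bounded_mult) (auto simp: Lp_def)
  then show ?thesis by (simp add: mult.commute)
qed

lemma integrable_Lp:
  assumes f: "Lp p f" and p: "p > 1"
  shows "integrable lborel (\<lambda>t. G (s - t) * f t)"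
proof (rule Bochner_Integration.integrable_bound)
  have [measurable]: "f \<in> borel_measurable borel" using f by (simp add: Lp_def)
  show "integrable lborel (\<lambda>t. G (s - t) + G (s - t) * \<bar>f t\<bar> powr p)"
    by (intro Bochner_Integration.integrable_add integrable_reflect_shift[OF integrable] integrable_Lp_left[OF f])
  show "(\<lambda>t. G (s - t) * f t) \<in> borel_measurable lborel" by measurable
  have "\<bar>f t\<bar> \<le> 1 + \<bar>f t\<bar> powr p" for t
    using le_truncation[of "\<bar>f t\<bar>" 1 p] p by simp
  then have "G (s - t) * \<bar>f t\<bar> \<le> G (s - t) * (1 + \<bar>f t\<bar> powr p)" for t
    by (intro mult_left_mono nonneg)
  then show "AE t in lborel. norm (G (s - t) * f t) \<le> norm (G (s - t) + G (s - t) * \<bar>f t\<bar> powr p)"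
    using nonneg by (intro AE_I2) (simp add: abs_mult algebra_simps)
qed

lemma conv_measurable [measurable]:
  assumes [measurable]: "f \<in> borel_measurable borel"
  shows "conv G f \<in> borel_measurable borel"
  unfolding conv_def[abs_def] by measurable

lemma conv_nonneg: "(\<And>t. 0 \<le> f t) \<Longrightarrow> 0 \<le> conv G f s"
  unfolding conv_def by (intro integral_nonneg_AE AE_I2 mult_nonneg_nonneg nonneg)

lemma conv_abs_le: "\<bar>conv G f s\<bar> \<le> conv G (\<lambda>t. \<bar>f t\<bar>) s"
proof -
  have "\<bar>conv G f s\<bar> \<le> (LINT t|lborel. \<bar>G (s - t) * f t\<bar>)"
    unfolding conv_def by (rule integral_abs_bound)
  then show ?thesis using nonneg by (simp add: conv_def abs_mult)
qed

lemma conv_shift: "conv G (\<lambda>t. f (t + c)) s = conv G f (s + c)"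
  unfolding conv_def using integral_shift[of "\<lambda>t. G (s + c - t) * f t" c] by simp

lemma conv_cmult: "conv G (\<lambda>t. c * f t) s = c * conv G f s"
  unfolding conv_def by (simp add: mult.left_commute)

text \<open>Jensen's inequality for the probability measure G (s - t) / A dt. The cases A = 0 and X
  = 0, where the normalisation fails, make the left-hand side 0.\<close>

lemma conv_jensen:
  assumes f: "Lp p f" and p: "p > 1"
  shows "\<bar>conv G f s\<bar> powr p \<le> A powr (p - 1) * (LINT t|lborel. G (s - t) * \<bar>f t\<bar> powr p)"
proof -
  define X where "X = conv G (\<lambda>t. \<bar>f t\<bar>) s"
  have fa: "Lp p (\<lambda>t. \<bar>f t\<bar>)" using f by (auto simp: Lp_def)
  have X0: "X \<ge> 0" unfolding X_def by (rule conv_nonneg) simp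
  let ?I = "LINT t|lborel. G (s - t) * \<bar>f t\<bar> powr p"
  have I0: "?I \<ge> 0" by (intro integral_nonneg_AE AE_I2 mult_nonneg_nonneg nonneg) auto
  have "X powr p \<le> A powr (p - 1) * ?I"
  proof (cases "X = 0 \<or> A = 0")
    case True
    have "X = 0"
    proof (cases "A = 0")
      case A0: True
      have "AE t in lborel. G t = 0"
        using integral_nonneg_eq_0_iff_AE[OF integrable] A0 nonneg unfolding A_def by auto
      then have "AE t in lborel. G (s + (-1) * t) = 0"
        by (intro AE_borel_affine) auto
      then have "AE t in lborel. G (s - t) * \<bar>f t\<bar> = 0" by eventually_elim simp
      then show ?thesis
        unfolding X_def conv_def by (rule integral_eq_zero_AE)
    qed (use True in auto)
    then show ?thesis using I0 p by simp
  next
    case False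
    then have pos: "X > 0" "A > 0" using X0 A_nonneg by auto
    \<comment> \<open>The mean of |f| under that measure. Young's inequality against a constant is
      sharp on average for this choice.\<close>
    define c where "c = X / A"
    have c: "c > 0" using pos by (simp add: c_def)
    have "X * c powr (p - 1) = (LINT t|lborel. G (s - t) * (\<bar>f t\<bar> * c powr (p - 1)))"
      by (simp add: X_def conv_def mult.assoc[symmetric])
    also have "\<dots> \<le> (LINT t|lborel. G (s - t) * \<bar>f t\<bar> powr p * (1 / p) + (p - 1) / p * c powr p * G (s - t))"
    proof (rule integral_mono)
      show "integrable lborel (\<lambda>t. G (s - t) * (\<bar>f t\<bar> * c powr (p - 1)))"
        using integrable_Lp[OF fa p, of s] by (simp add: mult.assoc[symmetric])
      show "integrable lborel (\<lambda>t. G (s - t) * \<bar>f t\<bar> powr p * (1 / p) + (p - 1) / p * c powr p * G (s - t))"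
        by (intro Bochner_Integration.integrable_add integrable_mult_left integrable_mult_right
          integrable_Lp_left[OF f] integrable_reflect_shift[OF integrable])
      show "G (s - t) * (\<bar>f t\<bar> * c powr (p - 1)) \<le> G (s - t) * \<bar>f t\<bar> powr p * (1 / p) + (p - 1) / p * c powr p * G (s - t)" for t
        using mult_left_mono[OF Young_powr[OF p, of "\<bar>f t\<bar>" c] nonneg[of "s - t"]] c
        by (simp add: algebra_simps)
    qed
    also have "\<dots> = ?I * (1 / p) + (p - 1) / p * c powr p * A"
      using integrable_Lp_left[OF f, of s] integrable_reflect_shift[OF integrable, of s]
      by (simp add: integral_reflect_shift A_def)
    finally have 1: "X * c powr (p - 1) \<le> ?I / p + (p - 1) / p * c powr p * A" by simp
    have "X * c powr (p - 1) = A * c powr p"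
    proof -
      have "c powr p = c powr 1 * c powr (p - 1)" by (subst powr_add[symmetric]) simp
      then show ?thesis using c pos by (simp add: c_def)
    qed
    with 1 have "A * c powr p * p \<le> ?I + (p - 1) * (A * c powr p)"
      using p by (simp add: field_simps)
    then have "A * c powr p \<le> ?I" by (simp add: algebra_simps)
    then have "A powr (p - 1) * (A * c powr p) \<le> A powr (p - 1) * ?I"
      by (intro mult_left_mono) auto
    moreover have "A powr (p - 1) * (A * c powr p) = X powr p"
    proof -
      have "A powr (p - 1) * A = A powr p" using pos by (simp add: powr_diff)
      then show ?thesis using pos by (simp add: c_def powr_divide mult.assoc[symmetric])
    qed
    ultimately show ?thesis by simp
  qed
  moreover have "\<bar>conv G f s\<bar> powr p \<le> X powr p"
    using p conv_abs_le[of f s] by (intro powr_mono2) (auto simp: X_def)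
  ultimately show ?thesis by linarith
qed

lemma nn_conv_Lp:
  assumes [measurable]: "g \<in> borel_measurable borel" and g: "\<And>t. 0 \<le> g t"
  shows "(\<integral>\<^sup>+s. (\<integral>\<^sup>+t. ennreal (G (s - t) * g t) \<partial>lborel) \<partial>lborel) = ennreal A * (\<integral>\<^sup>+t. ennreal (g t) \<partial>lborel)"
proof -
  have "(\<integral>\<^sup>+s. (\<integral>\<^sup>+t. ennreal (G (s - t) * g t) \<partial>lborel) \<partial>lborel) =
      (\<integral>\<^sup>+t. (\<integral>\<^sup>+s. ennreal (G (s - t) * g t) \<partial>lborel) \<partial>lborel)"
    by (rule lborel_pair.Fubini') measurable
  also have "\<dots> = (\<integral>\<^sup>+t. ennreal A * ennreal (g t) \<partial>lborel)"
  proof (rule nn_integral_cong)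
    fix t
    have "(\<integral>\<^sup>+s. ennreal (G (s - t) * g t) \<partial>lborel) = (\<integral>\<^sup>+s. ennreal (G (s - t)) * ennreal (g t) \<partial>lborel)"
      by (intro nn_integral_cong) (simp add: ennreal_mult' g nonneg ennreal_mult)
    also have "\<dots> = (\<integral>\<^sup>+s. ennreal (G (s - t)) \<partial>lborel) * ennreal (g t)"
      by (rule nn_integral_multc) measurable
    also have "(\<integral>\<^sup>+s. ennreal (G (s - t)) \<partial>lborel) = ennreal (LINT s|lborel. G (s - t))"
      using integrable_shift[OF integrable, of "-t"] nonneg by (intro nn_integral_eq_integral) auto
    also have "(LINT s|lborel. G (s - t)) = A"
      using integral_shift[of G "-t"] by (simp add: A_def)
    finally show "(\<integral>\<^sup>+s. ennreal (G (s - t) * g t) \<partial>lborel) = ennreal A * ennreal (g t)" .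
  qed
  also have "\<dots> = ennreal A * (\<integral>\<^sup>+t. ennreal (g t) \<partial>lborel)"
    by (rule nn_integral_cmult) measurable
  finally show ?thesis .
qed

text \<open>Young's convolution inequality: integrate \<open>conv_jensen\<close> over s and exchange
  the integrals. One power of A comes from the exchange, the other p - 1 from Jensen.\<close>

lemma conv_Lp:
  assumes f: "Lp p f" and p: "p > 1"
  shows "Lp p (conv G f)"
    and "(LINT s|lborel. \<bar>conv G f s\<bar> powr p) \<le> A powr p * (LINT s|lborel. \<bar>f s\<bar> powr p)"
proof -
  have [measurable]: "f \<in> borel_measurable borel" using f by (simp add: Lp_def)
  let ?X = "LINT s|lborel. \<bar>f s\<bar> powr p"
  have X0: "?X \<ge> 0" by simp
  have "(\<integral>\<^sup>+s. ennreal (\<bar>conv G f s\<bar> powr p) \<partial>lborel) \<le>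
      (\<integral>\<^sup>+s. ennreal (A powr (p - 1)) * (\<integral>\<^sup>+t. ennreal (G (s - t) * \<bar>f t\<bar> powr p) \<partial>lborel) \<partial>lborel)"
  proof (rule nn_integral_mono)
    fix s
    have "ennreal (\<bar>conv G f s\<bar> powr p) \<le> ennreal (A powr (p - 1)) * ennreal (LINT t|lborel. G (s - t) * \<bar>f t\<bar> powr p)"
      using conv_jensen[OF f p, of s] by (simp add: ennreal_mult'[symmetric] ennreal_leI)
    also have "ennreal (LINT t|lborel. G (s - t) * \<bar>f t\<bar> powr p) = (\<integral>\<^sup>+t. ennreal (G (s - t) * \<bar>f t\<bar> powr p) \<partial>lborel)"
      by (rule nn_integral_eq_integral[symmetric, OF integrable_Lp_left[OF f]]) (use nonneg in auto)
    finally show "ennreal (\<bar>conv G f s\<bar> powr p) \<le>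
      ennreal (A powr (p - 1)) * (\<integral>\<^sup>+t. ennreal (G (s - t) * \<bar>f t\<bar> powr p) \<partial>lborel)" .
  qed
  also have "\<dots> = ennreal (A powr (p - 1)) * (\<integral>\<^sup>+s. (\<integral>\<^sup>+t. ennreal (G (s - t) * \<bar>f t\<bar> powr p) \<partial>lborel) \<partial>lborel)"
    by (rule nn_integral_cmult) measurable
  also have "\<dots> = ennreal (A powr (p - 1)) * (ennreal A * (\<integral>\<^sup>+t. ennreal (\<bar>f t\<bar> powr p) \<partial>lborel))"
    by (subst nn_conv_Lp) auto
  also have "(\<integral>\<^sup>+t. ennreal (\<bar>f t\<bar> powr p) \<partial>lborel) = ennreal ?X"
    using f by (intro nn_integral_eq_integral) (auto simp: Lp_def)
  also have "ennreal (A powr (p - 1)) * (ennreal A * ennreal ?X) = ennreal (A powr (p - 1) * A * ?X)"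
    using A_nonneg by (simp add: ennreal_mult'[symmetric] mult.assoc)
  also have "A powr (p - 1) * A = A powr p"
    using A_nonneg p by (cases "A = 0") (auto simp: powr_diff)
  finally have le: "(\<integral>\<^sup>+s. ennreal (\<bar>conv G f s\<bar> powr p) \<partial>lborel) \<le> ennreal (A powr p * ?X)" .
  then have i: "integrable lborel (\<lambda>s. \<bar>conv G f s\<bar> powr p)"
    by (intro integrableI_bounded) (auto simp: le_less_trans[OF _ ennreal_less_top])
  then show "Lp p (conv G f)" by (simp add: Lp_def)
  have "ennreal (LINT s|lborel. \<bar>conv G f s\<bar> powr p) = (\<integral>\<^sup>+s. ennreal (\<bar>conv G f s\<bar> powr p) \<partial>lborel)"
    by (rule nn_integral_eq_integral[symmetric, OF i]) simp
  with le have "ennreal (LINT s|lborel. \<bar>conv G f s\<bar> powr p) \<le> ennreal (A powr p * ?X)" by simp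
  then show "(LINT s|lborel. \<bar>conv G f s\<bar> powr p) \<le> A powr p * ?X"
    by (subst (asm) ennreal_le_iff) auto
qed

lemma conv_le_of_unit:
  assumes f: "Lp p f" and p: "p > 1" and X: "(LINT s|lborel. \<bar>f s\<bar> powr p) \<le> 1"
  shows "\<bar>conv G f s\<bar> \<le> A + B"
proof -
  have fa: "Lp p (\<lambda>t. \<bar>f t\<bar>)" using f by (auto simp: Lp_def)
  have ir: "integrable lborel (\<lambda>t. B * \<bar>f t\<bar> powr p)" using f by (simp add: Lp_def)
  have "\<bar>conv G f s\<bar> \<le> (LINT t|lborel. G (s - t) * \<bar>f t\<bar>)"
    using conv_abs_le[of f s] by (simp add: conv_def)
  also have "\<dots> \<le> (LINT t|lborel. G (s - t) + B * \<bar>f t\<bar> powr p)"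
  proof (rule integral_mono[OF integrable_Lp[OF fa p]])
    show "integrable lborel (\<lambda>t. G (s - t) + B * \<bar>f t\<bar> powr p)"
      by (intro Bochner_Integration.integrable_add integrable_reflect_shift[OF integrable] ir)
    fix t
    have "G (s - t) * \<bar>f t\<bar> \<le> G (s - t) * (1 + \<bar>f t\<bar> powr p)"
      using le_truncation[of "\<bar>f t\<bar>" 1 p] p nonneg by (intro mult_left_mono) auto
    also have "\<dots> \<le> G (s - t) + B * \<bar>f t\<bar> powr p"
      using mult_right_mono[OF bounded[of "s - t"], of "\<bar>f t\<bar> powr p"] by (simp add: algebra_simps)
    finally show "G (s - t) * \<bar>f t\<bar> \<le> G (s - t) + B * \<bar>f t\<bar> powr p" .
  qed
  also have "\<dots> = A + B * (LINT s|lborel. \<bar>f s\<bar> powr p)"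
    using integrable_reflect_shift[OF integrable] ir by (simp add: integral_reflect_shift A_def)
  also have "\<dots> \<le> A + B" using mult_left_mono[OF X B_nonneg] by simp
  finally show ?thesis .
qed

lemma integrable_diff_kernel: "integrable lborel (\<lambda>t. \<bar>G (s - t) - G (s' - t)\<bar>)"
  by (intro integrable_abs Bochner_Integration.integrable_diff integrable_reflect_shift[OF integrable])

lemma integral_diff_kernel: "(LINT t|lborel. \<bar>G (s - t) - G (s' - t)\<bar>) \<le> C * \<bar>s - s'\<bar>"
  using integral_reflect_shift[of "\<lambda>t. \<bar>G (t + (s - s')) - G t\<bar>" s'] lipschitz[of "s - s'"]
  by (simp add: algebra_simps)

text \<open>Split f at height N: the bounded part sees the L^1 modulus of G, the rest is at most
  \<open>N powr (1 - p)\<close> in L^1. Taking N large first and s near s' afterwards gives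
  equicontinuity uniform over the unit ball of L^p.\<close>

lemma conv_modulus:
  assumes f: "Lp p f" and p: "p > 1" and X: "(LINT s|lborel. \<bar>f s\<bar> powr p) \<le> 1" and N: "N > 0"
  shows "\<bar>conv G f s - conv G f s'\<bar> \<le> N * C * \<bar>s - s'\<bar> + B * N powr (1 - p)"
proof -
  let ?D = "\<lambda>t. \<bar>G (s - t) - G (s' - t)\<bar>"
  note i = integrable_Lp[OF f p]
  have ir: "integrable lborel (\<lambda>t. \<bar>f t\<bar> powr p)" using f by (simp add: Lp_def)
  have "conv G f s - conv G f s' = (LINT t|lborel. G (s - t) * f t - G (s' - t) * f t)"
    unfolding conv_def by (rule Bochner_Integration.integral_diff[symmetric, OF i i])
  also have "\<bar>\<dots>\<bar> \<le> (LINT t|lborel. \<bar>G (s - t) * f t - G (s' - t) * f t\<bar>)"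
    by (rule integral_abs_bound)
  also have "\<dots> \<le> (LINT t|lborel. N * ?D t + B * N powr (1 - p) * \<bar>f t\<bar> powr p)"
  proof (rule integral_mono)
    show "integrable lborel (\<lambda>t. \<bar>G (s - t) * f t - G (s' - t) * f t\<bar>)"
      by (intro integrable_abs Bochner_Integration.integrable_diff i)
    show "integrable lborel (\<lambda>t. N * ?D t + B * N powr (1 - p) * \<bar>f t\<bar> powr p)"
      by (intro Bochner_Integration.integrable_add integrable_mult_right integrable_diff_kernel ir)
    fix t
    have D: "0 \<le> ?D t" "?D t \<le> B"
      using nonneg[of "s - t"] nonneg[of "s' - t"] bounded[of "s - t"] bounded[of "s' - t"] by auto
    have "\<bar>G (s - t) * f t - G (s' - t) * f t\<bar> = ?D t * \<bar>f t\<bar>"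
      by (simp add: abs_mult[symmetric] left_diff_distrib)
    also have "\<dots> \<le> ?D t * (N + N powr (1 - p) * \<bar>f t\<bar> powr p)"
      using le_truncation[of "\<bar>f t\<bar>" N p] p N D by (intro mult_left_mono) auto
    also have "\<dots> \<le> N * ?D t + B * (N powr (1 - p) * \<bar>f t\<bar> powr p)"
      using mult_right_mono[OF D(2), of "N powr (1 - p) * \<bar>f t\<bar> powr p"] by (simp add: algebra_simps)
    finally show "\<bar>G (s - t) * f t - G (s' - t) * f t\<bar> \<le> N * ?D t + B * N powr (1 - p) * \<bar>f t\<bar> powr p"
      by (simp add: mult.assoc)
  qed
  also have "\<dots> = N * (LINT t|lborel. ?D t) + B * N powr (1 - p) * (LINT t|lborel. \<bar>f t\<bar> powr p)"
    by (simp add: integrable_diff_kernel ir)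
  also have "\<dots> \<le> N * (C * \<bar>s - s'\<bar>) + B * N powr (1 - p) * 1"
    using N B_nonneg by (intro add_mono mult_left_mono integral_diff_kernel X) auto
  finally show ?thesis by (simp add: mult.assoc)
qed

text \<open>The function that \<open>dual\<close> convolves is only known to be measurable and
  bounded. For such input the convolution is Lipschitz, which yields the continuity of the
  extremal.\<close>

lemma conv_bounded_modulus:
  assumes "f \<in> borel_measurable borel" "\<And>t. \<bar>f t\<bar> \<le> D"
  shows "\<bar>conv G f s - conv G f s'\<bar> \<le> D * C * \<bar>s - s'\<bar>"
proof -
  let ?D = "\<lambda>t. \<bar>G (s - t) - G (s' - t)\<bar>"
  note i = integrable_bounded[OF assms]
  have D0: "0 \<le> D" using assms(2)[of 0] by linarith
  have "conv G f s - conv G f s' = (LINT t|lborel. G (s - t) * f t - G (s' - t) * f t)"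
    unfolding conv_def by (rule Bochner_Integration.integral_diff[symmetric, OF i i])
  also have "\<bar>\<dots>\<bar> \<le> (LINT t|lborel. \<bar>G (s - t) * f t - G (s' - t) * f t\<bar>)"
    by (rule integral_abs_bound)
  also have "\<dots> \<le> (LINT t|lborel. D * ?D t)"
  proof (rule integral_mono)
    show "integrable lborel (\<lambda>t. \<bar>G (s - t) * f t - G (s' - t) * f t\<bar>)"
      by (intro integrable_abs Bochner_Integration.integrable_diff i)
    show "integrable lborel (\<lambda>t. D * ?D t)" by (intro integrable_mult_right integrable_diff_kernel)
    fix t
    have "\<bar>G (s - t) * f t - G (s' - t) * f t\<bar> = ?D t * \<bar>f t\<bar>"
      by (simp add: abs_mult[symmetric] left_diff_distrib)
    also have "\<dots> \<le> ?D t * D" using assms(2) by (intro mult_left_mono) auto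
    finally show "\<bar>G (s - t) * f t - G (s' - t) * f t\<bar> \<le> D * ?D t" by (simp add: mult.commute)
  qed
  also have "\<dots> \<le> D * (C * \<bar>s - s'\<bar>)"
    using D0 integral_diff_kernel by (simp add: mult_left_mono)
  finally show ?thesis by (simp add: mult.assoc)
qed

text \<open>Tonelli, with nonnegative integrals, so that integrability of one pairing can be
  transferred to the other in \<open>dual_pairing\<close>.\<close>

lemma conv_adjoint:
  assumes [measurable]: "f \<in> borel_measurable borel" "\<phi> \<in> borel_measurable borel"
    and f: "\<And>t. 0 \<le> f t" and \<phi>: "\<And>t. 0 \<le> \<phi> t"
    and i: "\<And>s. integrable lborel (\<lambda>t. G (s - t) * f t)"
    and j: "\<And>s. integrable lborel (\<lambda>t. G (t - s) * \<phi> t)"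
  shows "(\<integral>\<^sup>+s. ennreal (conv G f s * \<phi> s) \<partial>lborel) =
    (\<integral>\<^sup>+t. ennreal (f t * conv (\<lambda>t. G (- t)) \<phi> t) \<partial>lborel)"
proof -
  have "(\<integral>\<^sup>+s. ennreal (conv G f s * \<phi> s) \<partial>lborel) =
      (\<integral>\<^sup>+s. (\<integral>\<^sup>+t. ennreal (G (s - t) * f t * \<phi> s) \<partial>lborel) \<partial>lborel)"
  proof (rule nn_integral_cong)
    fix s
    have "ennreal (conv G f s * \<phi> s) = ennreal (LINT t|lborel. G (s - t) * f t * \<phi> s)"
      using i by (simp add: conv_def)
    also have "\<dots> = (\<integral>\<^sup>+t. ennreal (G (s - t) * f t * \<phi> s) \<partial>lborel)"
      using i[of s] by (intro nn_integral_eq_integral[symmetric]) (auto simp: f \<phi> nonneg)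
    finally show "ennreal (conv G f s * \<phi> s) = (\<integral>\<^sup>+t. ennreal (G (s - t) * f t * \<phi> s) \<partial>lborel)" .
  qed
  also have "\<dots> = (\<integral>\<^sup>+t. (\<integral>\<^sup>+s. ennreal (G (s - t) * f t * \<phi> s) \<partial>lborel) \<partial>lborel)"
    by (rule lborel_pair.Fubini') measurable
  also have "\<dots> = (\<integral>\<^sup>+t. ennreal (f t * conv (\<lambda>t. G (- t)) \<phi> t) \<partial>lborel)"
  proof (rule nn_integral_cong)
    fix t
    have eq: "G (s - t) * f t * \<phi> s = f t * (G (s - t) * \<phi> s)" for s by simp
    have "(\<integral>\<^sup>+s. ennreal (G (s - t) * f t * \<phi> s) \<partial>lborel) = ennreal (LINT s|lborel. f t * (G (s - t) * \<phi> s))"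
      unfolding eq using j[of t] by (intro nn_integral_eq_integral) (auto simp: f \<phi> nonneg)
    also have "(LINT s|lborel. f t * (G (s - t) * \<phi> s)) = f t * conv (\<lambda>t. G (- t)) \<phi> t"
      using j[of t] by (simp add: conv_def)
    finally show "(\<integral>\<^sup>+s. ennreal (G (s - t) * f t * \<phi> s) \<partial>lborel) = ennreal (f t * conv (\<lambda>t. G (- t)) \<phi> t)" .
  qed
  finally show ?thesis .
qed

lemma kernel_reflect: "kernel (\<lambda>t. G (- t)) A B C"
proof
  show "(LINT t|lborel. \<bar>G (- (t + h)) - G (- t)\<bar>) \<le> C * \<bar>h\<bar>" for h
    using integral_reflect_shift[of "\<lambda>t. \<bar>G (t + (- h)) - G t\<bar>" 0] lipschitz[of "-h"] by simp
  show "integrable lborel (\<lambda>t. G (- t))" using integrable_reflect_shift[OF integrable, of 0] by simp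
  show "A = (LINT t|lborel. G (- t))" using integral_reflect_shift[of G 0] by (simp add: A_def)
qed (auto simp: nonneg bounded)

end

text \<open>The defect is nonnegative, so a zero at x > 0 is an interior minimum in x, and its
  derivative \<open>x powr (p - 1) - y powr (p - 1)\<close> vanishes there. At x = 0 only the term
  in y is left.\<close>

lemma Young_powr_eqD:
  fixes x y p :: real
  assumes p: "p > 1" and x: "x \<ge> 0" and y: "y \<ge> 0"
    and eq: "x powr p / p + (p - 1) / p * y powr p - x * y powr (p - 1) = 0"
  shows "x = y"
proof (cases "x = 0")
  case True
  with eq p y show ?thesis by auto
next
  case False
  with x have x: "x > 0" by simp
  let ?F = "\<lambda>t. t powr p / p + (p - 1) / p * y powr p - t * y powr (p - 1)"
  have "x powr (p - 1) - y powr (p - 1) = 0"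
  proof (rule DERIV_local_min)
    show "(?F has_real_derivative (x powr (p - 1) - y powr (p - 1))) (at x)"
      using x p by (auto intro!: derivative_eq_intros simp: field_simps)
    show "0 < x" by (rule x)
    show "\<forall>t. \<bar>x - t\<bar> < x \<longrightarrow> ?F x \<le> ?F t"
      using Young_powr[OF p _ y] eq by (auto simp: abs_if split: if_splits)
  qed
  then have "x powr (p - 1) = y powr (p - 1)" by simp
  then have "(x powr (p - 1)) powr (1 / (p - 1)) = (y powr (p - 1)) powr (1 / (p - 1))" by simp
  with x y p show ?thesis by (simp add: powr_powr)
qed

text \<open>The defect is coercive in x, so x stays bounded. By continuity every limit of a
  subsequence has defect 0 against z, hence equals z.\<close>

lemma Young_defect_tendsto:
  fixes x y :: "nat \<Rightarrow> real"
  assumes p: "p > 1" and x: "\<And>i. x i \<ge> 0" and y: "\<And>i. y i \<ge> 0" and z: "y \<longlonglongrightarrow> z"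
    and d: "(\<lambda>i. x i powr p / p + (p - 1) / p * y i powr p - x i * y i powr (p - 1)) \<longlonglongrightarrow> 0"
  shows "x \<longlonglongrightarrow> z"
proof (rule ccontr)
  assume nt: "\<not> x \<longlonglongrightarrow> z"
  obtain Y where Y: "\<And>i. norm (y i) \<le> Y"
    using Bseq_def convergent_imp_Bseq[OF convergentI[OF z]] by (metis BseqE)
  have Y0: "Y \<ge> 0" using Y[of 0] norm_ge_zero[of "y 0"] by linarith
  \<comment> \<open>Beyond R, \<open>x powr p / p\<close> exceeds x * y^(p-1) + x for every y up to
    Y, so the defect is at least x > 1.\<close>
  define R where "R = max 1 ((p * (Y powr (p - 1) + 1)) powr (1 / (p - 1)))"
  obtain e where e: "e > 0" and inf: "\<exists>\<^sub>F i in sequentially. e \<le> \<bar>x i - z\<bar>"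
    using nt unfolding tendsto_iff by (auto simp: not_eventually dist_real_def not_less)
  have "\<forall>\<^sub>F i in sequentially. x i powr p / p + (p - 1) / p * y i powr p - x i * y i powr (p - 1) < 1"
    using d by (rule order_tendstoD) simp
  then have "\<forall>\<^sub>F i in sequentially. x i \<le> R"
  proof eventually_elim
    case (elim i)
    show ?case
    proof (rule ccontr)
      assume "\<not> x i \<le> R"
      then have x1: "x i > 1" and x2: "(p * (Y powr (p - 1) + 1)) powr (1 / (p - 1)) \<le> x i" by (auto simp: R_def)
      have "((p * (Y powr (p - 1) + 1)) powr (1 / (p - 1))) powr (p - 1) \<le> x i powr (p - 1)"
        using p x2 by (intro powr_mono2) auto
      then have 1: "p * (Y powr (p - 1) + 1) \<le> x i powr (p - 1)"
        using p Y0 by (simp add: powr_powr)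
      have "y i powr (p - 1) \<le> Y powr (p - 1)" using p y Y[of i] by (intro powr_mono2) auto
      with 1 p have "y i powr (p - 1) + 1 \<le> x i powr (p - 1) / p" by (simp add: field_simps) (smt (verit) mult_left_mono)
      then have "x i * (y i powr (p - 1) + 1) \<le> x i * (x i powr (p - 1) / p)"
        using x1 by (intro mult_left_mono) auto
      also have "x i * (x i powr (p - 1) / p) = x i powr p / p" using x1 by (simp add: powr_diff)
      finally have "x i * y i powr (p - 1) + x i \<le> x i powr p / p" by (simp add: algebra_simps)
      moreover have "0 \<le> (p - 1) / p * y i powr p" using p by simp
      ultimately show False using elim x1 by linarith
    qed
  qed
  with inf have "\<exists>\<^sub>F i in sequentially. e \<le> \<bar>x i - z\<bar> \<and> x i \<le> R"
    by (rule frequently_eventually_frequently)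
  then have "infinite {i. e \<le> \<bar>x i - z\<bar> \<and> x i \<le> R}"
    by (simp add: frequently_cofinite cofinite_eq_sequentially[symmetric])
  then obtain r :: "nat \<Rightarrow> nat" where "strict_mono r" and "\<And>n. r n \<in> {i. e \<le> \<bar>x i - z\<bar> \<and> x i \<le> R}"
    using infinite_enumerate by blast
  then have r: "strict_mono r" "\<And>n. e \<le> \<bar>x (r n) - z\<bar>" "\<And>n. x (r n) \<le> R" by auto
  have "\<And>n. (x \<circ> r) n \<in> {0..R}" using r x by auto
  then obtain l r' where l: "l \<in> {0..R}" "strict_mono (r' :: nat \<Rightarrow> nat)" "((x \<circ> r) \<circ> r') \<longlonglongrightarrow> l"
    using seq_compactE[OF compact_imp_seq_compact[OF compact_Icc], of "x \<circ> r" 0 R] by blast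
  have xl: "(\<lambda>n. x (r (r' n))) \<longlonglongrightarrow> l" using l(3) by (simp add: o_def)
  have sm: "strict_mono (r \<circ> r')" using r(1) l(2) by (rule strict_mono_o)
  have yl: "(\<lambda>n. y (r (r' n))) \<longlonglongrightarrow> z" using LIMSEQ_subseq_LIMSEQ[OF z sm] by (simp add: o_def)
  have z0: "z \<ge> 0" using z y by (meson LIMSEQ_le_const)
  have "(\<lambda>n. x (r (r' n)) powr p / p + (p - 1) / p * y (r (r' n)) powr p - x (r (r' n)) * y (r (r' n)) powr (p - 1))
      \<longlonglongrightarrow> l powr p / p + (p - 1) / p * z powr p - l * z powr (p - 1)"
    using p x y by (intro tendsto_intros tendsto_powr' xl yl) auto
  moreover have "(\<lambda>n. x (r (r' n)) powr p / p + (p - 1) / p * y (r (r' n)) powr p - x (r (r' n)) * y (r (r' n)) powr (p - 1)) \<longlonglongrightarrow> 0"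
    using LIMSEQ_subseq_LIMSEQ[OF d sm] by (simp add: o_def)
  ultimately have "l powr p / p + (p - 1) / p * z powr p - l * z powr (p - 1) = 0"
    by (rule LIMSEQ_unique)
  then have "l = z" using l(1) by (intro Young_powr_eqD[OF p _ z0]) auto
  moreover have "e \<le> \<bar>l - z\<bar>"
    by (rule LIMSEQ_le_const[OF tendsto_rabs[OF tendsto_diff[OF xl tendsto_const]]]) (use r(2) in auto)
  ultimately show False using e by simp
qed

section \<open>Compactness and limits of convolutions\<close>

context kernel
begin

lemma conv_tendsto_bounded:
  assumes "\<And>i. f i \<in> borel_measurable borel" and f: "\<And>i t. \<bar>f i t\<bar> \<le> D" and m: "g \<in> borel_measurable borel"
    and l: "AE t in lborel. (\<lambda>i. f i t) \<longlonglongrightarrow> g t"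
  shows "(\<lambda>i. conv G (f i) s) \<longlonglongrightarrow> conv G g s"
  unfolding conv_def
proof (rule integral_dominated_convergence[where w="\<lambda>t. G (s - t) * D"])
  note [measurable] = assms(1) m
  show "(\<lambda>t. G (s - t) * g t) \<in> borel_measurable lborel" by measurable
  show "(\<lambda>t. G (s - t) * f i t) \<in> borel_measurable lborel" for i by measurable
  show "integrable lborel (\<lambda>t. G (s - t) * D)"
    by (intro integrable_mult_left integrable_reflect_shift integrable)
  show "AE t in lborel. (\<lambda>i. G (s - t) * f i t) \<longlonglongrightarrow> G (s - t) * g t"
    using l by eventually_elim (rule tendsto_mult_left)
  show "AE t in lborel. norm (G (s - t) * f i t) \<le> G (s - t) * D" for i
    using f nonneg by (intro AE_I2) (auto simp: abs_mult intro!: mult_left_mono)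
qed

lemma conv_truncate:
  assumes f: "Lp p f" and p: "p > 1" and f0: "\<And>t. 0 \<le> f t"
    and X: "(LINT s|lborel. \<bar>f s\<bar> powr p) \<le> 1" and N: "N > 0"
  shows "\<bar>conv G f s - conv G (\<lambda>t. min (f t) N) s\<bar> \<le> B * N powr (1 - p)"
proof -
  have [measurable]: "f \<in> borel_measurable borel" using f by (simp add: Lp_def)
  have i1: "integrable lborel (\<lambda>t. G (s - t) * f t)" by (rule integrable_Lp[OF f p])
  have i2: "integrable lborel (\<lambda>t. G (s - t) * min (f t) N)"
    using f0 N by (intro integrable_bounded[where D=N]) auto
  have ir: "integrable lborel (\<lambda>t. \<bar>f t\<bar> powr p)" using f by (simp add: Lp_def)
  have "conv G f s - conv G (\<lambda>t. min (f t) N) s = (LINT t|lborel. G (s - t) * f t - G (s - t) * min (f t) N)"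
    unfolding conv_def by (rule Bochner_Integration.integral_diff[symmetric, OF i1 i2])
  also have "\<bar>\<dots>\<bar> \<le> (LINT t|lborel. \<bar>G (s - t) * f t - G (s - t) * min (f t) N\<bar>)"
    by (rule integral_abs_bound)
  also have "\<dots> \<le> (LINT t|lborel. B * N powr (1 - p) * \<bar>f t\<bar> powr p)"
  proof (rule integral_mono)
    show "integrable lborel (\<lambda>t. \<bar>G (s - t) * f t - G (s - t) * min (f t) N\<bar>)"
      by (intro integrable_abs Bochner_Integration.integrable_diff i1 i2)
    show "integrable lborel (\<lambda>t. B * N powr (1 - p) * \<bar>f t\<bar> powr p)" using ir by simp
    fix t
    have d: "0 \<le> f t - min (f t) N" "f t - min (f t) N \<le> N powr (1 - p) * \<bar>f t\<bar> powr p"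
      using le_truncation[of "f t" N p] p N f0[of t] by (auto simp: min_def)
    have "\<bar>G (s - t) * f t - G (s - t) * min (f t) N\<bar> = G (s - t) * (f t - min (f t) N)"
      using d nonneg by (simp add: right_diff_distrib[symmetric] abs_mult)
    also have "\<dots> \<le> B * (N powr (1 - p) * \<bar>f t\<bar> powr p)"
      using d nonneg bounded B_nonneg by (intro mult_mono) auto
    finally show "\<bar>G (s - t) * f t - G (s - t) * min (f t) N\<bar> \<le> B * N powr (1 - p) * \<bar>f t\<bar> powr p"
      by (simp add: mult.assoc)
  qed
  also have "\<dots> = B * N powr (1 - p) * (LINT t|lborel. \<bar>f t\<bar> powr p)" by simp
  also have "\<dots> \<le> B * N powr (1 - p) * 1"
    using B_nonneg X by (intro mult_left_mono) auto
  finally show ?thesis by simp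
qed

lemma ex_small_powr:
  assumes "p > 1" "e > 0"
  obtains N where "N > (0::real)" "B * N powr (1 - p) < e"
proof -
  have "((\<lambda>N. B * N powr (1 - p)) \<longlongrightarrow> B * 0) at_top"
    using assms by (intro tendsto_mult_left tendsto_neg_powr filterlim_ident) auto
  then have "\<forall>\<^sub>F N in at_top. B * N powr (1 - p) < e" using assms by (intro order_tendstoD) auto
  then have "\<forall>\<^sub>F N in at_top. B * N powr (1 - p) < e \<and> N > 0"
    using eventually_gt_at_top[of 0] by eventually_elim simp
  then obtain N where "B * N powr (1 - p) < e" "N > 0" by (auto dest: eventually_happens)
  then show thesis using that by blast
qed

text \<open>There is no dominating function, only a norm bound. After truncation at height N the
  integrands are dominated by N * G, and the truncation error is at most
  \<open>B * N powr (1 - p)\<close> for all i and for the limit.\<close>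

lemma conv_tendsto_Lp:
  assumes p: "p > 1" and f: "\<And>i. Lp p (f i)" "\<And>i t. 0 \<le> f i t" "\<And>i. (LINT s|lborel. \<bar>f i s\<bar> powr p) \<le> 1"
    and g: "Lp p g" "\<And>t. 0 \<le> g t" "(LINT s|lborel. \<bar>g s\<bar> powr p) \<le> 1"
    and l: "AE t in lborel. (\<lambda>i. f i t) \<longlonglongrightarrow> g t"
  shows "(\<lambda>i. conv G (f i) s) \<longlonglongrightarrow> conv G g s"
  unfolding LIMSEQ_def
proof (intro allI impI)
  fix e :: real assume "e > 0"
  then obtain N where N: "N > 0" "B * N powr (1 - p) < e / 3"
    using ex_small_powr[OF p, of "e / 3"] by auto
  have [measurable]: "f i \<in> borel_measurable borel" "g \<in> borel_measurable borel" for i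
    using f g by (auto simp: Lp_def)
  have "(\<lambda>i. conv G (\<lambda>t. min (f i t) N) s) \<longlonglongrightarrow> conv G (\<lambda>t. min (g t) N) s"
  proof (rule conv_tendsto_bounded[where D=N])
    show "AE t in lborel. (\<lambda>i. min (f i t) N) \<longlonglongrightarrow> min (g t) N"
      using l by eventually_elim (intro tendsto_min tendsto_const)
  qed (use f g N in auto)
  then obtain n where n: "\<And>i. i \<ge> n \<Longrightarrow> dist (conv G (\<lambda>t. min (f i t) N) s) (conv G (\<lambda>t. min (g t) N) s) < e / 3"
    using \<open>e > 0\<close> unfolding LIMSEQ_def by (metis divide_pos_pos zero_less_numeral)
  have "dist (conv G (f i) s) (conv G g s) < e" if "i \<ge> n" for i
    using n[OF that] conv_truncate[OF f(1) p f(2) f(3) N(1), of i s] conv_truncate[OF g(1) p g(2) g(3) N(1), of s] N(2)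
    unfolding dist_real_def by linarith
  then show "\<exists>n. \<forall>i\<ge>n. dist (conv G (f i) s) (conv G g s) < e" by blast
qed

text \<open>The Arzela-Ascoli argument: a diagonal sequence converges at all rationals, and
  equicontinuity carries the Cauchy property to every real point.\<close>

lemma conv_subsequence:
  assumes p: "p > 1" and f: "\<And>i. Lp p (f i)" "\<And>i. (LINT s|lborel. \<bar>f i s\<bar> powr p) \<le> 1"
  obtains r where "strict_mono (r :: nat \<Rightarrow> nat)" "\<And>s. convergent (\<lambda>n. conv G (f (r n)) s)"
proof -
  obtain r where r: "strict_mono (r :: nat \<Rightarrow> nat)" "\<And>s. s \<in> \<rat> \<Longrightarrow> \<exists>l. (\<lambda>n. conv G (f (r n)) s) \<longlonglongrightarrow> l"
    using function_convergent_subsequence[of "\<rat>" "\<lambda>i. conv G (f i)" "A + B"] conv_le_of_unit[OF f(1) p f(2)]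
    by (auto simp: countable_rat)
  have "Cauchy (\<lambda>n. conv G (f (r n)) s)" for s
  proof (rule metric_CauchyI)
    fix e :: real assume "e > 0"
    then obtain N where N: "N > 0" "B * N powr (1 - p) < e / 6"
      using ex_small_powr[OF p, of "e / 6"] by auto
    \<comment> \<open>Makes N * |C| * d at most e / 6; the summand 1 keeps the denominator positive
      when C = 0.\<close>
    define d where "d = e / (6 * (N * \<bar>C\<bar> + 1))"
    have d: "d > 0" using \<open>e > 0\<close> N by (simp add: d_def add_nonneg_pos)
    then obtain s' where s': "s' \<in> \<rat>" "s < s'" "s' < s + d" using Rats_dense_in_real[of s "s + d"] by auto
    have "Cauchy (\<lambda>n. conv G (f (r n)) s')" using r(2)[OF s'(1)] by (auto intro: LIMSEQ_imp_Cauchy)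
    then obtain n where n: "\<And>i l. i \<ge> n \<Longrightarrow> l \<ge> n \<Longrightarrow> dist (conv G (f (r i)) s') (conv G (f (r l)) s') < e / 3"
      using \<open>e > 0\<close> unfolding Cauchy_def by (metis divide_pos_pos zero_less_numeral)
    have "N * C * \<bar>s - s'\<bar> \<le> N * \<bar>C\<bar> * \<bar>s - s'\<bar>"
      using N by (intro mult_right_mono mult_left_mono) auto
    also have "\<dots> \<le> N * \<bar>C\<bar> * d"
      using s' N d by (intro mult_left_mono) auto
    also have "\<dots> = e / 6 * (N * \<bar>C\<bar> / (N * \<bar>C\<bar> + 1))"
      by (simp add: d_def)
    also have "\<dots> \<le> e / 6 * 1"
      using N \<open>e > 0\<close> by (intro mult_left_mono) (auto simp: divide_le_eq_1 intro: add_nonneg_pos)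
    finally have "N * C * \<bar>s - s'\<bar> \<le> e / 6" by simp
    then have m: "\<bar>conv G (f (r i)) s - conv G (f (r i)) s'\<bar> < e / 3" for i
      using conv_modulus[OF f(1) p f(2) N(1), of "r i" s s'] N(2) by linarith
    have "dist (conv G (f (r i)) s) (conv G (f (r l)) s) < e" if "i \<ge> n" "l \<ge> n" for i l
      using n[OF that] m[of i] m[of l] unfolding dist_real_def by linarith
    then show "\<exists>n. \<forall>i\<ge>n. \<forall>l\<ge>n. dist (conv G (f (r i)) s) (conv G (f (r l)) s) < e" by blast
  qed
  then have "convergent (\<lambda>n. conv G (f (r n)) s)" for s by (rule Cauchy_convergent)
  with r(1) show thesis using that by blast
qed

end

section \<open>The variational problem on the line\<close>

context kernel
begin

lemma conv_powr_bound:
  assumes p: "1 < p" "p < q" and f: "Lp p f" and X: "(LINT s|lborel. \<bar>f s\<bar> powr p) \<le> 1"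
  shows "Lp q (conv G f)" and "(LINT s|lborel. \<bar>conv G f s\<bar> powr q) \<le> (A + B) powr (q - p) * A powr p"
proof -
  note b = integrable_powr_mono[OF conv_Lp(1)[OF f p(1)] conv_le_of_unit[OF f p(1) X], of q]
  show "Lp q (conv G f)" using b p by simp
  have "(LINT s|lborel. \<bar>conv G f s\<bar> powr q) \<le> (A + B) powr (q - p) * (LINT s|lborel. \<bar>conv G f s\<bar> powr p)"
    using b p by simp
  also have "\<dots> \<le> (A + B) powr (q - p) * (A powr p * 1)"
    using conv_Lp(2)[OF f p(1)] X
    by (intro mult_left_mono order_trans[OF conv_Lp(2)[OF f p(1)]]) auto
  finally show "(LINT s|lborel. \<bar>conv G f s\<bar> powr q) \<le> (A + B) powr (q - p) * A powr p" by simp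
qed

text \<open>By \<open>conv_abs_le\<close>, replacing f by |f| can only increase the functional, so
  the supremum over nonnegative functions also bounds the signed case. Tonelli and Young's
  inequality then apply directly.\<close>

definition unit_nonneg :: "real \<Rightarrow> (real \<Rightarrow> real) set" where
  "unit_nonneg p = {f. Lp p f \<and> (\<forall>t. 0 \<le> f t) \<and> (LINT s|lborel. \<bar>f s\<bar> powr p) \<le> 1}"

definition opt_val :: "real \<Rightarrow> real \<Rightarrow> real" where
  "opt_val p q = Sup ((\<lambda>f. LINT s|lborel. \<bar>conv G f s\<bar> powr q) ` unit_nonneg p)"

lemma opt_val_upper:
  assumes "1 < p" "p < q" "f \<in> unit_nonneg p"
  shows "(LINT s|lborel. \<bar>conv G f s\<bar> powr q) \<le> opt_val p q"
  unfolding opt_val_def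
proof (rule cSup_upper)
  show "bdd_above ((\<lambda>f. LINT s|lborel. \<bar>conv G f s\<bar> powr q) ` unit_nonneg p)"
    using conv_powr_bound(2)[OF assms(1,2)] by (auto simp: unit_nonneg_def intro!: bdd_aboveI2)
qed (use assms in auto)

text \<open>For the indicator of the unit interval the convolution has total mass A > 0 by Tonelli,
  so it is not 0 almost everywhere.\<close>

lemma opt_val_pos:
  assumes p: "1 < p" "p < q" and A: "A > 0"
  shows "opt_val p q > 0"
proof -
  define f :: "real \<Rightarrow> real" where "f = indicator {0..1}"
  have f: "f \<in> unit_nonneg p"
  proof -
    have "(\<lambda>s. \<bar>f s\<bar> powr p) = indicator {0..1}" using p by (auto simp: f_def indicator_def)
    then show ?thesis by (auto simp: unit_nonneg_def Lp_def f_def)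
  qed
  then have Lf: "Lp p f" and X: "(LINT s|lborel. \<bar>f s\<bar> powr p) \<le> 1" by (auto simp: unit_nonneg_def)
  have fm [measurable]: "f \<in> borel_measurable borel" by (simp add: f_def)
  note q = conv_powr_bound(1)[OF p Lf X]
  have "(LINT s|lborel. \<bar>conv G f s\<bar> powr q) \<noteq> 0"
  proof
    assume "(LINT s|lborel. \<bar>conv G f s\<bar> powr q) = 0"
    then have "AE s in lborel. \<bar>conv G f s\<bar> powr q = 0"
      using q by (subst (asm) integral_nonneg_eq_0_iff_AE) (auto simp: Lp_def)
    then have "AE s in lborel. (\<integral>\<^sup>+t. ennreal (G (s - t) * f t) \<partial>lborel) = 0"
    proof eventually_elim
      case (elim s)
      have "(\<integral>\<^sup>+t. ennreal (G (s - t) * f t) \<partial>lborel) = ennreal (conv G f s)"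
        unfolding conv_def by (rule nn_integral_eq_integral[OF integrable_Lp[OF Lf p(1)]])
          (auto simp: nonneg f_def)
      with elim show ?case by simp
    qed
    then have "(\<integral>\<^sup>+s. (\<integral>\<^sup>+t. ennreal (G (s - t) * f t) \<partial>lborel) \<partial>lborel) = 0"
      by (subst nn_integral_0_iff_AE) auto
    then have "ennreal A * (\<integral>\<^sup>+t. ennreal (f t) \<partial>lborel) = 0"
      by (subst (asm) nn_conv_Lp) (auto simp: f_def)
    moreover have "(\<integral>\<^sup>+t. ennreal (f t) \<partial>lborel) = 1"
      by (simp add: f_def ennreal_indicator)
    ultimately show False using A by simp
  qed
  moreover have "(LINT s|lborel. \<bar>conv G f s\<bar> powr q) \<ge> 0" by simp
  ultimately show ?thesis using opt_val_upper[OF p f] by linarith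
qed

text \<open>Homogeneity: normalise |g| in L^p and compare; the factor c^q equals the integral of
  |g|^p to the power q / p. If that integral is 0, the convolution vanishes identically.\<close>

lemma conv_le_opt_val:
  assumes p: "1 < p" "p < q" and g: "Lp p g"
  shows "Lp q (conv G g)"
    and "(LINT s|lborel. \<bar>conv G g s\<bar> powr q) \<le> opt_val p q * (LINT s|lborel. \<bar>g s\<bar> powr p) powr (q / p)"
proof -
  let ?X = "LINT s|lborel. \<bar>g s\<bar> powr p"
  have [measurable]: "g \<in> borel_measurable borel" using g by (simp add: Lp_def)
  have *: "Lp q (conv G g) \<and> (LINT s|lborel. \<bar>conv G g s\<bar> powr q) \<le> opt_val p q * ?X powr (q / p)"
  proof (cases "?X = 0")
    case True
    then have "AE s in lborel. \<bar>g s\<bar> powr p = 0"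
      using g by (subst (asm) integral_nonneg_eq_0_iff_AE) (auto simp: Lp_def)
    then have "conv G g s = 0" for s
      unfolding conv_def by (intro integral_eq_zero_AE) (auto elim!: eventually_mono)
    then have "conv G g = (\<lambda>s. 0)" by auto
    then show ?thesis using p True by (simp add: Lp_def)
  next
    case False
    then have X: "?X > 0" by (simp add: less_le)
    define c where "c = ?X powr (1 / p)"
    have c: "c > 0" "c powr p = ?X" using X p by (auto simp: c_def powr_powr)
    define h where "h s = (1 / c) * \<bar>g s\<bar>" for s
    have hp: "\<bar>h s\<bar> powr p = (1 / ?X) * \<bar>g s\<bar> powr p" for s
      using c by (simp add: h_def abs_mult powr_mult powr_divide)
    have h: "h \<in> unit_nonneg p"
    proof -
      have "h \<in> borel_measurable borel" unfolding h_def[abs_def] by measurable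
      moreover have "(\<lambda>s. \<bar>h s\<bar> powr p) = (\<lambda>s. (1 / ?X) * \<bar>g s\<bar> powr p)" using hp by auto
      moreover have "0 \<le> h t" for t using c(1) by (simp add: h_def)
      moreover have "integrable lborel (\<lambda>s. (1 / ?X) * \<bar>g s\<bar> powr p)"
        using g by (intro integrable_mult_right) (simp add: Lp_def)
      ultimately show ?thesis using X unfolding unit_nonneg_def Lp_def by simp
    qed
    then have Lh: "Lp p h" "(LINT s|lborel. \<bar>h s\<bar> powr p) \<le> 1" by (auto simp: unit_nonneg_def)
    have le: "\<bar>conv G g s\<bar> powr q \<le> c powr q * \<bar>conv G h s\<bar> powr q" for s
    proof -
      have "conv G (\<lambda>t. \<bar>g t\<bar>) s = c * conv G h s"
        using c(1) unfolding conv_cmult[symmetric] by (simp add: h_def)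
      then have "\<bar>conv G g s\<bar> \<le> \<bar>c * conv G h s\<bar>" using conv_abs_le[of g s] by simp
      then have "\<bar>conv G g s\<bar> powr q \<le> \<bar>c * conv G h s\<bar> powr q" using p by (intro powr_mono2) auto
      then show ?thesis using c(1) by (simp add: abs_mult powr_mult)
    qed
    have ih: "integrable lborel (\<lambda>s. c powr q * \<bar>conv G h s\<bar> powr q)"
      using conv_powr_bound(1)[OF p Lh] by (simp add: Lp_def)
    have ig: "integrable lborel (\<lambda>s. \<bar>conv G g s\<bar> powr q)"
      by (rule Bochner_Integration.integrable_bound[OF ih]) (use le in \<open>auto simp: abs_mult\<close>)
    have "(LINT s|lborel. \<bar>conv G g s\<bar> powr q) \<le> (LINT s|lborel. c powr q * \<bar>conv G h s\<bar> powr q)"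
      by (rule integral_mono[OF ig ih le])
    also have "\<dots> = c powr q * (LINT s|lborel. \<bar>conv G h s\<bar> powr q)" by simp
    also have "\<dots> \<le> c powr q * opt_val p q"
      by (intro mult_left_mono opt_val_upper[OF p h]) auto
    also have "c powr q = ?X powr (q / p)" by (simp add: c_def powr_powr)
    finally show ?thesis using ig by (simp add: Lp_def mult.commute)
  qed
  then show "Lp q (conv G g)"
    "(LINT s|lborel. \<bar>conv G g s\<bar> powr q) \<le> opt_val p q * ?X powr (q / p)" by auto
qed

text \<open>The lower bound at 0 is the number c with c^(q-p) A^p = M / 2, where M is the optimal
  value. If G * f stayed below c, interpolation would give at most M / 2 for the functional, which
  is less than what a near-maximiser attains.\<close>

lemma near_optimal:
  assumes p: "1 < p" "p < q" and A: "A > 0" and e: "0 < e" "e \<le> opt_val p q / 2"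
  shows "\<exists>f\<in>unit_nonneg p. (LINT s|lborel. \<bar>conv G f s\<bar> powr q) > opt_val p q - e \<and>
    (opt_val p q / 2 / A powr p) powr (1 / (q - p)) \<le> conv G f 0"
proof -
  let ?c = "(opt_val p q / 2 / A powr p) powr (1 / (q - p))"
  have M: "opt_val p q > 0" using opt_val_pos[OF p A] .
  have "(\<lambda>t. 0) \<in> unit_nonneg p" by (auto simp: unit_nonneg_def Lp_def)
  then have "unit_nonneg p \<noteq> {}" by auto
  then obtain f where f: "f \<in> unit_nonneg p" "(LINT s|lborel. \<bar>conv G f s\<bar> powr q) > opt_val p q - e"
    using less_cSupE[of "opt_val p q - e" "(\<lambda>f. LINT s|lborel. \<bar>conv G f s\<bar> powr q) ` unit_nonneg p"] e
    by (auto simp: opt_val_def)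
  then have Lf: "Lp p f" and f0: "\<And>t. 0 \<le> f t" and X: "(LINT s|lborel. \<bar>f s\<bar> powr p) \<le> 1"
    by (auto simp: unit_nonneg_def)
  obtain s where s: "?c \<le> conv G f s"
  proof (rule ccontr)
    assume "\<not> thesis"
    with that have "conv G f s < ?c" for s by (meson not_less)
    then have "\<bar>conv G f s\<bar> \<le> ?c" for s using conv_nonneg[OF f0, where s=s] by (simp add: less_imp_le)
    then have "(LINT s|lborel. \<bar>conv G f s\<bar> powr q) \<le> ?c powr (q - p) * (LINT s|lborel. \<bar>conv G f s\<bar> powr p)"
      using p by (intro integrable_powr_mono(2)[OF conv_Lp(1)[OF Lf p(1)]]) auto
    also have "\<dots> \<le> ?c powr (q - p) * (A powr p * 1)"
      using X by (intro mult_left_mono order_trans[OF conv_Lp(2)[OF Lf p(1)]]) auto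
    also have "?c powr (q - p) = opt_val p q / 2 / A powr p"
      using p M A by (simp add: powr_powr)
    finally show False using f(2) e A by simp
  qed
  \<comment> \<open>Translation changes neither the norm nor the functional and moves the large
    value to the origin.\<close>
  define h where "h t = f (t + s)" for t
  have cs: "conv G h t = conv G f (t + s)" for t unfolding h_def by (rule conv_shift)
  have "h \<in> unit_nonneg p"
    using Lp_shift[OF Lf, of s] X f0 integral_shift[of "\<lambda>t. \<bar>f t\<bar> powr p" s]
    by (auto simp: unit_nonneg_def h_def[abs_def])
  moreover have "(LINT t|lborel. \<bar>conv G h t\<bar> powr q) > opt_val p q - e"
    using f(2) integral_shift[of "\<lambda>t. \<bar>conv G f t\<bar> powr q" s] by (simp add: cs)
  moreover have "?c \<le> conv G h 0" using s by (simp add: cs)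
  ultimately show ?thesis by blast
qed

text \<open>The Euler--Lagrange map: an extremal \<open>g = conv G f\<close> satisfies \<open>f\<^sup>p\<^sup>-\<^sup>1 = dual p q g\<close>.\<close>

definition dual :: "real \<Rightarrow> real \<Rightarrow> (real \<Rightarrow> real) \<Rightarrow> real \<Rightarrow> real" where
  "dual p q g t = conv (\<lambda>t. G (- t)) (\<lambda>s. g s powr (q - 1)) t / opt_val p q"

text \<open>Young's inequality with exponent q shows that the right-hand pairing is finite, and
  \<open>conv_adjoint\<close> passes this on to the left. The bound D ensures that the convolution
  inside \<open>dual\<close> converges at every point.\<close>

lemma dual_pairing:
  assumes p: "1 < p" "p < q" and u: "Lp p u" "\<And>t. 0 \<le> u t"
    and g: "Lp q g" "\<And>t. 0 \<le> g t" "\<And>t. g t \<le> D"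
  shows "integrable lborel (\<lambda>t. u t * dual p q g t)"
    and "integrable lborel (\<lambda>s. conv G u s * g s powr (q - 1))"
    and "(LINT t|lborel. u t * dual p q g t) = (LINT s|lborel. conv G u s * g s powr (q - 1)) / opt_val p q"
proof -
  interpret R: kernel "\<lambda>t. G (- t)" A B C by (rule kernel_reflect)
  have [measurable]: "u \<in> borel_measurable borel" "g \<in> borel_measurable borel"
    using u g by (auto simp: Lp_def)
  have q: "1 < q" using p by simp
  have gb: "\<bar>g s powr (q - 1)\<bar> \<le> D powr (q - 1)" for s
    using g q by (auto intro: powr_mono2)
  have cu: "0 \<le> conv G u s" for s by (rule conv_nonneg[OF u(2)])
  note cq = conv_le_opt_val(1)[OF p u(1)]
  show i1: "integrable lborel (\<lambda>s. conv G u s * g s powr (q - 1))"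
  proof (rule Bochner_Integration.integrable_bound)
    show "integrable lborel (\<lambda>s. \<bar>conv G u s\<bar> powr q / q + (q - 1) / q * \<bar>g s\<bar> powr q)"
      using cq g(1) by (intro Bochner_Integration.integrable_add) (auto simp: Lp_def)
    show "(\<lambda>s. conv G u s * g s powr (q - 1)) \<in> borel_measurable lborel" by measurable
    show "AE s in lborel. norm (conv G u s * g s powr (q - 1)) \<le> norm (\<bar>conv G u s\<bar> powr q / q + (q - 1) / q * \<bar>g s\<bar> powr q)"
      using Young_powr[OF q cu g(2)] cu g(2) q by (intro AE_I2) (auto simp: abs_mult)
  qed
  have adj: "(\<integral>\<^sup>+s. ennreal (conv G u s * g s powr (q - 1)) \<partial>lborel) =
      (\<integral>\<^sup>+t. ennreal (u t * conv (\<lambda>t. G (- t)) (\<lambda>s. g s powr (q - 1)) t) \<partial>lborel)"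
  proof (rule conv_adjoint)
    show "integrable lborel (\<lambda>t. G (t - s) * g t powr (q - 1))" for s
      using R.integrable_bounded[of "\<lambda>s. g s powr (q - 1)" "D powr (q - 1)" s] gb by simp
    show "integrable lborel (\<lambda>t. G (s - t) * u t)" for s by (rule integrable_Lp[OF u(1) p(1)])
  qed (use u in auto)
  have d0: "0 \<le> conv (\<lambda>t. G (- t)) (\<lambda>s. g s powr (q - 1)) t" for t by (rule R.conv_nonneg) simp
  have nn1: "(\<integral>\<^sup>+s. ennreal (conv G u s * g s powr (q - 1)) \<partial>lborel) = ennreal (LINT s|lborel. conv G u s * g s powr (q - 1))"
    by (rule nn_integral_eq_integral[OF i1]) (use cu in auto)
  have i2: "integrable lborel (\<lambda>t. u t * conv (\<lambda>t. G (- t)) (\<lambda>s. g s powr (q - 1)) t)"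
    using adj nn1 d0 u(2) by (intro integrableI_nonneg) (auto simp: less_top[symmetric] intro: R.conv_measurable)
  then show "integrable lborel (\<lambda>t. u t * dual p q g t)" by (simp add: dual_def)
  have "(LINT t|lborel. u t * conv (\<lambda>t. G (- t)) (\<lambda>s. g s powr (q - 1)) t) = (LINT s|lborel. conv G u s * g s powr (q - 1))"
  proof -
    have "ennreal (LINT t|lborel. u t * conv (\<lambda>t. G (- t)) (\<lambda>s. g s powr (q - 1)) t) = ennreal (LINT s|lborel. conv G u s * g s powr (q - 1))"
      using adj nn1 nn_integral_eq_integral[OF i2] d0 u(2) by simp
    then show ?thesis
      by (subst (asm) ennreal_inj) (use cu d0 u(2) in \<open>auto intro!: integral_nonneg_AE\<close>)
  qed
  then show "(LINT t|lborel. u t * dual p q g t) = (LINT s|lborel. conv G u s * g s powr (q - 1)) / opt_val p q"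
    by (simp add: dual_def)
qed

lemma dual_properties:
  assumes p: "1 < p" "p < q" and A: "A > 0"
    and g: "g \<in> borel_measurable borel" "\<And>t. 0 \<le> g t" "\<And>t. g t \<le> D"
  shows "0 \<le> dual p q g t" and "dual p q g t \<le> A * D powr (q - 1) / opt_val p q"
    and "continuous_on UNIV (dual p q g)"
proof -
  interpret R: kernel "\<lambda>t. G (- t)" A B C by (rule kernel_reflect)
  have M: "opt_val p q > 0" using opt_val_pos[OF p A] .
  have m: "(\<lambda>s. g s powr (q - 1)) \<in> borel_measurable borel" using g(1) by measurable
  have gb: "\<bar>g s powr (q - 1)\<bar> \<le> D powr (q - 1)" for s
    using g p by (auto intro: powr_mono2)
  show "0 \<le> dual p q g t" unfolding dual_def using M by (intro divide_nonneg_pos R.conv_nonneg) auto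
  show "dual p q g t \<le> A * D powr (q - 1) / opt_val p q"
    unfolding dual_def using M R.conv_bounded[OF m gb, of t] by (intro divide_right_mono) auto
  have "(D powr (q - 1) * C)-lipschitz_on UNIV (conv (\<lambda>t. G (- t)) (\<lambda>s. g s powr (q - 1)))"
    if "C \<ge> 0"
    using R.conv_bounded_modulus[OF m gb] that by (intro lipschitz_onI) (auto simp: dist_real_def)
  moreover have "C \<ge> 0"
    using order_trans[OF integral_nonneg_AE lipschitz[of 1]] by simp
  ultimately show "continuous_on UNIV (dual p q g)"
    unfolding dual_def[abs_def] using M
    by (intro continuous_on_divide continuous_on_const) (auto intro: lipschitz_on_continuous_on)
qed

text \<open>For psi in the unit ball, the pairing of psi with h = \<open>dual p q (conv G f)\<close>
  is the integral of (G * psi) (G * f)^(q-1) divided by M. Young's inequality with exponent q and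
  the maximality of M for both psi and f bound it by 1. Taking psi proportional to y, where y^p = y
  * h, turns this into the bound on the norm of y.\<close>

lemma dual_norm_le:
  assumes p: "1 < p" "p < q" and A: "A > 0" and f: "f \<in> unit_nonneg p"
  defines "y \<equiv> \<lambda>t. dual p q (conv G f) t powr (1 / (p - 1))"
  shows "Lp p y" and "(LINT t|lborel. \<bar>y t\<bar> powr p) \<le> 1"
proof -
  have M: "opt_val p q > 0" using opt_val_pos[OF p A] .
  have Lf: "Lp p f" and f0: "\<And>t. 0 \<le> f t" and X: "(LINT s|lborel. \<bar>f s\<bar> powr p) \<le> 1"
    using f by (auto simp: unit_nonneg_def)
  have [measurable]: "f \<in> borel_measurable borel" using Lf by (simp add: Lp_def)
  have g0: "0 \<le> conv G f t" for t by (rule conv_nonneg[OF f0])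
  have gD: "conv G f t \<le> A + B" for t using conv_le_of_unit[OF Lf p(1) X, of t] by simp
  have gm: "conv G f \<in> borel_measurable borel" by measurable
  note gq = conv_powr_bound(1)[OF p Lf X]
  define h where "h = dual p q (conv G f)"
  define H where "H = A * (A + B) powr (q - 1) / opt_val p q"
  have h: "0 \<le> h t" "h t \<le> H" "continuous_on UNIV h" for t
    using dual_properties[OF p A gm g0 gD] by (auto simp: h_def H_def)
  have [measurable]: "h \<in> borel_measurable borel" using h(3) by (rule borel_measurable_continuous_onI)
  have y: "y t = h t powr (1 / (p - 1))" for t by (simp add: y_def h_def)
  have yp: "\<bar>y t\<bar> powr p = y t * h t" for t
  proof (cases "h t = 0")
    case True then show ?thesis using p by (simp add: y)
  next
    case False
    then have ht: "h t > 0" using h(1)[of t] by simp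
    have "p / (p - 1) = 1 / (p - 1) + 1" using p by (simp add: field_simps)
    then show ?thesis using ht by (simp add: y powr_powr powr_add)
  qed
  have ym [measurable]: "y \<in> borel_measurable borel" unfolding y[abs_def] by measurable
  have yb: "0 \<le> y t" "y t \<le> H powr (1 / (p - 1))" for t
    unfolding y using h(1)[of t] h(2)[of t] p by (auto intro!: powr_mono2)
  \<comment> \<open>So far y is only known to be bounded, so it cannot be normalised in L^p. Its
    restrictions to bounded intervals can, and Fatou's lemma removes the restriction
    afterwards.\<close>
  have trunc: "integrable lborel (\<lambda>t. \<bar>indicator {-R..R} t * y t\<bar> powr p)"
    "(LINT t|lborel. \<bar>indicator {-R..R} t * y t\<bar> powr p) \<le> 1" for R :: real
  proof -
    let ?Y = "\<lambda>t. indicator {-R..R} t * y t"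
    have Yp: "\<bar>?Y t\<bar> powr p = indicator {-R..R} t * (y t * h t)" for t
      using yp[of t] by (auto simp: indicator_def)
    have bd: "\<bar>y t * h t\<bar> \<le> H powr (1 / (p - 1)) * H" for t
      using yb[of t] h(1)[of t] h(2)[of t] by (auto simp: abs_mult intro!: mult_mono)
    show i: "integrable lborel (\<lambda>t. \<bar>?Y t\<bar> powr p)"
      unfolding Yp using bd emeasure_compact_finite[of "{-R..R}"]
      by (intro integrable_bounded_mult integrable_real_indicator) auto
    define Z where "Z = (LINT t|lborel. \<bar>?Y t\<bar> powr p)"
    have "Z \<le> 1"
    proof (cases "Z = 0")
      case False
      moreover have "Z \<ge> 0" by (simp add: Z_def)
      ultimately have Z: "Z > 0" by simp
      define c where "c = Z powr (1 / p)"
      have c: "c > 0" "c powr p = Z" using Z p by (auto simp: c_def powr_powr)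
      define \<psi> where "\<psi> t = (1 / c) * ?Y t" for t
      have \<psi>p: "\<bar>\<psi> t\<bar> powr p = (1 / Z) * \<bar>?Y t\<bar> powr p" for t
        using c by (simp add: \<psi>_def abs_mult powr_mult powr_divide)
      have \<psi>: "\<psi> \<in> unit_nonneg p"
      proof -
        have "\<psi> \<in> borel_measurable borel" unfolding \<psi>_def[abs_def] by measurable
        moreover have "(\<lambda>s. \<bar>\<psi> s\<bar> powr p) = (\<lambda>s. (1 / Z) * \<bar>?Y s\<bar> powr p)" using \<psi>p by auto
        moreover have "0 \<le> \<psi> t" for t using c(1) yb(1)[of t] by (simp add: \<psi>_def)
        moreover have "integrable lborel (\<lambda>s. (1 / Z) * \<bar>?Y s\<bar> powr p)"
          by (intro integrable_mult_right i)
        moreover have "(LINT s|lborel. (1 / Z) * \<bar>?Y s\<bar> powr p) = 1"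
          using Z by (simp add: Z_def[symmetric] integral_mult_right_zero del: abs_mult)
        ultimately show ?thesis unfolding unit_nonneg_def Lp_def by simp
      qed
      then have L\<psi>: "Lp p \<psi>" and \<psi>0: "\<And>t. 0 \<le> \<psi> t" and \<psi>1: "(LINT s|lborel. \<bar>\<psi> s\<bar> powr p) \<le> 1"
        by (auto simp: unit_nonneg_def)
      note dp = dual_pairing[OF p L\<psi> \<psi>0 gq g0 gD]
      have "Z / c = (LINT t|lborel. \<psi> t * h t)"
      proof -
        have "\<psi> t * h t = (1 / c) * \<bar>?Y t\<bar> powr p" for t unfolding Yp by (simp add: \<psi>_def)
        then show ?thesis by (simp add: Z_def)
      qed
      also have "\<dots> = (LINT s|lborel. conv G \<psi> s * conv G f s powr (q - 1)) / opt_val p q"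
        using dp(3) by (simp add: h_def)
      also have "\<dots> \<le> (opt_val p q / q + (q - 1) / q * opt_val p q) / opt_val p q"
      proof (rule divide_right_mono)
        have iq: "integrable lborel (\<lambda>s. \<bar>conv G \<psi> s\<bar> powr q)" "integrable lborel (\<lambda>s. \<bar>conv G f s\<bar> powr q)"
          using conv_powr_bound(1)[OF p L\<psi> \<psi>1] gq by (auto simp: Lp_def)
        have "(LINT s|lborel. conv G \<psi> s * conv G f s powr (q - 1)) \<le>
            (LINT s|lborel. \<bar>conv G \<psi> s\<bar> powr q / q + (q - 1) / q * \<bar>conv G f s\<bar> powr q)"
        proof (rule integral_mono[OF dp(2)])
          show "integrable lborel (\<lambda>s. \<bar>conv G \<psi> s\<bar> powr q / q + (q - 1) / q * \<bar>conv G f s\<bar> powr q)"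
            using iq by (intro Bochner_Integration.integrable_add) auto
          show "conv G \<psi> s * conv G f s powr (q - 1) \<le> \<bar>conv G \<psi> s\<bar> powr q / q + (q - 1) / q * \<bar>conv G f s\<bar> powr q" for s
            using Young_powr[of q "conv G \<psi> s" "conv G f s"] p conv_nonneg[OF \<psi>0, where s=s] g0[of s] by simp
        qed
        also have "\<dots> = (LINT s|lborel. \<bar>conv G \<psi> s\<bar> powr q) / q + (q - 1) / q * (LINT s|lborel. \<bar>conv G f s\<bar> powr q)"
          using iq by simp
        also have "\<dots> \<le> opt_val p q / q + (q - 1) / q * opt_val p q"
          using opt_val_upper[OF p \<psi>] opt_val_upper[OF p f] p
          by (intro add_mono divide_right_mono mult_left_mono) auto
        finally show "(LINT s|lborel. conv G \<psi> s * conv G f s powr (q - 1)) \<le> opt_val p q / q + (q - 1) / q * opt_val p q" .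
      qed (use M in simp)
      also have "\<dots> = 1" using M p by (simp add: field_simps)
      finally have "Z \<le> c" using c by simp
      \<comment> \<open>From Z <= Z^(1/p) with p > 1 it follows that Z <= 1.\<close>
      then have "Z powr 1 \<le> Z powr (1 / p)" using Z by (simp add: c_def)
      show ?thesis
      proof (rule ccontr)
        assume "\<not> Z \<le> 1"
        then have "Z powr (1 / p) < Z powr 1" using p by (intro powr_less_mono) auto
        with \<open>Z powr 1 \<le> Z powr (1 / p)\<close> show False by simp
      qed
    qed simp
    then show "(LINT t|lborel. \<bar>?Y t\<bar> powr p) \<le> 1" by (simp add: Z_def)
  qed
  have "(\<integral>\<^sup>+t. ennreal (\<bar>y t\<bar> powr p) \<partial>lborel) \<le> liminf (\<lambda>n. \<integral>\<^sup>+t. ennreal (\<bar>indicator {-real n..real n} t * y t\<bar> powr p) \<partial>lborel)"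
  proof -
    have "(\<integral>\<^sup>+t. ennreal (\<bar>y t\<bar> powr p) \<partial>lborel) \<le> (\<integral>\<^sup>+t. liminf (\<lambda>n. ennreal (\<bar>indicator {-real n..real n} t * y t\<bar> powr p)) \<partial>lborel)"
    proof (rule nn_integral_mono)
      fix t
      obtain n0 :: nat where n0: "\<bar>t\<bar> \<le> real n0" using real_arch_simple by blast
      have "ennreal (\<bar>y t\<bar> powr p) \<le> ennreal (\<bar>indicator {-real n..real n} t * y t\<bar> powr p)" if "n \<ge> n0" for n
        using n0 that by (auto simp: indicator_def)
      then show "ennreal (\<bar>y t\<bar> powr p) \<le> liminf (\<lambda>n. ennreal (\<bar>indicator {-real n..real n} t * y t\<bar> powr p))"
        by (intro Liminf_bounded) (auto simp: eventually_sequentially)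
    qed
    also have "\<dots> \<le> liminf (\<lambda>n. \<integral>\<^sup>+t. ennreal (\<bar>indicator {-real n..real n} t * y t\<bar> powr p) \<partial>lborel)"
      by (rule nn_integral_liminf) measurable
    finally show ?thesis .
  qed
  also have "\<dots> \<le> 1"
  proof (rule Liminf_le[OF sequentially_bot])
    show "\<forall>\<^sub>F n in sequentially. (\<integral>\<^sup>+t. ennreal (\<bar>indicator {-real n..real n} t * y t\<bar> powr p) \<partial>lborel) \<le> 1"
      using trunc by (intro always_eventually allI) (simp add: nn_integral_eq_integral)
  qed
  finally have le: "(\<integral>\<^sup>+t. ennreal (\<bar>y t\<bar> powr p) \<partial>lborel) \<le> 1" .
  have i: "integrable lborel (\<lambda>t. \<bar>y t\<bar> powr p)"
    using le by (intro integrableI_bounded) (auto simp: le_less_trans)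
  then show "Lp p y" by (simp add: Lp_def)
  show "(LINT t|lborel. \<bar>y t\<bar> powr p) \<le> 1" using le nn_integral_eq_integral[OF i] by simp
qed


theorem conv_extremal:
  assumes p: "1 < p" "p < q" and A: "A > 0"
  obtains f where "\<And>t. 0 \<le> f t" "continuous_on UNIV f" "Lp p f"
    "(LINT t|lborel. \<bar>f t\<bar> powr p) = 1" "(LINT s|lborel. \<bar>conv G f s\<bar> powr q) = opt_val p q"
proof -
  define M where "M = opt_val p q"
  have M: "M > 0" using opt_val_pos[OF p A] by (simp add: M_def)
  define c where "c = (M / 2 / A powr p) powr (1 / (q - p))"
  have c: "c > 0" using M A by (simp add: c_def)
  define e where "e i = M / (2 * (real i + 1))" for i
  have e: "0 < e i" "e i \<le> M / 2" for i
    using M by (auto simp: e_def field_simps)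
  have "\<forall>i. \<exists>f. f \<in> unit_nonneg p \<and> (LINT s|lborel. \<bar>conv G f s\<bar> powr q) > M - e i \<and> c \<le> conv G f 0"
    using near_optimal[OF p A] e unfolding M_def c_def by blast
  then obtain f0 where f0: "\<And>i. f0 i \<in> unit_nonneg p"
    "\<And>i. (LINT s|lborel. \<bar>conv G (f0 i) s\<bar> powr q) > M - e i" "\<And>i. c \<le> conv G (f0 i) 0"
    by metis
  have e0: "e \<longlonglongrightarrow> 0"
    using tendsto_mult_right_zero[OF LIMSEQ_inverse_real_of_nat, of "M / 2"]
    by (simp add: e_def[abs_def] field_simps)
  have L0: "Lp p (f0 i)" "0 \<le> f0 i t" "(LINT s|lborel. \<bar>f0 i s\<bar> powr p) \<le> 1" for i t
    using f0(1)[of i] unfolding unit_nonneg_def by blast+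
  obtain r where r: "strict_mono (r :: nat \<Rightarrow> nat)" "\<And>s. convergent (\<lambda>n. conv G (f0 (r n)) s)"
    by (rule conv_subsequence[OF p(1), of f0]) (use L0 in auto)
  define f1 where "f1 n = f0 (r n)" for n
  define g where "g s = lim (\<lambda>n. conv G (f1 n) s)" for s
  have gl: "(\<lambda>n. conv G (f1 n) s) \<longlonglongrightarrow> g s" for s
    using r(2) unfolding f1_def g_def by (simp add: convergent_LIMSEQ_iff)
  have L1: "Lp p (f1 i)" "0 \<le> f1 i t" "(LINT s|lborel. \<bar>f1 i s\<bar> powr p) \<le> 1" "f1 i \<in> unit_nonneg p" for i t
    unfolding f1_def by (rule L0 f0(1))+
  have [measurable]: "f1 i \<in> borel_measurable borel" for i using L1(1) by (simp add: Lp_def)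
  have e1: "(\<lambda>n. e (r n)) \<longlonglongrightarrow> 0" using LIMSEQ_subseq_LIMSEQ[OF e0 r(1)] by (simp add: o_def)
  have c0: "0 \<le> conv G (f1 n) s" for n s by (rule conv_nonneg[OF L1(2)])
  have cD: "conv G (f1 n) s \<le> A + B" for n s
    using conv_le_of_unit[OF L1(1) p(1) L1(3), of n s] by simp
  have g: "0 \<le> g s" "g s \<le> A + B" for s
    by (rule LIMSEQ_le_const[OF gl], use c0 in blast) (rule LIMSEQ_le_const2[OF gl], use cD in blast)
  have gm [measurable]: "g \<in> borel_measurable borel"
    using gl by (rule borel_measurable_LIMSEQ_real) measurable
  interpret R: kernel "\<lambda>t. G (- t)" A B C by (rule kernel_reflect)
  define h where "h n = dual p q (conv G (f1 n))" for n
  define y where "y n t = h n t powr (1 / (p - 1))" for n t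
  \<comment> \<open>The candidate is built from the limit of the duals, which converge pointwise.
    The functions f1 themselves are not yet known to converge; that they tend to f is the point of
    the defect argument.\<close>
  define f where "f t = dual p q g t powr (1 / (p - 1))" for t
  have h0: "0 \<le> h n t" for n t
    unfolding h_def by (rule dual_properties(1)[OF p A _ c0 cD]) measurable
  have d0: "0 \<le> dual p q g t" for t by (rule dual_properties(1)[OF p A gm g])
  have yh: "y n t powr (p - 1) = h n t" for n t using p h0[of n t] by (simp add: y_def powr_powr)
  have fh: "f t powr (p - 1) = dual p q g t" for t using p d0[of t] by (simp add: f_def powr_powr)
  have hl: "(\<lambda>n. h n t) \<longlonglongrightarrow> dual p q g t" for t
    unfolding h_def dual_def
  proof (intro tendsto_divide tendsto_const R.conv_tendsto_bounded)
    show "\<bar>conv G (f1 i) t powr (q - 1)\<bar> \<le> (A + B) powr (q - 1)" for i t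
      using c0 cD p by (auto intro: powr_mono2)
    show "AE t in lborel. (\<lambda>i. conv G (f1 i) t powr (q - 1)) \<longlonglongrightarrow> g t powr (q - 1)"
      using p c0 g by (intro AE_I2 tendsto_powr'[OF gl tendsto_const]) auto
  qed (use M in \<open>auto simp: M_def\<close>)
  have yl: "(\<lambda>n. y n t) \<longlonglongrightarrow> f t" for t
    unfolding y_def f_def using p h0 d0 by (intro tendsto_powr'[OF hl tendsto_const]) auto
  have y1: "Lp p (y n)" "(LINT t|lborel. \<bar>y n t\<bar> powr p) \<le> 1" for n
    using dual_norm_le[OF p A L1(4), of n] by (auto simp: y_def[abs_def] h_def)
  define d where "d n t = f1 n t powr p / p + (p - 1) / p * y n t powr p - f1 n t * y n t powr (p - 1)" for n t
  have y0: "0 \<le> y n t" "0 \<le> f t" for n t by (auto simp: y_def f_def)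
  have dpos: "0 \<le> d n t" for n t using Young_powr[OF p(1) L1(2) y0(1)] by (simp add: d_def)
  have pair: "integrable lborel (\<lambda>t. f1 n t * h n t)"
     "(LINT t|lborel. f1 n t * h n t) = (LINT s|lborel. \<bar>conv G (f1 n) s\<bar> powr q) / M" for n
  proof -
    note dp = dual_pairing[OF p L1(1) L1(2) conv_powr_bound(1)[OF p L1(1) L1(3)] c0 cD, of n n]
    show "integrable lborel (\<lambda>t. f1 n t * h n t)" using dp(1) by (simp add: h_def)
    have "conv G (f1 n) s * conv G (f1 n) s powr (q - 1) = \<bar>conv G (f1 n) s\<bar> powr q" for s
      using c0[of n s] p by (cases "conv G (f1 n) s = 0") (auto simp: powr_diff)
    with dp(3) show "(LINT t|lborel. f1 n t * h n t) = (LINT s|lborel. \<bar>conv G (f1 n) s\<bar> powr q) / M"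
      by (simp add: h_def M_def)
  qed
  have idn: "integrable lborel (d n)" and dle: "(LINT t|lborel. d n t) \<le> e (r n) / M" for n
  proof -
    have i1: "integrable lborel (\<lambda>t. f1 n t powr p)" "(LINT t|lborel. f1 n t powr p) \<le> 1"
      using L1(1,3)[of n] L1(2)[of n] by (auto simp: Lp_def)
    have i2: "integrable lborel (\<lambda>t. y n t powr p)" "(LINT t|lborel. y n t powr p) \<le> 1"
      using y1[of n] y0(1)[of n] by (auto simp: Lp_def)
    have deq: "d n = (\<lambda>t. f1 n t powr p / p + (p - 1) / p * y n t powr p - f1 n t * h n t)"
      unfolding d_def yh ..
    show "integrable lborel (d n)" unfolding deq using i1 i2 pair(1)
      by (intro Bochner_Integration.integrable_diff Bochner_Integration.integrable_add) auto
    have "(LINT t|lborel. d n t) = (LINT t|lborel. f1 n t powr p) / p + (p - 1) / p * (LINT t|lborel. y n t powr p)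
        - (LINT t|lborel. f1 n t * h n t)"
      unfolding deq using i1 i2 pair(1) by simp
    \<comment> \<open>Both p-th power integrals are at most 1 and the pairing is at least 1 - e / M,
      so only e / M is left for the nonnegative defect.\<close>
    also have "\<dots> \<le> 1 / p + (p - 1) / p * 1 - (M - e (r n)) / M"
      using i1 i2 p M f0(2)[of "r n"] unfolding pair(2)
      by (intro diff_mono add_mono divide_right_mono mult_left_mono) (auto simp: f1_def)
    also have "\<dots> = e (r n) / M" using p M by (simp add: field_simps)
    finally show "(LINT t|lborel. d n t) \<le> e (r n) / M" .
  qed
  have "(\<lambda>n. LINT t|lborel. norm (d n t)) \<longlonglongrightarrow> 0"
  proof (rule tendsto_sandwich[OF _ _ tendsto_const])
    show "\<forall>\<^sub>F n in sequentially. 0 \<le> (LINT t|lborel. norm (d n t))" by simp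
    show "\<forall>\<^sub>F n in sequentially. (LINT t|lborel. norm (d n t)) \<le> e (r n) / M"
      using dle dpos by simp
    show "(\<lambda>n. e (r n) / M) \<longlonglongrightarrow> 0" using tendsto_divide[OF e1 tendsto_const, of M] M by simp
  qed
  from tendsto_L1_AE_subseq[OF idn this]
  obtain r2 where r2: "strict_mono (r2 :: nat \<Rightarrow> nat)" "AE t in lborel. (\<lambda>n. d (r2 n) t) \<longlonglongrightarrow> 0" by blast
  have fl: "AE t in lborel. (\<lambda>n. f1 (r2 n) t) \<longlonglongrightarrow> f t"
    using r2(2)
  proof eventually_elim
    case (elim t)
    have "(\<lambda>n. y (r2 n) t) \<longlonglongrightarrow> f t" using LIMSEQ_subseq_LIMSEQ[OF yl r2(1)] by (simp add: o_def)
    then show ?case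
      using elim unfolding d_def by (rule Young_defect_tendsto[OF p(1) L1(2) y0(1)])
  qed
  have dc: "continuous_on UNIV (dual p q g)" by (rule dual_properties(3)[OF p A gm g])
  then have fc: "continuous_on UNIV f"
    unfolding f_def[abs_def] using d0 p by (intro continuous_on_powr' continuous_on_const) auto
  have fm [measurable]: "f \<in> borel_measurable borel" by (rule borel_measurable_continuous_onI[OF fc])
  have nf: "(\<integral>\<^sup>+t. ennreal (\<bar>f t\<bar> powr p) \<partial>lborel) \<le> 1"
  proof -
    have "(\<integral>\<^sup>+t. ennreal (\<bar>f t\<bar> powr p) \<partial>lborel) \<le> (\<integral>\<^sup>+t. liminf (\<lambda>n. ennreal (\<bar>y n t\<bar> powr p)) \<partial>lborel)"
    proof (rule nn_integral_mono)
      fix t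
      have "(\<lambda>n. ennreal (\<bar>y n t\<bar> powr p)) \<longlonglongrightarrow> ennreal (\<bar>f t\<bar> powr p)"
        using p by (intro tendsto_ennrealI tendsto_powr' tendsto_rabs yl tendsto_const) auto
      then show "ennreal (\<bar>f t\<bar> powr p) \<le> liminf (\<lambda>n. ennreal (\<bar>y n t\<bar> powr p))"
        using lim_imp_Liminf[OF sequentially_bot] by force
    qed
    also have "\<dots> \<le> liminf (\<lambda>n. \<integral>\<^sup>+t. ennreal (\<bar>y n t\<bar> powr p) \<partial>lborel)"
    proof (rule nn_integral_liminf)
      have [measurable]: "y n \<in> borel_measurable borel" for n using y1(1) by (simp add: Lp_def)
      show "(\<lambda>t. ennreal (\<bar>y n t\<bar> powr p)) \<in> borel_measurable lborel" for n by measurable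
    qed
    also have "\<dots> \<le> 1"
    proof (rule Liminf_le[OF sequentially_bot])
      have "(\<integral>\<^sup>+t. ennreal (\<bar>y n t\<bar> powr p) \<partial>lborel) = ennreal (LINT t|lborel. \<bar>y n t\<bar> powr p)" for n
        using y1(1)[of n] by (intro nn_integral_eq_integral) (auto simp: Lp_def)
      then show "\<forall>\<^sub>F n in sequentially. (\<integral>\<^sup>+t. ennreal (\<bar>y n t\<bar> powr p) \<partial>lborel) \<le> 1"
        using y1(2) by simp
    qed
    finally show ?thesis .
  qed
  have ifp: "integrable lborel (\<lambda>t. \<bar>f t\<bar> powr p)"
    using nf by (intro integrableI_bounded) (auto simp: le_less_trans)
  then have Lf: "Lp p f" by (simp add: Lp_def)
  define X where "X = (LINT t|lborel. \<bar>f t\<bar> powr p)"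
  have X1: "X \<le> 1" using nf nn_integral_eq_integral[OF ifp] by (simp add: X_def)
  have X0: "0 \<le> X" by (simp add: X_def)
  \<comment> \<open>The pointwise limit of the convolutions is identified with the convolution of
    the almost everywhere limit. Only now does the formula for f become an Euler-Lagrange
    equation.\<close>
  have gT: "g s = conv G f s" for s
  proof (rule LIMSEQ_unique)
    show "(\<lambda>n. conv G (f1 (r2 n)) s) \<longlonglongrightarrow> g s"
      using LIMSEQ_subseq_LIMSEQ[OF gl r2(1)] by (simp add: o_def)
    show "(\<lambda>n. conv G (f1 (r2 n)) s) \<longlonglongrightarrow> conv G f s"
      using conv_tendsto_Lp[OF p(1) L1(1) L1(2) L1(3) Lf y0(2) X1[unfolded X_def] fl] .
  qed
  then have gT': "g = conv G f" by auto
  \<comment> \<open>The translations made in \<open>near_optimal\<close> are used here: the lower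
    bound c at the origin survives in the limit.\<close>
  have "X \<noteq> 0"
  proof
    assume "X = 0"
    then have "AE s in lborel. \<bar>f s\<bar> powr p = 0"
      using ifp unfolding X_def by (subst (asm) integral_nonneg_eq_0_iff_AE) auto
    then have "conv G f 0 = 0"
      unfolding conv_def by (intro integral_eq_zero_AE) (auto elim!: eventually_mono)
    moreover have "c \<le> g 0" using f0(3) by (intro LIMSEQ_le_const[OF gl]) (auto simp: f1_def)
    ultimately show False using c gT by simp
  qed
  then have Xp: "X > 0" using X0 by simp
  have fgD: "conv G f s \<le> A + B" "0 \<le> conv G f s" for s using g gT by auto
  have "X = (LINT t|lborel. f t * dual p q g t)"
  proof -
    have "\<bar>f t\<bar> powr p = f t * dual p q g t" for t
      using y0(2)[of t] p unfolding fh[symmetric] by (cases "f t = 0") (auto simp: powr_diff)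
    then show ?thesis by (simp add: X_def)
  qed
  also have "\<dots> = (LINT s|lborel. conv G f s * conv G f s powr (q - 1)) / M"
    unfolding gT' M_def
    by (rule dual_pairing(3)[OF p Lf y0(2) conv_powr_bound(1)[OF p Lf X1[unfolded X_def]] fgD(2) fgD(1)])
  also have "(\<lambda>s. conv G f s * conv G f s powr (q - 1)) = (\<lambda>s. \<bar>conv G f s\<bar> powr q)"
  proof
    fix s
    show "conv G f s * conv G f s powr (q - 1) = \<bar>conv G f s\<bar> powr q"
      using fgD(2)[of s] p by (cases "conv G f s = 0") (auto simp: powr_diff)
  qed
  finally have XJ: "M * X = (LINT s|lborel. \<bar>conv G f s\<bar> powr q)" using M by simp
  also have "\<dots> \<le> M * X powr (q / p)"
    using conv_le_opt_val(2)[OF p Lf] by (simp add: X_def M_def)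
  finally have "X \<le> X powr (q / p)" using M by simp
  have "X = 1"
  proof (rule ccontr)
    assume "X \<noteq> 1"
    then have "X < 1" using X1 by simp
    then have "X powr (q / p) < X powr 1"
      using Xp p by (intro powr_less_mono') auto
    with \<open>X \<le> X powr (q / p)\<close> Xp show False by simp
  qed
  then show thesis
    using that[of f] y0(2) fc Lf XJ by (auto simp: X_def M_def)
qed

end

section \<open>Inverting the first order operators\<close>

text \<open>Up to the sign -sgn mu, the bounded fundamental solution of D - mu, supported on the
  half-line where it decays. The sign is split off so that the kernel is nonnegative for both signs
  of mu.\<close>

definition exp_kernel :: "real \<Rightarrow> real \<Rightarrow> real" where
  "exp_kernel \<mu> t = (if \<mu> * t \<le> 0 then exp (\<mu> * t) else 0)"

lemma exp_kernel_bounds: "0 \<le> exp_kernel \<mu> t" "exp_kernel \<mu> t \<le> 1"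
  by (auto simp: exp_kernel_def)

lemma exp_kernel_measurable [measurable]: "exp_kernel \<mu> \<in> borel_measurable borel"
  unfolding exp_kernel_def[abs_def] by measurable

lemma exp_kernel_neg_integral:
  assumes "\<mu> < 0"
  shows "integrable lborel (exp_kernel \<mu>)" and "(LINT t|lborel. exp_kernel \<mu> t) = 1 / \<bar>\<mu>\<bar>"
proof -
  have e: "ennreal (exp_kernel \<mu> t) = ennreal (exp (\<mu> * t)) * indicator {0..} t" for t
    using assms by (auto simp: exp_kernel_def indicator_def mult_le_0_iff)
  have "(\<integral>\<^sup>+t. ennreal (exp (\<mu> * t)) * indicator {0..} t \<partial>lborel) = ennreal (0 - exp (\<mu> * 0) / \<mu>)"
  proof (rule nn_integral_FTC_atLeast)
    show "((\<lambda>t. exp (\<mu> * t) / \<mu>) has_real_derivative exp (\<mu> * t)) (at t)" for t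
      using assms by (auto intro!: derivative_eq_intros)
    have "filterlim (\<lambda>t. - \<mu> * t) at_top at_top"
      using assms by (intro filterlim_tendsto_pos_mult_at_top[OF tendsto_const]) (auto simp: filterlim_ident)
    then have "((\<lambda>t. exp (\<mu> * t)) \<longlongrightarrow> 0) at_top"
      by (intro filterlim_compose[OF exp_at_bot]) (simp add: filterlim_uminus_at_top)
    then show "((\<lambda>t. exp (\<mu> * t) / \<mu>) \<longlongrightarrow> 0) at_top"
      by (rule tendsto_divide_zero)
  qed auto
  then have n: "(\<integral>\<^sup>+t. ennreal (exp_kernel \<mu> t) \<partial>lborel) = ennreal (1 / \<bar>\<mu>\<bar>)"
    unfolding e using assms by simp
  show i: "integrable lborel (exp_kernel \<mu>)"
    by (rule integrableI_nonneg) (auto simp: n exp_kernel_bounds)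
  have "ennreal (LINT t|lborel. exp_kernel \<mu> t) = ennreal (1 / \<bar>\<mu>\<bar>)"
    using n nn_integral_eq_integral[OF i] by (simp add: exp_kernel_bounds)
  then show "(LINT t|lborel. exp_kernel \<mu> t) = 1 / \<bar>\<mu>\<bar>"
    by (subst (asm) ennreal_inj) (auto intro!: integral_nonneg_AE simp: exp_kernel_bounds)
qed

lemma exp_kernel_integral:
  assumes "\<mu> \<noteq> 0"
  shows "integrable lborel (exp_kernel \<mu>)" and "(LINT t|lborel. exp_kernel \<mu> t) = 1 / \<bar>\<mu>\<bar>"
proof -
  have "integrable lborel (exp_kernel \<mu>) \<and> (LINT t|lborel. exp_kernel \<mu> t) = 1 / \<bar>\<mu>\<bar>"
  proof (cases "\<mu> < 0")
    case False
    then have n: "- \<mu> < 0" using assms by simp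
    have "exp_kernel \<mu> = (\<lambda>t. exp_kernel (- \<mu>) (0 - t))" by (auto simp: exp_kernel_def)
    then show ?thesis
      using integrable_reflect_shift[OF exp_kernel_neg_integral(1)[OF n], of 0]
        integral_reflect_shift[of "exp_kernel (- \<mu>)" 0] exp_kernel_neg_integral(2)[OF n] by simp
  qed (use exp_kernel_neg_integral in blast)
  then show "integrable lborel (exp_kernel \<mu>)" "(LINT t|lborel. exp_kernel \<mu> t) = 1 / \<bar>\<mu>\<bar>" by auto
qed

text \<open>The bound is symmetric in x and y, so it can be integrated without distinguishing which
  argument is larger.\<close>

lemma abs_exp_diff_le: "\<bar>exp x - exp y\<bar> \<le> \<bar>x - y\<bar> * (exp x + exp (y::real))"
proof -
  have *: "exp x - exp y \<le> \<bar>x - y\<bar> * (exp x + exp y)" for x y :: real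
  proof -
    have "exp x - exp y = exp x * (1 - exp (y - x))" by (simp add: exp_diff right_diff_distrib)
    also have "\<dots> \<le> exp x * (x - y)"
    proof (rule mult_left_mono)
      show "1 - exp (y - x) \<le> x - y" using exp_ge_add_one_self[of "y - x"] by linarith
    qed simp
    also have "\<dots> \<le> exp x * \<bar>x - y\<bar>" by (intro mult_left_mono) auto
    also have "\<dots> \<le> (exp x + exp y) * \<bar>x - y\<bar>" by (intro mult_right_mono) auto
    finally show ?thesis by (simp add: mult.commute)
  qed
  show ?thesis using *[of x y] *[of y x] by (simp add: abs_if algebra_simps split: if_splits)
qed

lemma kernel_exp_kernel:
  assumes "\<mu> \<noteq> 0"
  shows "kernel (exp_kernel \<mu>) (1 / \<bar>\<mu>\<bar>) 1 4"
proof
  fix h :: real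
  let ?k = "exp_kernel \<mu>"
  \<comment> \<open>The first term treats points where both values lie on the same side of the jump
    and integrates to 2 |h|. The indicator collects the points across the jump and adds 2 |h|, hence
    the constant 4.\<close>
  have le: "\<bar>?k (t + h) - ?k t\<bar> \<le> \<bar>\<mu>\<bar> * \<bar>h\<bar> * (?k (t + h) + ?k t) + indicator {-\<bar>h\<bar>..\<bar>h\<bar>} t" for t
  proof (cases "\<mu> * t \<le> 0 \<longleftrightarrow> \<mu> * (t + h) \<le> 0")
    case True
    then have "\<bar>?k (t + h) - ?k t\<bar> \<le> \<bar>\<mu>\<bar> * \<bar>h\<bar> * (?k (t + h) + ?k t)"
      using abs_exp_diff_le[of "\<mu> * (t + h)" "\<mu> * t"]
      by (auto simp: exp_kernel_def abs_mult[symmetric] algebra_simps)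
    then show ?thesis by (simp add: indicator_def)
  next
    case False
    then have "t \<in> {-\<bar>h\<bar>..\<bar>h\<bar>}"
      by (auto simp: mult_le_0_iff abs_if split: if_splits)
    moreover have "\<bar>?k (t + h) - ?k t\<bar> \<le> 1"
      using exp_kernel_bounds[of \<mu> t] exp_kernel_bounds[of \<mu> "t + h"] by auto
    moreover have "0 \<le> \<bar>\<mu>\<bar> * \<bar>h\<bar> * (?k (t + h) + ?k t)"
      by (intro mult_nonneg_nonneg add_nonneg_nonneg exp_kernel_bounds) auto
    ultimately show ?thesis by simp
  qed
  note i = exp_kernel_integral[OF assms]
  note ih = integrable_shift[OF i(1), of h]
  have iI: "integrable lborel (indicator {-\<bar>h\<bar>..\<bar>h\<bar>} :: real \<Rightarrow> real)"
    using emeasure_compact_finite[of "{-\<bar>h\<bar>..\<bar>h\<bar>}"] by (intro integrable_real_indicator) auto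
  have "(LINT t|lborel. \<bar>?k (t + h) - ?k t\<bar>) \<le>
      (LINT t|lborel. \<bar>\<mu>\<bar> * \<bar>h\<bar> * (?k (t + h) + ?k t) + indicator {-\<bar>h\<bar>..\<bar>h\<bar>} t)"
    using i(1) ih iI by (intro integral_mono le integrable_abs Bochner_Integration.integrable_diff
        Bochner_Integration.integrable_add integrable_mult_right)
  also have "\<dots> = \<bar>\<mu>\<bar> * \<bar>h\<bar> * (1 / \<bar>\<mu>\<bar> + 1 / \<bar>\<mu>\<bar>) + 2 * \<bar>h\<bar>"
    using i ih iI by (simp add: integral_shift)
  also have "\<dots> = 4 * \<bar>h\<bar>" using assms by (simp add: field_simps)
  finally show "(LINT t|lborel. \<bar>?k (t + h) - ?k t\<bar>) \<le> 4 * \<bar>h\<bar>" .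
qed (use exp_kernel_bounds exp_kernel_integral[OF assms] in auto)

text \<open>In each constant one factor carries the supremum or the translation and the other
  contributes its mass: the supremum falls on H, the translation on G.\<close>

lemma kernel_conv:
  assumes G: "kernel G A B C" and H: "kernel H A' B' C'"
  shows "kernel (conv G H) (A * A') (A * B') (C * A')"
proof -
  interpret G: kernel G A B C by fact
  interpret H: kernel H A' B' C' by fact
  have Hb: "\<bar>H t\<bar> \<le> B'" for t using H.nonneg[of t] H.bounded[of t] by simp
  have iH: "integrable lborel (\<lambda>t. G (s - t) * H t)" for s by (rule G.integrable_bounded[OF H.meas Hb])
  have c0: "0 \<le> conv G H t" for t by (rule G.conv_nonneg[OF H.nonneg])
  have nn: "(\<integral>\<^sup>+s. ennreal (conv G H s) \<partial>lborel) = ennreal (A * A')"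
  proof -
    have "(\<integral>\<^sup>+s. ennreal (conv G H s) \<partial>lborel) = (\<integral>\<^sup>+s. (\<integral>\<^sup>+t. ennreal (G (s - t) * H t) \<partial>lborel) \<partial>lborel)"
      unfolding conv_def using nn_integral_eq_integral[OF iH]
      by (intro nn_integral_cong) (simp add: G.nonneg H.nonneg)
    also have "\<dots> = ennreal A * (\<integral>\<^sup>+t. ennreal (H t) \<partial>lborel)" by (rule G.nn_conv_Lp[OF H.meas H.nonneg])
    also have "(\<integral>\<^sup>+t. ennreal (H t) \<partial>lborel) = ennreal A'"
      using nn_integral_eq_integral[OF H.integrable] by (simp add: H.nonneg H.A_def)
    finally show ?thesis using G.A_nonneg by (simp add: ennreal_mult')
  qed
  have cm [measurable]: "conv G H \<in> borel_measurable borel" by (rule G.conv_measurable) measurable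
  have ci: "integrable lborel (conv G H)"
    by (rule integrableI_nonneg) (auto simp: nn c0)
  show ?thesis
  proof
    show "conv G H t \<le> A * B'" for t using G.conv_bounded[OF H.meas Hb, of t] by simp
    show "A * A' = (LINT t|lborel. conv G H t)"
    proof -
      have "ennreal (LINT t|lborel. conv G H t) = ennreal (A * A')"
        using nn nn_integral_eq_integral[OF ci] c0 by simp
      then show ?thesis
        by (subst (asm) ennreal_inj) (auto intro!: integral_nonneg_AE mult_nonneg_nonneg simp: c0 G.A_nonneg H.A_nonneg)
    qed
    fix h :: real
    have C0: "C \<ge> 0" using order_trans[OF integral_nonneg_AE G.lipschitz[of 1]] by simp
    have "(\<integral>\<^sup>+t. ennreal \<bar>conv G H (t + h) - conv G H t\<bar> \<partial>lborel) \<le>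
        (\<integral>\<^sup>+t. (\<integral>\<^sup>+r. ennreal (\<bar>G (t + h - r) - G (t - r)\<bar> * H r) \<partial>lborel) \<partial>lborel)"
    proof (rule nn_integral_mono)
      fix t
      have i: "integrable lborel (\<lambda>r. (G (t + h - r) - G (t - r)) * H r)"
        unfolding left_diff_distrib by (intro Bochner_Integration.integrable_diff iH)
      have "conv G H (t + h) - conv G H t = (LINT r|lborel. (G (t + h - r) - G (t - r)) * H r)"
        unfolding conv_def left_diff_distrib by (rule Bochner_Integration.integral_diff[symmetric, OF iH iH])
      then have "\<bar>conv G H (t + h) - conv G H t\<bar> \<le> (LINT r|lborel. \<bar>(G (t + h - r) - G (t - r)) * H r\<bar>)"
        using integral_abs_bound[of lborel "\<lambda>r. (G (t + h - r) - G (t - r)) * H r"] by simp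
      then have "ennreal \<bar>conv G H (t + h) - conv G H t\<bar> \<le> ennreal (LINT r|lborel. \<bar>(G (t + h - r) - G (t - r)) * H r\<bar>)"
        by (rule ennreal_leI)
      also have "\<dots> = (\<integral>\<^sup>+r. ennreal \<bar>(G (t + h - r) - G (t - r)) * H r\<bar> \<partial>lborel)"
        using nn_integral_eq_integral[OF integrable_abs[OF i]] by simp
      also have "\<dots> = (\<integral>\<^sup>+r. ennreal (\<bar>G (t + h - r) - G (t - r)\<bar> * H r) \<partial>lborel)"
        using H.nonneg by (simp add: abs_mult)
      finally show "ennreal \<bar>conv G H (t + h) - conv G H t\<bar> \<le> (\<integral>\<^sup>+r. ennreal (\<bar>G (t + h - r) - G (t - r)\<bar> * H r) \<partial>lborel)" .
    qed
    also have "\<dots> = (\<integral>\<^sup>+r. (\<integral>\<^sup>+t. ennreal (\<bar>G (t + h - r) - G (t - r)\<bar> * H r) \<partial>lborel) \<partial>lborel)"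
      by (rule lborel_pair.Fubini') measurable
    also have "\<dots> \<le> (\<integral>\<^sup>+r. ennreal (C * \<bar>h\<bar>) * ennreal (H r) \<partial>lborel)"
    proof (rule nn_integral_mono)
      fix r
      have i: "integrable lborel (\<lambda>t. \<bar>G (t + h - r) - G (t - r)\<bar>)"
        using integrable_shift[OF G.integrable, of "h - r"] integrable_shift[OF G.integrable, of "- r"]
        by (intro integrable_abs Bochner_Integration.integrable_diff) (auto simp: algebra_simps)
      have "(\<integral>\<^sup>+t. ennreal (\<bar>G (t + h - r) - G (t - r)\<bar> * H r) \<partial>lborel) =
          ennreal (LINT t|lborel. \<bar>G (t + h - r) - G (t - r)\<bar> * H r)"
        using i H.nonneg by (intro nn_integral_eq_integral integrable_mult_left) auto
      also have "(LINT t|lborel. \<bar>G (t + h - r) - G (t - r)\<bar> * H r) = (LINT t|lborel. \<bar>G (t + h) - G t\<bar>) * H r"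
        using integral_shift[of "\<lambda>t. \<bar>G (t + h) - G t\<bar>" "- r"] by (simp add: algebra_simps)
      also have "\<dots> \<le> C * \<bar>h\<bar> * H r" by (intro mult_right_mono G.lipschitz H.nonneg)
      finally show "(\<integral>\<^sup>+t. ennreal (\<bar>G (t + h - r) - G (t - r)\<bar> * H r) \<partial>lborel) \<le> ennreal (C * \<bar>h\<bar>) * ennreal (H r)"
        using H.nonneg by (simp add: ennreal_mult''[symmetric] ennreal_leI)
    qed
    also have "\<dots> = ennreal (C * \<bar>h\<bar>) * (\<integral>\<^sup>+r. ennreal (H r) \<partial>lborel)"
      by (rule nn_integral_cmult) measurable
    also have "(\<integral>\<^sup>+r. ennreal (H r) \<partial>lborel) = ennreal A'"
      using nn_integral_eq_integral[OF H.integrable] by (simp add: H.nonneg H.A_def)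
    finally have "(\<integral>\<^sup>+t. ennreal \<bar>conv G H (t + h) - conv G H t\<bar> \<partial>lborel) \<le> ennreal (C * \<bar>h\<bar> * A')"
      using H.A_nonneg by (simp add: ennreal_mult'')
    moreover have "(\<integral>\<^sup>+t. ennreal \<bar>conv G H (t + h) - conv G H t\<bar> \<partial>lborel) = ennreal (LINT t|lborel. \<bar>conv G H (t + h) - conv G H t\<bar>)"
      using integrable_shift[OF ci, of h] ci
      by (intro nn_integral_eq_integral integrable_abs Bochner_Integration.integrable_diff) auto
    ultimately have "ennreal (LINT t|lborel. \<bar>conv G H (t + h) - conv G H t\<bar>) \<le> ennreal (C * \<bar>h\<bar> * A')" by simp
    then show "(LINT t|lborel. \<bar>conv G H (t + h) - conv G H t\<bar>) \<le> C * A' * \<bar>h\<bar>"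
      using C0 H.A_nonneg by (subst (asm) ennreal_le_iff) (auto simp: mult_ac)
  qed (use c0 ci in auto)
qed

text \<open>Boundedness of f makes the double integral absolutely convergent, so Fubini applies. It
  is used for the links of a chain, which are continuous with compact support.\<close>

lemma conv_assoc:
  assumes G: "kernel G A B C" and H: "kernel H A' B' C'"
    and f [measurable]: "f \<in> borel_measurable borel" and D: "\<And>t. \<bar>f t\<bar> \<le> D"
  shows "conv (conv G H) f s = conv G (conv H f) s"
proof -
  interpret G: kernel G A B C by fact
  interpret H: kernel H A' B' C' by fact
  let ?F = "\<lambda>(x, r). G (s - x) * (H (x - r) * f r)"
  have fa: "(\<lambda>t. \<bar>f t\<bar>) \<in> borel_measurable borel" "\<And>t. \<bar>\<bar>f t\<bar>\<bar> \<le> D" using D by auto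
  have iF: "integrable (lborel \<Otimes>\<^sub>M lborel) ?F"
  proof (rule lborel_pair.Fubini_integrable)
    show "?F \<in> borel_measurable (lborel \<Otimes>\<^sub>M lborel)" by measurable
    have e: "(LINT r|lborel. norm (?F (x, r))) = G (s - x) * conv H (\<lambda>t. \<bar>f t\<bar>) x" for x
      using G.nonneg H.nonneg by (simp add: abs_mult conv_def)
    have "\<bar>conv H (\<lambda>t. \<bar>f t\<bar>) x\<bar> \<le> A' * D" for x by (rule H.conv_bounded[OF fa])
    then show "integrable lborel (\<lambda>x. LINT r|lborel. norm (?F (x, r)))"
      unfolding e by (intro G.integrable_bounded) auto
    show "AE x in lborel. integrable lborel (\<lambda>r. ?F (x, r))"
      using H.integrable_bounded[OF f D] by simp
  qed
  have "conv G (conv H f) s = (LINT x|lborel. (LINT r|lborel. ?F (x, r)))"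
    by (simp add: conv_def)
  also have "\<dots> = (LINT r|lborel. (LINT x|lborel. ?F (x, r)))"
    by (rule lborel_pair.Fubini_integral[symmetric, of "\<lambda>x r. ?F (x, r)"]) (use iF in simp)
  also have "\<dots> = (LINT r|lborel. conv G H (s - r) * f r)"
  proof (rule Bochner_Integration.integral_cong[OF refl])
    fix r
    have "(LINT x|lborel. ?F (x, r)) = (LINT x|lborel. G (s - x) * H (x - r)) * f r"
      by (simp add: mult.assoc[symmetric])
    also have "(LINT x|lborel. G (s - x) * H (x - r)) = conv G H (s - r)"
      unfolding conv_def using integral_shift[of "\<lambda>x. G (s - x) * H (x - r)" r]
      by (simp add: algebra_simps)
    finally show "(LINT x|lborel. ?F (x, r)) = conv G H (s - r) * f r" .
  qed
  finally show ?thesis by (simp add: conv_def)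
qed

text \<open>Multiply by exp (mu (s - t)) and integrate over t on the side of s where this factor
  decays: to the left of s for mu < 0, to the right for mu > 0. The boundary term at s gives z s up
  to the sign.\<close>

lemma first_order_inverse:
  assumes \<mu>: "\<mu> \<noteq> 0" and z: "\<And>s. (z has_real_derivative z' s) (at s)"
    and c: "continuous_on UNIV (\<lambda>s. z' s - \<mu> * z s)"
    and M: "\<And>s. \<bar>s\<bar> > M \<Longrightarrow> z s = 0" "\<And>s. \<bar>s\<bar> > M \<Longrightarrow> z' s - \<mu> * z s = 0"
  shows "z s = - sgn \<mu> * conv (exp_kernel \<mu>) (\<lambda>s. z' s - \<mu> * z s) s"
proof -
  \<comment> \<open>Far enough to lie outside the support and to have s between -L and L.\<close>
  define L where "L = \<bar>M\<bar> + \<bar>s\<bar> + 1"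
  let ?f = "\<lambda>t. exp (\<mu> * (s - t)) * (z' t - \<mu> * z t)"
  have D: "((\<lambda>t. exp (\<mu> * (s - t)) * z t) has_real_derivative ?f t) (at t)" for t
    by (auto intro!: derivative_eq_intros z simp: algebra_simps)
  have "continuous_on UNIV ?f" by (intro continuous_intros c)
  then have cf: "isCont ?f t" for t by (simp add: continuous_on_eq_continuous_at)
  have zL: "z L = 0" "z (- L) = 0" using M(1) by (auto simp: L_def)
  have L: "- L \<le> s" "s \<le> L" by (auto simp: L_def)
  have f0: "z' t - \<mu> * z t = 0" if "t < - L \<or> t > L" for t using that by (intro M(2)) (auto simp: L_def)
  show ?thesis
  proof (cases "\<mu> < 0")
    case True
    have "has_bochner_integral lborel (\<lambda>t. ?f t * indicator {-L..s} t) (exp (\<mu> * (s - s)) * z s - exp (\<mu> * (s - (-L))) * z (-L))"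
      by (rule has_bochner_integral_FTC_Icc_real[OF L(1) D cf])
    then have "(LINT t|lborel. ?f t * indicator {-L..s} t) = z s"
      using zL by (simp add: has_bochner_integral_iff)
    moreover have "?f t * indicator {-L..s} t = exp_kernel \<mu> (s - t) * (z' t - \<mu> * z t)" for t
      using True f0[of t] by (auto simp: exp_kernel_def indicator_def mult_le_0_iff)
    ultimately show ?thesis using True by (simp add: conv_def)
  next
    case False
    with \<mu> have p: "\<mu> > 0" by simp
    have "has_bochner_integral lborel (\<lambda>t. ?f t * indicator {s..L} t) (exp (\<mu> * (s - L)) * z L - exp (\<mu> * (s - s)) * z s)"
      by (rule has_bochner_integral_FTC_Icc_real[OF L(2) D cf])
    then have "(LINT t|lborel. ?f t * indicator {s..L} t) = - z s"
      using zL by (simp add: has_bochner_integral_iff)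
    moreover have "?f t * indicator {s..L} t = exp_kernel \<mu> (s - t) * (z' t - \<mu> * z t)" for t
      using p f0[of t] by (auto simp: exp_kernel_def indicator_def mult_le_0_iff)
    ultimately show ?thesis using p by (simp add: conv_def)
  qed
qed

text \<open>What a profile of a function in \<open>Ckcr k\<close> provides along the whole chain. It
  is kept abstract because the links are formed with \<open>deriv\<close>, so differentiability has
  to be known at every stage.\<close>

definition admissible :: "nat \<Rightarrow> real \<Rightarrow> nat \<Rightarrow> (real \<Rightarrow> real) \<Rightarrow> bool" where
  "admissible n a k w \<longleftrightarrow>
    (\<forall>l<k. \<forall>s. (ef_chain n a l w has_real_derivative deriv (ef_chain n a l w) s) (at s)) \<and>
    (\<forall>l\<le>k. continuous_on UNIV (ef_chain n a l w)) \<and>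
    (\<exists>M. \<forall>l\<le>k. \<forall>s. \<bar>s\<bar> > M \<longrightarrow> ef_chain n a l w s = 0)"

lemma admissible_profile:
  fixes v :: "'a::euclidean_space \<Rightarrow> real"
  assumes "v \<in> Ckcr k"
  shows "admissible DIM('a) a k (ef_profile a v)"
proof -
  have v: "Ck k v" "radial v" using assms by (auto simp: Ckcr_def Ckc_iff)
  obtain M where "\<And>l s. l \<le> k \<Longrightarrow> \<bar>s\<bar> > M \<Longrightarrow> ef_chain DIM('a) a l (ef_profile a v) s = 0"
    using ef_chain_vanishes[OF assms] by metis
  with ef_chain_has_derivative[OF v] ef_chain_continuous[OF v] show ?thesis
    unfolding admissible_def by blast
qed

lemma continuous_cs_bounded:
  fixes f :: "real \<Rightarrow> real"
  assumes f: "continuous_on UNIV f" and M: "\<And>s. \<bar>s\<bar> > M \<Longrightarrow> f s = 0"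
  shows "\<exists>D. \<forall>s. \<bar>f s\<bar> \<le> D"
proof -
  have "compact (f ` {-M..M})"
    using f by (intro compact_continuous_image) (auto intro: continuous_on_subset)
  then have "bounded (f ` {-M..M})" by (rule compact_imp_bounded)
  then obtain D where "\<forall>x\<in>f ` {-M..M}. norm x \<le> D" unfolding bounded_iff by blast
  then have D: "\<bar>f s\<bar> \<le> D" if "s \<in> {-M..M}" for s using that by auto
  have "\<bar>f s\<bar> \<le> \<bar>D\<bar>" for s
  proof (cases "s \<in> {-M..M}")
    case False
    then have "\<bar>s\<bar> > M" by auto
    then show ?thesis using M by simp
  qed (use D in fastforce)
  then show ?thesis by blast
qed

lemma admissible_bounded:
  assumes "admissible n a k w" "l \<le> k"
  shows "\<exists>D. \<forall>s. \<bar>ef_chain n a l w s\<bar> \<le> D"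
  using assms continuous_cs_bounded[of "ef_chain n a l w"] unfolding admissible_def by blast

text \<open>Every nonzero root contributes the inverse of its factor, an exponential kernel with a
  sign; the signs are collected in \<open>\<epsilon>\<close> and the kernel stays nonnegative. It
  depends on the roots only and not on w, so the formula survives limits in L^p.\<close>

lemma ef_chain_representation:
  assumes "\<And>l. j \<le> l \<Longrightarrow> l < k \<Longrightarrow> ef_root n a l \<noteq> 0" and "j < k"
  obtains G A B C \<epsilon> where "kernel G A B C" "A > 0" "\<bar>\<epsilon>\<bar> = (1::real)"
    "\<And>w s. admissible n a k w \<Longrightarrow> ef_chain n a j w s = \<epsilon> * conv G (ef_chain n a k w) s"
proof -
  have "\<exists>G A B C \<epsilon>. kernel G A B C \<and> A > 0 \<and> \<bar>\<epsilon>\<bar> = (1::real) \<and>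
    (\<forall>w. admissible n a k w \<longrightarrow> (\<forall>s. ef_chain n a j w s = \<epsilon> * conv G (ef_chain n a k w) s))"
    using assms
  proof (induction "k - j - 1" arbitrary: j)
    case 0
    then have k: "k = Suc j" by simp
    define \<mu> where "\<mu> = ef_root n a j"
    have \<mu>: "\<mu> \<noteq> 0" using 0 by (simp add: \<mu>_def)
    have "ef_chain n a j w s = - sgn \<mu> * conv (exp_kernel \<mu>) (ef_chain n a k w) s"
      if w: "admissible n a k w" for w s
    proof -
      obtain M where M: "\<And>l s. l \<le> k \<Longrightarrow> \<bar>s\<bar> > M \<Longrightarrow> ef_chain n a l w s = 0"
        using w unfolding admissible_def by blast
      have e: "ef_chain n a k w = (\<lambda>s. deriv (ef_chain n a j w) s - \<mu> * ef_chain n a j w s)"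
        by (simp add: k \<mu>_def)
      show ?thesis unfolding e
      proof (rule first_order_inverse[OF \<mu>])
        show "(ef_chain n a j w has_real_derivative deriv (ef_chain n a j w) s) (at s)" for s
          using w k by (auto simp: admissible_def)
        show "continuous_on UNIV (\<lambda>s. deriv (ef_chain n a j w) s - \<mu> * ef_chain n a j w s)"
          using w unfolding e[symmetric] by (auto simp: admissible_def)
        show "ef_chain n a j w s = 0" "deriv (ef_chain n a j w) s - \<mu> * ef_chain n a j w s = 0"
          if "\<bar>s\<bar> > M" for s
          using M[of j s] M[of k s] that k e by auto
      qed
    qed
    then show ?case
      using kernel_exp_kernel[OF \<mu>] \<mu>
      by (intro exI[of _ "exp_kernel \<mu>"] exI[of _ "1 / \<bar>\<mu>\<bar>"] exI[of _ 1] exI[of _ 4] exI[of _ "- sgn \<mu>"])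
        (auto simp: abs_sgn_eq)
  next
    case (Suc d)
    have j: "Suc j < k" "j < k" using Suc.hyps(2) by auto
    have d: "d = k - Suc j - 1" using Suc.hyps(2) by simp
    have "\<And>l. Suc j \<le> l \<Longrightarrow> l < k \<Longrightarrow> ef_root n a l \<noteq> 0" using Suc.prems by simp
    from Suc.hyps(1)[OF d this j(1)]
    obtain G A B C \<epsilon> where G: "kernel G A B C" "A > 0" "\<bar>\<epsilon>\<bar> = (1::real)"
      "\<And>w s. admissible n a k w \<Longrightarrow> ef_chain n a (Suc j) w s = \<epsilon> * conv G (ef_chain n a k w) s"
      by blast
    define \<mu> where "\<mu> = ef_root n a j"
    have \<mu>: "\<mu> \<noteq> 0" using Suc.prems by (simp add: \<mu>_def)
    note K = kernel_exp_kernel[OF \<mu>]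
    interpret K: kernel "exp_kernel \<mu>" "1 / \<bar>\<mu>\<bar>" 1 4 by (rule K)
    have "ef_chain n a j w s = (- sgn \<mu> * \<epsilon>) * conv (conv (exp_kernel \<mu>) G) (ef_chain n a k w) s"
      if w: "admissible n a k w" for w s
    proof -
      obtain M where M: "\<And>l s. l \<le> k \<Longrightarrow> \<bar>s\<bar> > M \<Longrightarrow> ef_chain n a l w s = 0"
        using w unfolding admissible_def by blast
      have e: "ef_chain n a (Suc j) w = (\<lambda>s. deriv (ef_chain n a j w) s - \<mu> * ef_chain n a j w s)"
        by (simp add: \<mu>_def)
      have "ef_chain n a j w s = - sgn \<mu> * conv (exp_kernel \<mu>) (ef_chain n a (Suc j) w) s"
        unfolding e
      proof (rule first_order_inverse[OF \<mu>])
        show "(ef_chain n a j w has_real_derivative deriv (ef_chain n a j w) s) (at s)" for s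
          using w j by (auto simp: admissible_def)
        have "continuous_on UNIV (ef_chain n a (Suc j) w)"
          using w j unfolding admissible_def by (meson less_imp_le)
        then show "continuous_on UNIV (\<lambda>s. deriv (ef_chain n a j w) s - \<mu> * ef_chain n a j w s)"
          unfolding e .
        show "ef_chain n a j w s = 0" "deriv (ef_chain n a j w) s - \<mu> * ef_chain n a j w s = 0"
          if "\<bar>s\<bar> > M" for s
          using M[of j s] M[of "Suc j" s] that j e by auto
      qed
      also have "ef_chain n a (Suc j) w = (\<lambda>s. \<epsilon> * conv G (ef_chain n a k w) s)"
        using G(4)[OF w] by auto
      also have "conv (exp_kernel \<mu>) (\<lambda>s. \<epsilon> * conv G (ef_chain n a k w) s) s =
          \<epsilon> * conv (exp_kernel \<mu>) (conv G (ef_chain n a k w)) s" by (rule K.conv_cmult)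
      also have "conv (exp_kernel \<mu>) (conv G (ef_chain n a k w)) s = conv (conv (exp_kernel \<mu>) G) (ef_chain n a k w) s"
      proof -
        obtain D where "\<And>s. \<bar>ef_chain n a k w s\<bar> \<le> D" using admissible_bounded[OF w, of k] by auto
        moreover have "ef_chain n a k w \<in> borel_measurable borel"
          using w by (auto simp: admissible_def intro: borel_measurable_continuous_onI)
        ultimately show ?thesis using conv_assoc[OF K G(1)] by metis
      qed
      finally show ?thesis by simp
    qed
    then show ?case
      using kernel_conv[OF K G(1)] \<mu> G(2,3)
      by (intro exI[of _ "conv (exp_kernel \<mu>) G"] exI[of _ "1 / \<bar>\<mu>\<bar> * A"] exI[of _ "1 / \<bar>\<mu>\<bar> * B"]
          exI[of _ "4 * A"] exI[of _ "- sgn \<mu> * \<epsilon>"])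
        (auto simp: abs_sgn_eq abs_mult)
  qed
  then show thesis using that by blast
qed

section \<open>Density\<close>

lemma vanishes_off_Icc: "(\<And>s. \<bar>s\<bar> > M \<Longrightarrow> f s = 0) \<Longrightarrow> vanishes_off {-M..M} (f :: real \<Rightarrow> 'a::zero)"
  unfolding vanishes_off_def by (metis abs_le_iff atLeastAtMost_iff minus_le_iff not_le)

section \<open>Approximation in L^p by smooth functions\<close>

lemma Lp_cont_cs:
  assumes "p > 0" "continuous_on UNIV f" "\<And>s. \<bar>s\<bar> > M \<Longrightarrow> f s = 0"
  shows "Lp p f"
proof -
  have "integrable lborel (\<lambda>s. \<bar>f s\<bar> powr p)"
    using assms by (intro integrable_compact_support[of _ "{-M..M}"] continuous_on_powr' continuous_intros)
      (use vanishes_off_Icc[of M f] assms in \<open>auto simp: vanishes_off_def\<close>)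
  then show ?thesis using assms by (auto simp: Lp_def intro: borel_measurable_continuous_onI)
qed

lemma Lp_smooth_cs: "p > 0 \<Longrightarrow> f \<in> smooth_cs \<Longrightarrow> Lp p f"
  unfolding smooth_cs_def using Lp_cont_cs[of p f] Ck_imp_continuous by blast

text \<open>A quasi-triangle inequality for p-th powers. The constant \<open>2 powr p\<close> is
  harmless, since it is only used to show that integrals are small or finite, and it saves taking
  p-th roots.\<close>

lemma powr_add_le:
  fixes x y p :: real
  assumes "p > 0"
  shows "\<bar>x + y\<bar> powr p \<le> 2 powr p * (\<bar>x\<bar> powr p + \<bar>y\<bar> powr p)"
proof -
  have "\<bar>x + y\<bar> powr p \<le> (2 * max \<bar>x\<bar> \<bar>y\<bar>) powr p" using assms by (intro powr_mono2) auto
  also have "\<dots> = 2 powr p * (max \<bar>x\<bar> \<bar>y\<bar>) powr p" by (simp add: powr_mult)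
  also have "\<dots> \<le> 2 powr p * (\<bar>x\<bar> powr p + \<bar>y\<bar> powr p)" by (auto simp: max_def)
  finally show ?thesis .
qed

lemma Lp_add:
  assumes "p > 0" "Lp p f" "Lp p g"
  shows "Lp p (\<lambda>s. f s + g s)"
    and "(LINT s|lborel. \<bar>f s + g s\<bar> powr p) \<le>
      2 powr p * ((LINT s|lborel. \<bar>f s\<bar> powr p) + (LINT s|lborel. \<bar>g s\<bar> powr p))"
proof -
  have [measurable]: "f \<in> borel_measurable borel" "g \<in> borel_measurable borel" using assms by (auto simp: Lp_def)
  have i: "integrable lborel (\<lambda>s. 2 powr p * (\<bar>f s\<bar> powr p + \<bar>g s\<bar> powr p))"
    using assms by (auto simp: Lp_def)
  have j: "integrable lborel (\<lambda>s. \<bar>f s + g s\<bar> powr p)"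
    by (rule Bochner_Integration.integrable_bound[OF i]) (use powr_add_le[OF assms(1)] in \<open>auto simp: abs_mult\<close>)
  then show "Lp p (\<lambda>s. f s + g s)" by (simp add: Lp_def)
  have "(LINT s|lborel. \<bar>f s + g s\<bar> powr p) \<le> (LINT s|lborel. 2 powr p * (\<bar>f s\<bar> powr p + \<bar>g s\<bar> powr p))"
    by (rule integral_mono[OF j i powr_add_le[OF assms(1)]])
  also have "\<dots> = 2 powr p * ((LINT s|lborel. \<bar>f s\<bar> powr p) + (LINT s|lborel. \<bar>g s\<bar> powr p))"
    using assms by (simp add: Lp_def)
  finally show "(LINT s|lborel. \<bar>f s + g s\<bar> powr p) \<le>
      2 powr p * ((LINT s|lborel. \<bar>f s\<bar> powr p) + (LINT s|lborel. \<bar>g s\<bar> powr p))" .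
qed

lemma Lp_cmult: "Lp p f \<Longrightarrow> Lp p (\<lambda>s. c * f s)"
  unfolding Lp_def by (auto simp: abs_mult powr_mult)

lemma Lp_diff:
  assumes "p > 0" "Lp p f" "Lp p g"
  shows "Lp p (\<lambda>s. f s - g s)"
  using Lp_add(1)[OF assms(1,2) Lp_cmult[OF assms(3), of "-1"]] by simp

lemma Lp_dist_triangle:
  assumes "p > 0" "Lp p f" "Lp p g" "Lp p h"
  shows "(LINT s|lborel. \<bar>f s - h s\<bar> powr p) \<le>
    2 powr p * ((LINT s|lborel. \<bar>f s - g s\<bar> powr p) + (LINT s|lborel. \<bar>g s - h s\<bar> powr p))"
  using Lp_add(2)[OF assms(1) Lp_diff[OF assms(1,2,3)] Lp_diff[OF assms(1,3,4)]] by simp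

text \<open>Three approximations: restrict to (-R, R), replace the indicator by a smooth cutoff, and
  replace f by a polynomial close to it on [-R, R]. Continuity of f serves the Weierstrass theorem,
  and the extremals are continuous.\<close>

lemma smooth_cs_dense_Lp:
  fixes f :: "real \<Rightarrow> real"
  assumes p: "p > 0" and f: "continuous_on UNIV f" "Lp p f" and e: "e > 0"
  shows "\<exists>h\<in>smooth_cs. (LINT s|lborel. \<bar>f s - h s\<bar> powr p) < e"
proof -
  define d where "d = e / (2 * 2 powr p)"
  have d: "d > 0" using e by (simp add: d_def)
  have fi: "integrable lborel (\<lambda>s. \<bar>f s\<bar> powr p)" and [measurable]: "f \<in> borel_measurable borel"
    using f by (auto simp: Lp_def)
  have "(\<lambda>n. LINT s|lborel. \<bar>f s\<bar> powr p * (1 - indicator {-real n<..<real n} s)) \<longlonglongrightarrow> (LINT s::real|lborel. (0::real))"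
  proof (rule integral_dominated_convergence[where w="\<lambda>s. \<bar>f s\<bar> powr p"])
    show "AE s in lborel. (\<lambda>n. \<bar>f s\<bar> powr p * (1 - indicator {-real n<..<real n} s)) \<longlonglongrightarrow> 0"
    proof (intro AE_I2 tendsto_eventually)
      fix s :: real
      obtain n0 :: nat where n0: "\<bar>s\<bar> < real n0" using reals_Archimedean2 by blast
      show "\<forall>\<^sub>F n in sequentially. \<bar>f s\<bar> powr p * (1 - indicator {-real n<..<real n} s) = 0"
        using eventually_ge_at_top[of n0] by eventually_elim (use n0 in \<open>auto simp: indicator_def\<close>)
    qed
  qed (use fi in \<open>auto simp: indicator_def\<close>)
  then have "\<forall>\<^sub>F n in sequentially. (LINT s|lborel. \<bar>f s\<bar> powr p * (1 - indicator {-real n<..<real n} s)) < d / 2"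
    using d by (intro order_tendstoD) auto
  then obtain n :: nat where n: "(LINT s|lborel. \<bar>f s\<bar> powr p * (1 - indicator {-real n<..<real n} s)) < d / 2" "n > 0"
    using eventually_gt_at_top[of 0] by (metis (mono_tags, lifting) eventually_conj eventually_happens trivial_limit_sequentially)
  define R where "R = real n"
  have R: "R > 0" using n by (simp add: R_def)
  obtain \<theta> :: "nat \<Rightarrow> real \<Rightarrow> real" where \<theta>: "\<And>m k. Ck k (\<theta> m)" "\<And>m x. 0 \<le> \<theta> m x" "\<And>m x. \<theta> m x \<le> 1"
    "\<And>m x. x \<notin> box (-R) R \<Longrightarrow> \<theta> m x = 0" "\<And>x. (\<lambda>m. \<theta> m x) \<longlonglongrightarrow> indicator (box (-R) R) x"
    using box_cutoff[of "-R" R] by metis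
  have [measurable]: "\<theta> m \<in> borel_measurable borel" for m
    using Ck_imp_continuous[OF \<theta>(1)] by (rule borel_measurable_continuous_onI)
  have "(\<lambda>m. LINT s|lborel. \<bar>f s\<bar> powr p * (1 - \<theta> m s) powr p) \<longlonglongrightarrow>
      (LINT s|lborel. \<bar>f s\<bar> powr p * (1 - indicator {-R<..<R} s))"
  proof (rule integral_dominated_convergence[where w="\<lambda>s. \<bar>f s\<bar> powr p"])
    show "AE s in lborel. (\<lambda>m. \<bar>f s\<bar> powr p * (1 - \<theta> m s) powr p) \<longlonglongrightarrow> \<bar>f s\<bar> powr p * (1 - indicator {-R<..<R} s)"
    proof (intro AE_I2)
      fix s
      have "(\<lambda>m. \<bar>f s\<bar> powr p * (1 - \<theta> m s) powr p) \<longlonglongrightarrow> \<bar>f s\<bar> powr p * (1 - indicator (box (-R) R) s) powr p"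
        using \<theta>(3) p by (intro tendsto_intros tendsto_powr' \<theta>(5)) auto
      then show "(\<lambda>m. \<bar>f s\<bar> powr p * (1 - \<theta> m s) powr p) \<longlonglongrightarrow> \<bar>f s\<bar> powr p * (1 - indicator {-R<..<R} s)"
        using p by (cases "s \<in> {-R<..<R}") (auto simp: box_real)
    qed
    show "AE s in lborel. norm (\<bar>f s\<bar> powr p * (1 - \<theta> m s) powr p) \<le> \<bar>f s\<bar> powr p" for m
      using \<theta>(2,3)[of m] p by (intro AE_I2) (auto simp: abs_mult intro!: mult_left_le powr_le1)
  qed (use fi in auto)
  moreover have "(LINT s|lborel. \<bar>f s\<bar> powr p * (1 - indicator {-R<..<R} s)) < d"
    using n(1) d unfolding R_def by linarith
  ultimately have "\<forall>\<^sub>F m in sequentially. (LINT s|lborel. \<bar>f s\<bar> powr p * (1 - \<theta> m s) powr p) < d"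
    by (rule order_tendstoD)
  then obtain m where m: "(LINT s|lborel. \<bar>f s\<bar> powr p * (1 - \<theta> m s) powr p) < d"
    by (auto dest: eventually_happens)
  \<comment> \<open>Chosen so that the polynomial error contributes \<open>\<eta> powr p\<close>
    times the length 2 R, that is d / 2.\<close>
  define \<eta> where "\<eta> = (d / (4 * R)) powr (1 / p)"
  have \<eta>: "\<eta> > 0" "\<eta> powr p = d / (4 * R)" using d R p by (auto simp: \<eta>_def powr_powr)
  have "continuous_on {-R..R} f" using f(1) continuous_on_subset by blast
  from Stone_Weierstrass_real_polynomial_function[OF compact_Icc this \<eta>(1)]
  obtain P where P: "real_polynomial_function P" "\<And>s. s \<in> {-R..R} \<Longrightarrow> \<bar>f s - P s\<bar> < \<eta>" by auto
  have CP: "Ck k P" for k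
    using P(1) by induction (auto intro: Ck_bounded_linear Ck_const Ck_add Ck_mult)
  define h where "h s = P s * \<theta> m s" for s
  have \<theta>0: "\<theta> m s = 0" if "\<bar>s\<bar> > R" for s
    by (rule \<theta>(4)) (use that in \<open>auto simp: box_real abs_less_iff\<close>)
  have hs: "h \<in> smooth_cs"
  proof -
    have "h s = 0" if "\<bar>s\<bar> > R" for s
      using \<theta>0[OF that] by (simp add: h_def)
    then show ?thesis
      unfolding smooth_cs_def using Ck_mult[OF CP \<theta>(1)] by (auto simp: h_def[abs_def])
  qed
  have cf\<theta>: "continuous_on UNIV (\<lambda>s. f s * \<theta> m s)"
    by (intro continuous_intros f(1) Ck_imp_continuous[OF \<theta>(1)])
  have Lf\<theta>: "Lp p (\<lambda>s. f s * \<theta> m s)"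
    by (rule Lp_cont_cs[OF p cf\<theta>, of R]) (use \<theta>0 in auto)
  have "(LINT s|lborel. \<bar>f s - f s * \<theta> m s\<bar> powr p) = (LINT s|lborel. \<bar>f s\<bar> powr p * (1 - \<theta> m s) powr p)"
  proof -
    have "\<bar>f s - f s * \<theta> m s\<bar> = \<bar>f s\<bar> * (1 - \<theta> m s)" for s
    proof -
      have "f s - f s * \<theta> m s = f s * (1 - \<theta> m s)" by (simp add: algebra_simps)
      then show ?thesis using \<theta>(3)[of m s] by (simp add: abs_mult)
    qed
    then show ?thesis using \<theta>(3) by (simp add: powr_mult)
  qed
  with m have 1: "(LINT s|lborel. \<bar>f s - f s * \<theta> m s\<bar> powr p) < d" by simp
  have "(LINT s|lborel. \<bar>f s * \<theta> m s - h s\<bar> powr p) \<le> (LINT s|lborel. \<eta> powr p * indicator {-R..R} s)"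
  proof (rule integral_mono)
    show "integrable lborel (\<lambda>s. \<bar>f s * \<theta> m s - h s\<bar> powr p)"
      using Lp_diff[OF p Lf\<theta> Lp_smooth_cs[OF p hs]] by (simp add: Lp_def)
    show "integrable lborel (\<lambda>s. \<eta> powr p * indicator {-R..R} s)"
      using emeasure_compact_finite[of "{-R..R}"] by (intro integrable_mult_right integrable_real_indicator) auto
    fix s
    have "f s * \<theta> m s - h s = (f s - P s) * \<theta> m s" by (simp add: h_def algebra_simps)
    then have e1: "\<bar>f s * \<theta> m s - h s\<bar> = \<bar>f s - P s\<bar> * \<theta> m s" using \<theta>(2)[of m s] by (simp add: abs_mult)
    show "\<bar>f s * \<theta> m s - h s\<bar> powr p \<le> \<eta> powr p * indicator {-R..R} s"
    proof (cases "s \<in> {-R..R}")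
      case True
      have "\<bar>f s - P s\<bar> * \<theta> m s \<le> \<eta> * 1"
        using P(2)[OF True] \<theta>(2,3)[of m s] \<eta>(1) by (intro mult_mono) auto
      then show ?thesis using True p \<theta>(2)[of m s] unfolding e1 by (auto intro!: powr_mono2)
    next
      case False
      then have "\<theta> m s = 0" by (intro \<theta>(4)) (auto simp: box_real)
      then show ?thesis unfolding e1 using p False by simp
    qed
  qed
  also have "\<dots> = d / 2" using R \<eta>(2) by simp
  finally have 2: "(LINT s|lborel. \<bar>f s * \<theta> m s - h s\<bar> powr p) \<le> d / 2" .
  have "(LINT s|lborel. \<bar>f s - h s\<bar> powr p) \<le> 2 powr p * (d + d / 2)"
    using Lp_dist_triangle[OF p f(2) Lf\<theta> Lp_smooth_cs[OF p hs]] 1 2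
    by (elim order_trans) (intro mult_left_mono add_mono, auto)
  also have "\<dots> < e" using e by (simp add: d_def)
  finally show ?thesis using hs by blast
qed

text \<open>The chain with an arbitrary list of roots, the head acting first. Inductions can then
  add a factor at either end.\<close>

fun ops :: "real list \<Rightarrow> (real \<Rightarrow> real) \<Rightarrow> real \<Rightarrow> real" where
  "ops [] g = g"
| "ops (\<mu> # \<Lambda>) g = ops \<Lambda> (\<lambda>s. deriv g s - \<mu> * g s)"

section \<open>Dense range of the operators\<close>

lemma ops_append: "ops (\<Lambda> @ \<Lambda>') g = ops \<Lambda>' (ops \<Lambda> g)"
  by (induction \<Lambda> arbitrary: g) auto

lemma ops_ef_chain: "ops (map (ef_root n a) [0..<k]) w = ef_chain n a k w"
  by (induction k) (auto simp: ops_append)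

lemma smooth_cs_step: "g \<in> smooth_cs \<Longrightarrow> (\<lambda>s. deriv g s - \<mu> * g s) \<in> smooth_cs"
  by (intro smooth_cs_diff smooth_cs_cmult smooth_csD(4))

lemma ops_smooth_cs: "g \<in> smooth_cs \<Longrightarrow> ops \<Lambda> g \<in> smooth_cs"
  by (induction \<Lambda> arbitrary: g) (auto intro: smooth_cs_step)

lemma ops_diff: "f \<in> smooth_cs \<Longrightarrow> g \<in> smooth_cs \<Longrightarrow> ops \<Lambda> (\<lambda>s. f s - g s) = (\<lambda>s. ops \<Lambda> f s - ops \<Lambda> g s)"
proof (induction \<Lambda> arbitrary: f g)
  case (Cons \<mu> \<Lambda>)
  have "deriv (\<lambda>s. f s - g s) s = deriv f s - deriv g s" for s
    using Cons.prems by (intro DERIV_imp_deriv DERIV_diff smooth_csD(2))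
  then have "(\<lambda>s. deriv (\<lambda>s. f s - g s) s - \<mu> * (f s - g s)) = (\<lambda>s. (deriv f s - \<mu> * f s) - (deriv g s - \<mu> * g s))"
    by (auto simp: algebra_simps)
  then show ?case using Cons.IH[OF smooth_cs_step smooth_cs_step, OF Cons.prems] by simp
qed simp

lemma ops_cmult: "f \<in> smooth_cs \<Longrightarrow> ops \<Lambda> (\<lambda>s. c * f s) = (\<lambda>s. c * ops \<Lambda> f s)"
proof (induction \<Lambda> arbitrary: f)
  case (Cons \<mu> \<Lambda>)
  have "deriv (\<lambda>s. c * f s) s = c * deriv f s" for s
    using Cons.prems by (intro DERIV_imp_deriv DERIV_cmult smooth_csD(2))
  then have "(\<lambda>s. deriv (\<lambda>s. c * f s) s - \<mu> * (c * f s)) = (\<lambda>s. c * (deriv f s - \<mu> * f s))"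
    by (auto simp: algebra_simps)
  then show ?case using Cons.IH[OF smooth_cs_step, OF Cons.prems] by simp
qed simp

lemma deriv_shift:
  assumes "f \<in> smooth_cs"
  shows "deriv (\<lambda>s. f (c * s + d)) s = c * deriv f (c * s + d)"
proof (rule DERIV_imp_deriv)
  have "((\<lambda>s. f (c * s + d)) has_real_derivative deriv f (c * s + d) * c) (at s)"
    by (rule DERIV_chain2[where f=f and g="\<lambda>s. c * s + d", OF smooth_csD(2)[OF assms]])
      (auto intro!: derivative_eq_intros)
  then show "((\<lambda>s. f (c * s + d)) has_real_derivative c * deriv f (c * s + d)) (at s)" by (simp add: mult.commute)
qed

lemma ops_translate: "f \<in> smooth_cs \<Longrightarrow> ops \<Lambda> (\<lambda>s. f (s + d)) = (\<lambda>s. ops \<Lambda> f (s + d))"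
proof (induction \<Lambda> arbitrary: f)
  case (Cons \<mu> \<Lambda>)
  have "deriv (\<lambda>s. f (s + d)) s = deriv f (s + d)" for s
    using deriv_shift[OF Cons.prems, of 1 d] by simp
  then show ?case using Cons.IH[OF smooth_cs_step, OF Cons.prems] by simp
qed simp

text \<open>Variation of constants: w is exp (mu s) times the primitive of exp (-mu t) h that
  vanishes near -infinity. The moment is the total increment of this primitive, so it also vanishes
  to the right of the support.\<close>

lemma first_order_solvable:
  assumes h: "h \<in> smooth_cs" and m: "(LINT t|lborel. exp (- \<mu> * t) * h t) = 0"
  shows "\<exists>w\<in>smooth_cs. (\<lambda>s. deriv w s - \<mu> * w s) = h"
proof -
  obtain M0 where M0: "\<And>s. \<bar>s\<bar> > M0 \<Longrightarrow> h s = 0" using h by (auto simp: smooth_cs_def)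
  \<comment> \<open>The additional 1 makes h vanish at the endpoints -M and M as well.\<close>
  define M where "M = \<bar>M0\<bar> + 1"
  have M: "M > 0" "\<And>s. \<bar>s\<bar> \<ge> M \<Longrightarrow> h s = 0" using M0 by (auto simp: M_def)
  let ?g = "\<lambda>t. exp (- \<mu> * t) * h t"
  have cg: "continuous_on UNIV ?g" by (intro continuous_intros smooth_csD(3)[OF h])
  then have ig: "isCont ?g t" for t by (simp add: continuous_on_eq_continuous_at)
  have "\<exists>F. \<forall>x. -\<infinity> < ereal x \<longrightarrow> ereal x < \<infinity> \<longrightarrow> (F has_vector_derivative ?g x) (at x)"
    by (rule einterval_antiderivative) (use ig in auto)
  then obtain F where F: "\<And>x. (F has_real_derivative ?g x) (at x)"
    by (auto simp: has_real_derivative_iff_has_vector_derivative)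
  define H where "H s = F s - F (- M)" for s
  have H: "(H has_real_derivative ?g s) (at s)" for s
    unfolding H_def[abs_def] by (auto intro!: derivative_eq_intros F)
  have left: "H s = 0" if "s \<le> - M" for s
  proof -
    have "H (-M) = H s"
    proof (cases "s = - M")
      case False
      show ?thesis
      proof (rule DERIV_isconst_end[of s "- M" H])
        show "s < - M" using that False by simp
        show "continuous_on {s..- M} H" using H by (meson DERIV_isCont continuous_at_imp_continuous_on)
        show "(H has_real_derivative 0) (at x)" if "s < x" "x < - M" for x
          using H[of x] M(2)[of x] that M(1) by simp
      qed
    qed simp
    then show ?thesis by (simp add: H_def)
  qed
  have "has_bochner_integral lborel (\<lambda>t. ?g t * indicator {-M..M} t) (H M - H (-M))"
    by (rule has_bochner_integral_FTC_Icc_real[OF _ H ig]) (use M in simp)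
  moreover have eq: "?g t * indicator {-M..M} t = ?g t" for t
  proof (cases "t \<in> {-M..M}")
    case False
    then have "\<bar>t\<bar> \<ge> M" by auto
    then show ?thesis using M(2)[of t] by simp
  qed simp
  ultimately have "H M - H (-M) = 0" using m unfolding eq by (simp only: has_bochner_integral_iff)
  then have "H M = 0" using left[of "-M"] by simp
  have right: "H s = 0" if "s \<ge> M" for s
  proof -
    have "H s = H M"
    proof (cases "s = M")
      case False
      show ?thesis
      proof (rule DERIV_isconst_end[of M s H])
        show "M < s" using that False by simp
        show "continuous_on {M..s} H" using H by (meson DERIV_isCont continuous_at_imp_continuous_on)
        show "(H has_real_derivative 0) (at x)" if "M < x" "x < s" for x
          using H[of x] M(2)[of x] that M(1) by simp
      qed
    qed simp
    with \<open>H M = 0\<close> show ?thesis by simp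
  qed
  define w where "w s = exp (\<mu> * s) * H s" for s
  have w: "(w has_real_derivative \<mu> * w s + h s) (at s)" for s
  proof -
    have "(w has_real_derivative exp (\<mu> * s) * \<mu> * H s + exp (\<mu> * s) * ?g s) (at s)"
      unfolding w_def[abs_def] by (auto intro!: derivative_eq_intros H)
    moreover have "exp (\<mu> * s) * ?g s = h s"
      by (simp add: mult.assoc[symmetric] exp_add[symmetric])
    moreover have "exp (\<mu> * s) * \<mu> * H s = \<mu> * w s" by (simp add: w_def)
    ultimately show ?thesis by (simp only:)
  qed
  \<comment> \<open>Bootstrapping: the derivative mu w + h is as smooth as w.\<close>
  have "Ck k w" for k
  proof (induction k)
    case 0
    show ?case using w by (auto intro!: continuous_at_imp_continuous_on DERIV_isCont)
  next
    case (Suc k)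
    show ?case by (rule Ck_real_SucI[OF w]) (intro Ck_add Ck_cmult Suc smooth_csD(1)[OF h])
  qed
  moreover have "w s = 0" if "\<bar>s\<bar> > M" for s
    using left[of s] right[of s] that by (auto simp: w_def abs_if split: if_splits)
  ultimately have "w \<in> smooth_cs" by (auto simp: smooth_cs_def)
  moreover have "(\<lambda>s. deriv w s - \<mu> * w s) = h"
    using DERIV_imp_deriv[OF w] by auto
  ultimately show ?thesis by blast
qed

lemma ex_bump: "\<exists>\<eta>\<in>smooth_cs. (\<forall>s. 0 \<le> \<eta> s) \<and> (\<forall>s. \<bar>s\<bar> < 1 \<longrightarrow> 0 < \<eta> s)"
proof -
  obtain \<theta> :: "nat \<Rightarrow> real \<Rightarrow> real" where \<theta>: "\<And>m k. Ck k (\<theta> m)" "\<And>m x. 0 \<le> \<theta> m x"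
    "\<And>m x. x \<notin> box (-1) 1 \<Longrightarrow> \<theta> m x = 0" "\<And>m x. m > 0 \<Longrightarrow> x \<in> box (-1) 1 \<Longrightarrow> \<theta> m x > 0"
    using box_cutoff[of "-1" 1] by metis
  have "\<theta> 1 s = 0" if "\<bar>s\<bar> > 1" for s
    by (rule \<theta>(3)) (use that in \<open>auto simp: box_real abs_less_iff\<close>)
  then have "\<theta> 1 \<in> smooth_cs" using \<theta>(1) by (auto simp: smooth_cs_def)
  moreover have "0 < \<theta> 1 s" if "\<bar>s\<bar> < 1" for s
    by (rule \<theta>(4)) (use that in \<open>auto simp: box_real abs_less_iff\<close>)
  ultimately show ?thesis using \<theta>(2) by blast
qed

lemma integral_pos_of_pos_near_0:
  assumes f: "integrable lborel f" "\<And>s::real. 0 \<le> f s" "\<And>s. \<bar>s\<bar> < 1 \<Longrightarrow> 0 < f s"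
  shows "0 < (LINT s|lborel. f s :: real)"
proof -
  have "(LINT s|lborel. f s) \<noteq> 0"
  proof
    assume "(LINT s|lborel. f s) = 0"
    then have "AE s in lborel. f s = 0" using f by (subst (asm) integral_nonneg_eq_0_iff_AE) auto
    then have "AE s in lborel. s \<notin> {-1<..<1::real}"
    proof eventually_elim
      case (elim s)
      show ?case using elim f(3)[of s] by (auto simp: abs_less_iff)
    qed
    then have "emeasure lborel {-1<..<1::real} = 0"
      by (subst (asm) AE_iff_measurable[where N="{-1<..<1}"]) auto
    then show False by simp
  qed
  moreover have "0 \<le> (LINT s|lborel. f s)" using f by (intro integral_nonneg_AE) auto
  ultimately show ?thesis by simp
qed

text \<open>The equation has a compactly supported solution iff one exponential moment vanishes. The bump that
  corrects this moment is moved towards infinity, where its \<open>L\<^sup>p\<close> norm tends to \<open>0\<close>.\<close>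

lemma first_order_range_dense:
  assumes p: "p > 0" and \<mu>: "\<mu> \<noteq> 0" and w0: "w0 \<in> smooth_cs" and e: "e > 0"
  shows "\<exists>w\<in>smooth_cs. (LINT s|lborel. \<bar>ops (\<mu> # \<Lambda>) w s - ops \<Lambda> w0 s\<bar> powr p) < e"
proof -
  obtain \<eta>0 where \<eta>0: "\<eta>0 \<in> smooth_cs" "\<And>s. 0 \<le> \<eta>0 s" "\<And>s. \<bar>s\<bar> < 1 \<Longrightarrow> 0 < \<eta>0 s"
    using ex_bump by blast
  have ie: "integrable lborel (\<lambda>t. exp (- \<mu> * t) * g t)" if g: "g \<in> smooth_cs" for g
  proof -
    obtain M where "\<And>s. \<bar>s\<bar> > M \<Longrightarrow> g s = 0" using g by (auto simp: smooth_cs_def)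
    then show ?thesis
      by (intro integrable_compact_support[of _ "{-M..M}"] continuous_intros smooth_csD(3)[OF g])
        (use vanishes_off_Icc[of M g] in \<open>auto simp: vanishes_off_def\<close>)
  qed
  define I0 where "I0 = (LINT t|lborel. exp (- \<mu> * t) * \<eta>0 t)"
  have I0: "I0 > 0" unfolding I0_def
    by (rule integral_pos_of_pos_near_0[OF ie[OF \<eta>0(1)]]) (use \<eta>0 in auto)
  define c where "c = (LINT t|lborel. exp (- \<mu> * t) * w0 t) / I0"
  define K where "K = \<bar>c\<bar> powr p * (LINT s|lborel. \<bar>ops \<Lambda> \<eta>0 s\<bar> powr p)"
  have K: "K \<ge> 0" by (simp add: K_def)
  \<comment> \<open>Solves exp (mu s0)^p = e / (2 (K + 1)); its sign, the direction of the shift,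
    adapts to the sign of mu. The factor exp (mu s0) of the shifted bump keeps its moment at c * I0,
    while the p-th power integral of the correction becomes exp (mu s0)^p * K < e.\<close>
  define s0 where "s0 = ln (e / (K + 1) / 2) / (p * \<mu>)"
  define \<eta> where "\<eta> s = (c * exp (\<mu> * s0)) * \<eta>0 (s + (- s0))" for s
  have \<eta>s: "\<eta> \<in> smooth_cs"
    unfolding \<eta>_def[abs_def] using smooth_cs_cmult[OF smooth_cs_shift[OF \<eta>0(1), of 1 "- s0"]] by simp
  have "(LINT t|lborel. exp (- \<mu> * t) * \<eta> t) = c * I0"
  proof -
    have "exp (- \<mu> * t) * \<eta> t = c * (exp (- \<mu> * (t + (- s0))) * \<eta>0 (t + (- s0)))" for t
    proof -
      have "exp (- \<mu> * t) * exp (\<mu> * s0) = exp (- \<mu> * (t + (- s0)))"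
        by (simp add: exp_add[symmetric] algebra_simps)
      then show ?thesis by (simp add: \<eta>_def mult_ac)
    qed
    then show ?thesis
      using integral_shift[of "\<lambda>t. exp (- \<mu> * t) * \<eta>0 t" "- s0"] by (simp add: I0_def)
  qed
  then have m: "(LINT t|lborel. exp (- \<mu> * t) * (w0 t - \<eta> t)) = 0"
    using I0 Bochner_Integration.integral_diff[OF ie[OF w0] ie[OF \<eta>s]] by (simp add: c_def right_diff_distrib)
  obtain w where w: "w \<in> smooth_cs" "(\<lambda>s. deriv w s - \<mu> * w s) = (\<lambda>s. w0 s - \<eta> s)"
    using first_order_solvable[OF smooth_cs_diff[OF w0 \<eta>s] m] by blast
  have "ops (\<mu> # \<Lambda>) w = (\<lambda>s. ops \<Lambda> w0 s - ops \<Lambda> \<eta> s)"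
    using w by (simp add: ops_diff[OF w0 \<eta>s])
  moreover have "ops \<Lambda> \<eta> = (\<lambda>s. (c * exp (\<mu> * s0)) * ops \<Lambda> \<eta>0 (s + (- s0)))"
    unfolding \<eta>_def[abs_def] using ops_cmult[of "\<lambda>s. \<eta>0 (s + (- s0))" \<Lambda>] smooth_cs_shift[OF \<eta>0(1), of 1 "- s0"]
      ops_translate[OF \<eta>0(1), of \<Lambda> "- s0"] by simp
  ultimately have "(LINT s|lborel. \<bar>ops (\<mu> # \<Lambda>) w s - ops \<Lambda> w0 s\<bar> powr p) =
     (LINT s|lborel. \<bar>(c * exp (\<mu> * s0)) * ops \<Lambda> \<eta>0 (s + (- s0))\<bar> powr p)" by simp
  also have "\<dots> = (LINT s|lborel. \<bar>(c * exp (\<mu> * s0)) * ops \<Lambda> \<eta>0 s\<bar> powr p)"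
    by (rule integral_shift[of "\<lambda>s. \<bar>(c * exp (\<mu> * s0)) * ops \<Lambda> \<eta>0 s\<bar> powr p"])
  also have "\<dots> = exp (\<mu> * s0) powr p * K"
    by (simp add: abs_mult powr_mult K_def mult_ac)
  also have "exp (\<mu> * s0) powr p = e / (K + 1) / 2"
  proof -
    have "p * (\<mu> * s0) = ln (e / (K + 1) / 2)" using p \<mu> by (simp add: s0_def)
    then show ?thesis using e K by (simp add: powr_def)
  qed
  also have "e / (K + 1) / 2 * K < e"
  proof -
    have "K / (K + 1) \<le> 1" using K by simp
    then have "e * (K / (K + 1)) \<le> e * 1" using e by (intro mult_left_mono) auto
    then have "e * (K / (K + 1)) / 2 \<le> e * 1 / 2" by (rule divide_right_mono) simp
    also have "\<dots> < e" using e by simp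
    finally show ?thesis by simp
  qed
  finally show ?thesis using w(1) by blast
qed

text \<open>The factors are inverted from the last one backwards. Differential operators are not
  bounded on L^p, so an error made earlier could not be pushed through the remaining factors; each
  error is therefore measured after the trailing list \<open>\<Lambda>\<close>, which grows by one
  factor per step.\<close>

lemma ops_range_dense:
  assumes p: "p > 0"
  shows "0 \<notin> set \<Lambda>' \<Longrightarrow> w0 \<in> smooth_cs \<Longrightarrow> e > 0 \<Longrightarrow>
    \<exists>w\<in>smooth_cs. (LINT s|lborel. \<bar>ops (\<Lambda>' @ \<Lambda>) w s - ops \<Lambda> w0 s\<bar> powr p) < e"
proof (induction \<Lambda>' arbitrary: \<Lambda> w0 e rule: rev_induct)
  case Nil
  then show ?case using p by (intro bexI[of _ w0]) auto
next
  case (snoc \<mu> \<Lambda>')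
  define d where "d = e / (2 * 2 powr p)"
  have d: "d > 0" using snoc.prems by (simp add: d_def)
  obtain w1 where w1: "w1 \<in> smooth_cs" "(LINT s|lborel. \<bar>ops (\<mu> # \<Lambda>) w1 s - ops \<Lambda> w0 s\<bar> powr p) < d"
    using first_order_range_dense[OF p _ snoc.prems(2) d, of \<mu> \<Lambda>] snoc.prems(1) by auto
  obtain w where w: "w \<in> smooth_cs" "(LINT s|lborel. \<bar>ops (\<Lambda>' @ (\<mu> # \<Lambda>)) w s - ops (\<mu> # \<Lambda>) w1 s\<bar> powr p) < d"
    using snoc.IH[of w1 d "\<mu> # \<Lambda>"] snoc.prems(1) w1(1) d by auto
  have "(LINT s|lborel. \<bar>ops (\<Lambda>' @ (\<mu> # \<Lambda>)) w s - ops \<Lambda> w0 s\<bar> powr p) \<le>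
    2 powr p * ((LINT s|lborel. \<bar>ops (\<Lambda>' @ (\<mu> # \<Lambda>)) w s - ops (\<mu> # \<Lambda>) w1 s\<bar> powr p) +
      (LINT s|lborel. \<bar>ops (\<mu> # \<Lambda>) w1 s - ops \<Lambda> w0 s\<bar> powr p))"
    by (intro Lp_dist_triangle[OF p] Lp_smooth_cs[OF p] ops_smooth_cs w w1 snoc.prems)
  also have "\<dots> < 2 powr p * (d + d)"
    using w(2) w1(2) by (intro mult_strict_left_mono add_strict_mono) auto
  also have "\<dots> = e" by (simp add: d_def)
  finally show ?case using w(1) by auto
qed

lemma ef_chain_range_dense:
  assumes p: "p > 0" and r: "\<And>l. l < k \<Longrightarrow> ef_root n a l \<noteq> 0"
    and f: "continuous_on UNIV f" "Lp p f" and e: "e > 0"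
  shows "\<exists>w\<in>smooth_cs. (LINT s|lborel. \<bar>ef_chain n a k w s - f s\<bar> powr p) < e"
proof -
  define d where "d = e / (2 * 2 powr p)"
  have d: "d > 0" using e by (simp add: d_def)
  obtain h where h: "h \<in> smooth_cs" "(LINT s|lborel. \<bar>f s - h s\<bar> powr p) < d"
    using smooth_cs_dense_Lp[OF p f d] by blast
  have "0 \<notin> set (map (ef_root n a) [0..<k])" using r by (force simp: image_iff)
  from ops_range_dense[OF p this h(1) d, of "[]"]
  obtain w where w: "w \<in> smooth_cs" "(LINT s|lborel. \<bar>ef_chain n a k w s - h s\<bar> powr p) < d"
    by (auto simp: ops_ef_chain)
  have "(LINT s|lborel. \<bar>ef_chain n a k w s - f s\<bar> powr p) \<le>
    2 powr p * ((LINT s|lborel. \<bar>ef_chain n a k w s - h s\<bar> powr p) + (LINT s|lborel. \<bar>h s - f s\<bar> powr p))"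
    by (intro Lp_dist_triangle[OF p] Lp_smooth_cs[OF p] ef_chain_smooth_cs w h f)
  also have "\<dots> < 2 powr p * (d + d)"
    using w(2) h(2) by (intro mult_strict_left_mono add_strict_mono) (auto simp: abs_minus_commute)
  also have "\<dots> = e" by (simp add: d_def)
  finally show ?thesis using w(1) by auto
qed

text \<open>Every derivative of psi (s / R) gains 1 / R. If a root is 0, its factor is a pure
  derivative and the gain is not spoilt by a zeroth order term. Both bounds are proved together, as
  a factor with nonzero root needs the gain from the rest of the list; the derivative of psi is
  treated by the same induction.\<close>

lemma ops_dilation_bound:
  "\<psi> \<in> smooth_cs \<Longrightarrow> \<exists>C\<ge>0. \<forall>R\<ge>1. \<forall>s. \<bar>ops \<Lambda> (\<lambda>s. \<psi> (1 / R * s + 0)) s\<bar> \<le> C \<and>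
    (0 \<in> set \<Lambda> \<longrightarrow> \<bar>ops \<Lambda> (\<lambda>s. \<psi> (1 / R * s + 0)) s\<bar> \<le> C / R)"
proof (induction \<Lambda> arbitrary: \<psi>)
  case Nil
  obtain M where M: "\<And>s. \<bar>s\<bar> > M \<Longrightarrow> \<psi> s = 0" using Nil by (auto simp: smooth_cs_def)
  obtain D where D: "\<And>s. \<bar>\<psi> s\<bar> \<le> D"
    using continuous_cs_bounded[OF smooth_csD(3)[OF Nil] M] by blast
  then have "0 \<le> D" using abs_ge_zero order_trans by blast
  with D show ?case by (intro exI[of _ D]) auto
next
  case (Cons \<mu> \<Lambda>)
  obtain C1 where C1: "C1 \<ge> 0" "\<And>R s. R \<ge> 1 \<Longrightarrow> \<bar>ops \<Lambda> (\<lambda>s. deriv \<psi> (1 / R * s + 0)) s\<bar> \<le> C1"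
      "\<And>R s. R \<ge> 1 \<Longrightarrow> 0 \<in> set \<Lambda> \<Longrightarrow> \<bar>ops \<Lambda> (\<lambda>s. deriv \<psi> (1 / R * s + 0)) s\<bar> \<le> C1 / R"
    using Cons.IH[OF smooth_csD(4)[OF Cons.prems]] by blast
  obtain C2 where C2: "C2 \<ge> 0" "\<And>R s. R \<ge> 1 \<Longrightarrow> \<bar>ops \<Lambda> (\<lambda>s. \<psi> (1 / R * s + 0)) s\<bar> \<le> C2"
      "\<And>R s. R \<ge> 1 \<Longrightarrow> 0 \<in> set \<Lambda> \<Longrightarrow> \<bar>ops \<Lambda> (\<lambda>s. \<psi> (1 / R * s + 0)) s\<bar> \<le> C2 / R"
    using Cons.IH[OF Cons.prems] by blast
  define C where "C = C1 + \<bar>\<mu>\<bar> * C2"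
  have "\<bar>ops (\<mu> # \<Lambda>) (\<lambda>s. \<psi> (1 / R * s + 0)) s\<bar> \<le> C \<and>
    (0 \<in> set (\<mu> # \<Lambda>) \<longrightarrow> \<bar>ops (\<mu> # \<Lambda>) (\<lambda>s. \<psi> (1 / R * s + 0)) s\<bar> \<le> C / R)" if R: "R \<ge> 1" for R s
  proof -
    have s1: "(\<lambda>s. deriv \<psi> (1 / R * s + 0)) \<in> smooth_cs" "(\<lambda>s. \<psi> (1 / R * s + 0)) \<in> smooth_cs"
      using R by (intro smooth_cs_shift smooth_csD(4) Cons.prems; simp)+
    define X Y where "X = ops \<Lambda> (\<lambda>s. deriv \<psi> (1 / R * s + 0)) s" and "Y = ops \<Lambda> (\<lambda>s. \<psi> (1 / R * s + 0)) s"
    have "ops (\<mu> # \<Lambda>) (\<lambda>s. \<psi> (1 / R * s + 0)) s = 1 / R * X - \<mu> * Y"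
      using ops_diff[OF smooth_cs_cmult[OF s1(1), of "1 / R"] smooth_cs_cmult[OF s1(2), of \<mu>], of \<Lambda>]
        ops_cmult[OF s1(1), of \<Lambda> "1 / R"] ops_cmult[OF s1(2), of \<Lambda> \<mu>] deriv_shift[OF Cons.prems, of "1 / R" 0]
      by (simp add: X_def Y_def)
    then have le: "\<bar>ops (\<mu> # \<Lambda>) (\<lambda>s. \<psi> (1 / R * s + 0)) s\<bar> \<le> \<bar>X\<bar> / R + \<bar>\<mu>\<bar> * \<bar>Y\<bar>"
      using R by (simp add: abs_mult[symmetric] order_trans[OF abs_triangle_ineq4])
    have X: "\<bar>X\<bar> \<le> C1" "0 \<in> set \<Lambda> \<Longrightarrow> \<bar>X\<bar> \<le> C1 / R" using C1(2,3)[OF R] by (auto simp: X_def)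
    have Y: "\<bar>Y\<bar> \<le> C2" "0 \<in> set \<Lambda> \<Longrightarrow> \<bar>Y\<bar> \<le> C2 / R" using C2(2,3)[OF R] by (auto simp: Y_def)
    have XR: "\<bar>X\<bar> / R \<le> C1 / R" using X R by (intro divide_right_mono) auto
    have "C1 / R \<le> C1" using C1(1) R by (simp add: divide_le_eq mult_le_cancel_left1)
    then have 1: "\<bar>X\<bar> / R + \<bar>\<mu>\<bar> * \<bar>Y\<bar> \<le> C"
      unfolding C_def using XR Y(1) by (intro add_mono mult_left_mono) auto
    have 2: "\<bar>X\<bar> / R + \<bar>\<mu>\<bar> * \<bar>Y\<bar> \<le> C / R" if "0 \<in> set (\<mu> # \<Lambda>)"
    proof (cases "\<mu> = 0")
      case True
      then show ?thesis using XR by (simp add: C_def)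
    next
      case False
      then have "\<bar>\<mu>\<bar> * \<bar>Y\<bar> \<le> \<bar>\<mu>\<bar> * (C2 / R)" using that Y(2) by (intro mult_left_mono) auto
      then show ?thesis using XR by (simp add: C_def add_divide_distrib)
    qed
    show ?thesis using le 1 2 by (meson order_trans)
  qed
  moreover have "C \<ge> 0" using C1(1) C2(1) by (simp add: C_def)
  ultimately show ?case by blast
qed

section \<open>Limits in the completion\<close>

text \<open>The Riesz-Fischer argument for p-th power distances: a fast subsequence converges almost
  everywhere, and Fatou's lemma turns its limit into a limit of the whole sequence.\<close>

lemma Lp_complete:
  fixes f :: "nat \<Rightarrow> real \<Rightarrow> real"
  assumes p: "p > 0" and f: "\<And>i. Lp p (f i)"
    and C: "\<And>e. e > 0 \<Longrightarrow> \<exists>N. \<forall>i\<ge>N. \<forall>l\<ge>N. (LINT s|lborel. \<bar>f i s - f l s\<bar> powr p) < e"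
  shows "\<exists>g. Lp p g \<and> (\<lambda>i. LINT s|lborel. \<bar>f i s - g s\<bar> powr p) \<longlonglongrightarrow> 0"
proof -
  have [measurable]: "f i \<in> borel_measurable borel" for i using f by (simp add: Lp_def)
  \<comment> \<open>So small that even after multiplication by 2^(m p) the p-th powers of the
    increments have a finite sum. Almost everywhere the increments are then eventually at most
    2^(-m).\<close>
  define e where "e m = (1 / 2 powr (real m * p)) * (1/2) ^ m" for m :: nat
  have e: "e m > 0" for m by (simp add: e_def)
  obtain N where N: "\<And>m i l. i \<ge> N m \<Longrightarrow> l \<ge> N m \<Longrightarrow> (LINT s|lborel. \<bar>f i s - f l s\<bar> powr p) < e m"
    using C[OF e] by metis
  \<comment> \<open>The partial sums make r m and r (Suc m) both at least N m, and the summand m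
    lets r tend to infinity.\<close>
  define r where "r m = (\<Sum>j\<le>m. N j) + m" for m
  have r: "r m \<ge> N m" "r (Suc m) \<ge> N m" for m
  proof -
    have "N m \<le> (\<Sum>j\<le>m. N j)" by (rule member_le_sum) auto
    then show "r m \<ge> N m" "r (Suc m) \<ge> N m" by (auto simp: r_def)
  qed
  have rm: "r m \<ge> m" for m by (simp add: r_def)
  have L: "Lp p (\<lambda>s. f i s - f l s)" for i l by (rule Lp_diff[OF p f f])
  have nn: "(\<integral>\<^sup>+s. ennreal (\<bar>f i s - f l s\<bar> powr p) \<partial>lborel) = ennreal (LINT s|lborel. \<bar>f i s - f l s\<bar> powr p)" for i l
    using L[of i l] by (intro nn_integral_eq_integral) (auto simp: Lp_def)
  define D where "D m s = 2 powr (real m * p) * \<bar>f (r (Suc m)) s - f (r m) s\<bar> powr p" for m s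
  have "(\<integral>\<^sup>+s. (\<Sum>m. ennreal (D m s)) \<partial>lborel) = (\<Sum>m. \<integral>\<^sup>+s. ennreal (D m s) \<partial>lborel)"
    by (rule nn_integral_suminf) (simp add: D_def)
  also have "\<dots> \<le> (\<Sum>m. ennreal ((1/2) ^ m))"
  proof (rule suminf_le)
    fix m
    have "(\<integral>\<^sup>+s. ennreal (D m s) \<partial>lborel) =
       ennreal (2 powr (real m * p)) * (\<integral>\<^sup>+s. ennreal (\<bar>f (r (Suc m)) s - f (r m) s\<bar> powr p) \<partial>lborel)"
      unfolding D_def by (subst nn_integral_cmult[symmetric]) (auto simp: ennreal_mult')
    also have "\<dots> \<le> ennreal (2 powr (real m * p)) * ennreal (e m)"
      unfolding nn using N[OF r(2) r(1), of m] by (intro mult_left_mono ennreal_leI) auto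
    also have "\<dots> = ennreal ((1/2) ^ m)" by (simp add: e_def ennreal_mult'[symmetric])
    finally show "(\<integral>\<^sup>+s. ennreal (D m s) \<partial>lborel) \<le> ennreal ((1/2) ^ m)" .
  qed auto
  also have "\<dots> = ennreal (\<Sum>m. (1/2) ^ m)" by (rule suminf_ennreal2) (auto intro: summable_geometric)
  finally have "(\<integral>\<^sup>+s. (\<Sum>m. ennreal (D m s)) \<partial>lborel) < \<infinity>" by (auto intro: le_less_trans)
  then have "AE s in lborel. (\<Sum>m. ennreal (D m s)) \<noteq> \<infinity>"
    by (intro nn_integral_PInf_AE) (auto simp: D_def)
  then have conv: "AE s in lborel. convergent (\<lambda>m. f (r m) s)"
  proof eventually_elim
    case (elim s)
    have "summable (\<lambda>m. D m s)"
      using elim by (intro summable_suminf_not_top) (auto simp: D_def)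
    then have "(\<lambda>m. D m s) \<longlonglongrightarrow> 0" by (rule summable_LIMSEQ_zero)
    then have "\<forall>\<^sub>F m in sequentially. D m s < 1" by (rule order_tendstoD) simp
    then have "\<forall>\<^sub>F m in sequentially. norm (f (r (Suc m)) s - f (r m) s) \<le> (1/2) ^ m"
    proof eventually_elim
      case (elim m)
      have "(2 ^ m * \<bar>f (r (Suc m)) s - f (r m) s\<bar>) powr p < 1"
        using elim by (simp add: D_def powr_mult powr_powr[symmetric] powr_realpow)
      then have "2 ^ m * \<bar>f (r (Suc m)) s - f (r m) s\<bar> < 1"
        using p by (metis abs_ge_zero ge_one_powr_ge_zero less_eq_real_def linorder_not_less not_less)
      then show ?case by (simp add: field_simps)
    qed
    then have "summable (\<lambda>m. f (r (Suc m)) s - f (r m) s)"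
      by (rule summable_comparison_test_ev) (auto intro: summable_geometric)
    then have "convergent (\<lambda>m. \<Sum>i<m. f (r (Suc i)) s - f (r i) s)" by (simp add: summable_iff_convergent)
    moreover have "(\<Sum>i<m. f (r (Suc i)) s - f (r i) s) = f (r m) s - f (r 0) s" for m
      by (rule sum_lessThan_telescope)
    ultimately have "convergent (\<lambda>m. f (r m) s - f (r 0) s)" by simp
    then show ?case by (simp add: convergent_diff_const_right_iff)
  qed
  define g where "g s = lim (\<lambda>m. f (r m) s)" for s
  have [measurable]: "g \<in> borel_measurable borel" unfolding g_def[abs_def] by measurable
  have gl: "AE s in lborel. (\<lambda>m. f (r m) s) \<longlonglongrightarrow> g s"
    using conv by eventually_elim (simp add: g_def convergent_LIMSEQ_iff)
  \<comment> \<open>Fatou's lemma in the second index bounds the distance to g by the eventual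
    distances within the sequence.\<close>
  have le: "(\<integral>\<^sup>+s. ennreal (\<bar>f i s - g s\<bar> powr p) \<partial>lborel) \<le> ennreal \<epsilon>"
    if M: "\<And>l. l \<ge> M \<Longrightarrow> (LINT s|lborel. \<bar>f i s - f l s\<bar> powr p) < \<epsilon>" for i M \<epsilon>
  proof -
    have "(\<integral>\<^sup>+s. ennreal (\<bar>f i s - g s\<bar> powr p) \<partial>lborel) \<le>
        (\<integral>\<^sup>+s. liminf (\<lambda>m. ennreal (\<bar>f i s - f (r m) s\<bar> powr p)) \<partial>lborel)"
    proof (rule nn_integral_mono_AE)
      show "AE s in lborel. ennreal (\<bar>f i s - g s\<bar> powr p) \<le> liminf (\<lambda>m. ennreal (\<bar>f i s - f (r m) s\<bar> powr p))"
        using gl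
      proof eventually_elim
        case (elim s)
        have "(\<lambda>m. ennreal (\<bar>f i s - f (r m) s\<bar> powr p)) \<longlonglongrightarrow> ennreal (\<bar>f i s - g s\<bar> powr p)"
          using p by (intro tendsto_ennrealI tendsto_powr' tendsto_rabs tendsto_diff elim tendsto_const) auto
        then show ?case using lim_imp_Liminf[OF sequentially_bot] by force
      qed
    qed
    also have "\<dots> \<le> liminf (\<lambda>m. \<integral>\<^sup>+s. ennreal (\<bar>f i s - f (r m) s\<bar> powr p) \<partial>lborel)"
      by (rule nn_integral_liminf) measurable
    also have "\<dots> \<le> ennreal \<epsilon>"
    proof (rule Liminf_le[OF sequentially_bot])
      show "\<forall>\<^sub>F m in sequentially. (\<integral>\<^sup>+s. ennreal (\<bar>f i s - f (r m) s\<bar> powr p) \<partial>lborel) \<le> ennreal \<epsilon>"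
        using eventually_ge_at_top[of M]
      proof eventually_elim
        case (elim m)
        have "(LINT s|lborel. \<bar>f i s - f (r m) s\<bar> powr p) < \<epsilon>" using elim rm[of m] by (intro M) simp
        then show ?case unfolding nn by (intro ennreal_leI) simp
      qed
    qed
    finally show ?thesis .
  qed
  have Lg': "Lp p (\<lambda>s. f (N 0) s - g s)"
    using le[of "N 0" "N 0" "e 0"] N[of 0 "N 0"]
    unfolding Lp_def by (auto intro!: integrableI_bounded simp: le_less_trans)
  have "Lp p g" using Lp_diff[OF p f[of "N 0"] Lg'] by simp
  moreover have "(\<lambda>i. LINT s|lborel. \<bar>f i s - g s\<bar> powr p) \<longlonglongrightarrow> 0"
    unfolding LIMSEQ_def
  proof (intro allI impI)
    fix \<epsilon> :: real assume \<epsilon>: "\<epsilon> > 0"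
    then obtain M where M: "\<And>i l. i \<ge> M \<Longrightarrow> l \<ge> M \<Longrightarrow> (LINT s|lborel. \<bar>f i s - f l s\<bar> powr p) < \<epsilon> / 2"
      using C[of "\<epsilon> / 2"] by (metis half_gt_zero)
    have "dist (LINT s|lborel. \<bar>f i s - g s\<bar> powr p) 0 < \<epsilon>" if "i \<ge> M" for i
    proof -
      have "ennreal (LINT s|lborel. \<bar>f i s - g s\<bar> powr p) = (\<integral>\<^sup>+s. ennreal (\<bar>f i s - g s\<bar> powr p) \<partial>lborel)"
        using Lp_diff[OF p f \<open>Lp p g\<close>, of i] by (intro nn_integral_eq_integral[symmetric]) (auto simp: Lp_def)
      also have "\<dots> \<le> ennreal (\<epsilon> / 2)" by (rule le[of M]) (rule M[OF that])
      finally show ?thesis using \<epsilon> by (subst (asm) ennreal_le_iff) auto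
    qed
    then show "\<exists>M. \<forall>i\<ge>M. dist (LINT s|lborel. \<bar>f i s - g s\<bar> powr p) 0 < \<epsilon>" by blast
  qed
  ultimately show ?thesis by blast
qed

section \<open>Weak derivatives of limits\<close>

lemma ef_measurable [measurable]:
  assumes [measurable]: "z \<in> borel_measurable borel"
  shows "(ef b z :: 'a::euclidean_space \<Rightarrow> real) \<in> borel_measurable borel"
  unfolding ef_def[abs_def] by measurable

lemma ef_dir_measurable [measurable]: "(ef_dir l :: 'a::euclidean_space \<Rightarrow> real \<times> 'a) \<in> borel_measurable borel"
  unfolding ef_dir_def[abs_def] by measurable

text \<open>On K the powers of |x| and the Jacobian are bounded, and \<open>le_truncation\<close>
  replaces Hoelder. The parameter N is left free: when the L^p size of z tends to 0, a small fixed N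
  makes the first term small and then the second tends to 0.\<close>

lemma ef_L1_bound:
  fixes K :: "'a::euclidean_space set"
  assumes K: "compact K" "0 \<notin> K" and p: "p > 1"
  obtains C where "C \<ge> 0" "\<And>z N. Lp p z \<Longrightarrow> N > 0 \<Longrightarrow>
    (\<integral>\<^sup>+x. ennreal (indicator K x * \<bar>ef b z x\<bar>) \<partial>lborel) \<le>
      ennreal (N * C + N powr (1 - p) * C * (LINT s|lborel. \<bar>z s\<bar> powr p))"
proof -
  obtain M where M: "M > 0" "\<And>x. x \<in> K \<Longrightarrow> x \<noteq> 0 \<and> \<bar>ln (norm x)\<bar> \<le> M"
    using compact_punctured_annulus[OF K] by blast
  define C0 where "C0 = exp (\<bar>b\<bar> * M)"
  define V where "V = measure lborel K"
  have Ks [measurable]: "K \<in> sets borel" using K by (simp add: compact_imp_closed borel_closed)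
  have V: "emeasure lborel K = ennreal V"
    unfolding V_def using emeasure_compact_finite[OF K(1)] by (intro emeasure_eq_ennreal_measure) auto
  let ?\<sigma> = "sphere_area TYPE('a)"
  define C1 where "C1 = ?\<sigma> * exp (real DIM('a) * M)"
  have C1: "C1 \<ge> 0" using sphere_area_pos[where 'a='a] by (simp add: C1_def)
  define C where "C = C0 * V + C0 * C1"
  have C0: "C0 \<ge> 0" "V \<ge> 0" by (auto simp: C0_def V_def)
  have "(\<integral>\<^sup>+x. ennreal (indicator K x * \<bar>ef b z x\<bar>) \<partial>lborel) \<le>
      ennreal (N * C + N powr (1 - p) * C * (LINT s|lborel. \<bar>z s\<bar> powr p))" if z: "Lp p z" and N: "N > 0" for z N
  proof -
    let ?X = "LINT s|lborel. \<bar>z s\<bar> powr p"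
    have X: "?X \<ge> 0" by simp
    have [measurable]: "z \<in> borel_measurable borel" using z by (simp add: Lp_def)
    have "(\<integral>\<^sup>+x. ennreal (indicator K x * \<bar>ef b z x\<bar>) \<partial>lborel) \<le>
       (\<integral>\<^sup>+x. ennreal (C0 * N) * indicator K x + ennreal (C0 * N powr (1 - p)) *
          (indicator {-M..M} (ln (norm x)) * ennreal (\<bar>z (ln (norm x))\<bar> powr p)) \<partial>lborel)"
    proof (rule nn_integral_mono)
      fix x :: 'a
      show "ennreal (indicator K x * \<bar>ef b z x\<bar>) \<le> ennreal (C0 * N) * indicator K x +
          ennreal (C0 * N powr (1 - p)) * (indicator {-M..M} (ln (norm x)) * ennreal (\<bar>z (ln (norm x))\<bar> powr p))"
      proof (cases "x \<in> K")
        case True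
        then have x: "x \<noteq> 0" "\<bar>ln (norm x)\<bar> \<le> M" using M(2) by auto
        have "(- b) * ln (norm x) \<le> \<bar>b\<bar> * M"
        proof -
          have "(- b) * ln (norm x) \<le> \<bar>b\<bar> * \<bar>ln (norm x)\<bar>" by (metis abs_ge_self abs_minus_cancel abs_mult)
          also have "\<dots> \<le> \<bar>b\<bar> * M" using x by (intro mult_left_mono) auto
          finally show ?thesis .
        qed
        then have pw: "norm x powr (- b) \<le> C0" using x by (simp add: powr_def C0_def)
        have "\<bar>ef b z x\<bar> \<le> C0 * \<bar>z (ln (norm x))\<bar>"
          using x pw by (simp add: ef_def abs_mult mult_right_mono)
        also have "\<dots> \<le> C0 * (N + N powr (1 - p) * \<bar>z (ln (norm x))\<bar> powr p)"
          using C0 le_truncation[OF _ N p, of "\<bar>z (ln (norm x))\<bar>"] by (intro mult_left_mono) auto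
        finally have "\<bar>ef b z x\<bar> \<le> C0 * N + C0 * N powr (1 - p) * \<bar>z (ln (norm x))\<bar> powr p"
          by (simp add: algebra_simps)
        then have "ennreal \<bar>ef b z x\<bar> \<le> ennreal (C0 * N) + ennreal (C0 * N powr (1 - p)) * ennreal (\<bar>z (ln (norm x))\<bar> powr p)"
          using C0 N by (simp add: ennreal_plus[symmetric] ennreal_mult'[symmetric] ennreal_leI del: ennreal_plus)
        then show ?thesis using True x by (auto simp: indicator_def abs_le_iff)
      qed simp
    qed
    also have "\<dots> = ennreal (C0 * N) * ennreal V + ennreal (C0 * N powr (1 - p)) *
        (\<integral>\<^sup>+x. indicator {-M..M} (ln (norm (x::'a))) * ennreal (\<bar>z (ln (norm x))\<bar> powr p) \<partial>lborel)"
      by (subst nn_integral_add) (auto simp: nn_integral_cmult V)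
    also have "(\<integral>\<^sup>+x. indicator {-M..M} (ln (norm (x::'a))) * ennreal (\<bar>z (ln (norm x))\<bar> powr p) \<partial>lborel) \<le> ennreal C1 * ennreal ?X"
    proof -
      have "(\<integral>\<^sup>+x. indicator {-M..M} (ln (norm (x::'a))) * ennreal (\<bar>z (ln (norm x))\<bar> powr p) \<partial>lborel) =
        (\<integral>\<^sup>+s. ennreal (?\<sigma> * exp (real DIM('a) * s)) * (indicator {-M..M} s * ennreal (\<bar>z s\<bar> powr p)) \<partial>lborel)"
        by (rule nn_integral_ln_norm) measurable
      also have "\<dots> \<le> (\<integral>\<^sup>+s. ennreal C1 * ennreal (\<bar>z s\<bar> powr p) \<partial>lborel)"
      proof (rule nn_integral_mono)
        fix s
        have "?\<sigma> * exp (real DIM('a) * s) \<le> C1" if "s \<in> {-M..M}"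
          using that sphere_area_pos[where 'a='a] by (auto simp: C1_def)
        then show "ennreal (?\<sigma> * exp (real DIM('a) * s)) * (indicator {-M..M} s * ennreal (\<bar>z s\<bar> powr p)) \<le> ennreal C1 * ennreal (\<bar>z s\<bar> powr p)"
          by (cases "s \<in> {-M..M}") (auto intro!: mult_right_mono ennreal_leI)
      qed
      also have "\<dots> = ennreal C1 * (\<integral>\<^sup>+s. ennreal (\<bar>z s\<bar> powr p) \<partial>lborel)" by (rule nn_integral_cmult) measurable
      also have "(\<integral>\<^sup>+s. ennreal (\<bar>z s\<bar> powr p) \<partial>lborel) = ennreal ?X"
        using z by (intro nn_integral_eq_integral) (auto simp: Lp_def)
      finally show ?thesis .
    qed
    also have "ennreal (C0 * N) * ennreal V + ennreal (C0 * N powr (1 - p)) * (ennreal C1 * ennreal ?X) =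
        ennreal (C0 * N * V + C0 * N powr (1 - p) * (C1 * ?X))"
      using C0 C1 N X by (simp add: ennreal_plus[symmetric] ennreal_mult'[symmetric] del: ennreal_plus)
    also have "\<dots> \<le> ennreal (N * C + N powr (1 - p) * C * ?X)"
    proof (rule ennreal_leI, rule add_mono)
      have "C0 * V \<le> C" "C0 * C1 \<le> C" using C0 C1 by (auto simp: C_def)
      then show "C0 * N * V \<le> N * C" "C0 * N powr (1 - p) * (C1 * ?X) \<le> N powr (1 - p) * C * ?X"
        using N X mult_left_mono[of "C0 * V" C N] mult_left_mono[of "C0 * C1" C "N powr (1 - p) * ?X"]
        by (auto simp: mult_ac)
    qed
    finally show ?thesis by (simp add: add_left_mono mult_left_mono)
  qed
  moreover have "C \<ge> 0" using C0 C1 by (simp add: C_def)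
  ultimately show thesis using that by blast
qed

lemma ef_locally_integrable:
  assumes z: "Lp p z" and p: "p > 1"
  shows "locally_integrable_punctured (ef b z :: 'a::euclidean_space \<Rightarrow> real)"
  unfolding locally_integrable_punctured_def set_integrable_def
proof (intro allI impI)
  fix K :: "'a set" assume "compact K \<and> 0 \<notin> K"
  then have K: "compact K" "0 \<notin> K" by auto
  have [measurable]: "K \<in> sets borel" "z \<in> borel_measurable borel"
    using K z by (auto simp: compact_imp_closed borel_closed Lp_def)
  obtain C where C: "\<And>z N. Lp p z \<Longrightarrow> N > 0 \<Longrightarrow> (\<integral>\<^sup>+x. ennreal (indicator K x * \<bar>ef b z x\<bar>) \<partial>lborel) \<le>
      ennreal (N * C + N powr (1 - p) * C * (LINT s|lborel. \<bar>z s\<bar> powr p))"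
    by (rule ef_L1_bound[OF K p, of b]) blast
  have "(\<integral>\<^sup>+x. ennreal (norm (indicator K x *\<^sub>R ef b z x)) \<partial>lborel) < \<infinity>"
    using C[OF z, of 1] by (auto simp: abs_mult intro: le_less_trans)
  then show "integrable lborel (\<lambda>x. indicator K x *\<^sub>R ef b z x)"
    by (intro integrableI_bounded) auto
qed

text \<open>The bounded factor m takes up one component of the direction \<open>ef_dir\<close>, so
  one statement covers the function itself, its scalar derivatives and each component of its vector
  derivatives.\<close>

lemma ef_pairing_tendsto:
  fixes \<phi> m :: "'a::euclidean_space \<Rightarrow> real"
  assumes p: "p > 1" and zi: "\<And>i. Lp p (zi i)" and z: "Lp p z"
    and l: "(\<lambda>i. LINT s|lborel. \<bar>zi i s - z s\<bar> powr p) \<longlonglongrightarrow> 0"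
    and m [measurable]: "m \<in> borel_measurable borel" and m1: "\<And>x. \<bar>m x\<bar> \<le> 1"
    and \<phi>: "continuous_on UNIV \<phi>" and K: "compact K" "0 \<notin> K" "vanishes_off K \<phi>"
  shows "(\<lambda>i. LINT x|lborel. ef b (zi i) x * m x * \<phi> x) \<longlonglongrightarrow> (LINT x|lborel. ef b z x * m x * \<phi> x)"
proof -
  obtain C where C: "C \<ge> 0" "\<And>z N. Lp p z \<Longrightarrow> N > 0 \<Longrightarrow> (\<integral>\<^sup>+x. ennreal (indicator K x * \<bar>ef b z x\<bar>) \<partial>lborel) \<le>
      ennreal (N * C + N powr (1 - p) * C * (LINT s|lborel. \<bar>z s\<bar> powr p))"
    by (rule ef_L1_bound[OF K(1,2) p, of b]) blast
  have "bounded (\<phi> ` K)"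
    using K(1) \<phi> by (intro compact_imp_bounded compact_continuous_image) (auto intro: continuous_on_subset)
  then obtain B0 where B0: "\<And>x. x \<in> K \<Longrightarrow> \<bar>\<phi> x\<bar> \<le> B0" unfolding bounded_iff by auto
  define B where "B = \<bar>B0\<bar> + 1"
  have B: "B > 0" "\<bar>\<phi> x\<bar> \<le> B * indicator K x" for x
    using B0[of x] K(3) by (auto simp: B_def vanishes_off_def indicator_def)
  have [measurable]: "\<phi> \<in> borel_measurable borel" using \<phi> by (rule borel_measurable_continuous_onI)
  have int: "integrable lborel (\<lambda>x. ef b y x * m x * \<phi> x)" if y: "Lp p y" for y
  proof (rule Bochner_Integration.integrable_bound)
    have [measurable]: "y \<in> borel_measurable borel" using y by (simp add: Lp_def)
    show "integrable lborel (\<lambda>x. ef b y x * \<phi> x)"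
      by (rule integrable_locally_integrable_mult[OF ef_locally_integrable[OF y p] \<phi> K])
    show "(\<lambda>x. ef b y x * m x * \<phi> x) \<in> borel_measurable lborel" by measurable
    show "AE x in lborel. norm (ef b y x * m x * \<phi> x) \<le> norm (ef b y x * \<phi> x)"
    proof (intro AE_I2)
      fix x
      have "\<bar>m x\<bar> * (\<bar>ef b y x\<bar> * \<bar>\<phi> x\<bar>) \<le> 1 * (\<bar>ef b y x\<bar> * \<bar>\<phi> x\<bar>)"
        by (intro mult_right_mono m1) auto
      then show "norm (ef b y x * m x * \<phi> x) \<le> norm (ef b y x * \<phi> x)" by (simp add: abs_mult mult_ac)
    qed
  qed
  have bound: "\<bar>(LINT x|lborel. ef b (zi i) x * m x * \<phi> x) - (LINT x|lborel. ef b z x * m x * \<phi> x)\<bar> \<le>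
      B * (N * C + N powr (1 - p) * C * (LINT s|lborel. \<bar>zi i s - z s\<bar> powr p))" if N: "N > 0" for i N
  proof -
    let ?y = "\<lambda>s. zi i s - z s"
    have Ly: "Lp p ?y" using p by (intro Lp_diff zi z) auto
    have [measurable]: "?y \<in> borel_measurable borel" using Ly by (simp add: Lp_def)
    have "(LINT x|lborel. ef b (zi i) x * m x * \<phi> x) - (LINT x|lborel. ef b z x * m x * \<phi> x) =
        (LINT x|lborel. ef b ?y x * m x * \<phi> x)"
    proof (subst Bochner_Integration.integral_diff[symmetric, OF int[OF zi] int[OF z]])
      have "ef b (zi i) x * m x * \<phi> x - ef b z x * m x * \<phi> x = ef b ?y x * m x * \<phi> x" for x
        by (simp add: ef_def algebra_simps)
      then show "(LINT x|lborel. ef b (zi i) x * m x * \<phi> x - ef b z x * m x * \<phi> x) = (LINT x|lborel. ef b ?y x * m x * \<phi> x)"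
        by simp
    qed
    also have "\<bar>\<dots>\<bar> \<le> (LINT x|lborel. \<bar>ef b ?y x * m x * \<phi> x\<bar>)" by (rule integral_abs_bound)
    finally have 1: "\<bar>(LINT x|lborel. ef b (zi i) x * m x * \<phi> x) - (LINT x|lborel. ef b z x * m x * \<phi> x)\<bar> \<le>
       (LINT x|lborel. \<bar>ef b ?y x * m x * \<phi> x\<bar>)" .
    have R0: "0 \<le> B * (N * C + N powr (1 - p) * C * (LINT s|lborel. \<bar>?y s\<bar> powr p))"
      using B(1) N C(1) by (intro mult_nonneg_nonneg add_nonneg_nonneg) auto
    have "ennreal (LINT x|lborel. \<bar>ef b ?y x * m x * \<phi> x\<bar>) = (\<integral>\<^sup>+x. ennreal \<bar>ef b ?y x * m x * \<phi> x\<bar> \<partial>lborel)"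
      by (rule nn_integral_eq_integral[symmetric, OF integrable_abs[OF int[OF Ly]]]) simp
    also have "\<dots> \<le> (\<integral>\<^sup>+x. ennreal B * ennreal (indicator K x * \<bar>ef b ?y x\<bar>) \<partial>lborel)"
    proof (rule nn_integral_mono)
      fix x
      have "\<bar>ef b ?y x * m x * \<phi> x\<bar> = \<bar>m x\<bar> * (\<bar>\<phi> x\<bar> * \<bar>ef b ?y x\<bar>)" by (simp add: abs_mult mult_ac)
      also have "\<dots> \<le> 1 * ((B * indicator K x) * \<bar>ef b ?y x\<bar>)"
        using B(1) by (intro mult_mono m1 B(2)) auto
      finally have "\<bar>ef b ?y x * m x * \<phi> x\<bar> \<le> B * (indicator K x * \<bar>ef b ?y x\<bar>)" by simp
      then show "ennreal \<bar>ef b ?y x * m x * \<phi> x\<bar> \<le> ennreal B * ennreal (indicator K x * \<bar>ef b ?y x\<bar>)"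
        using B(1) by (simp add: ennreal_mult'[symmetric] ennreal_leI)
    qed
    also have "\<dots> = ennreal B * (\<integral>\<^sup>+x. ennreal (indicator K x * \<bar>ef b ?y x\<bar>) \<partial>lborel)"
      by (rule nn_integral_cmult) (use K in \<open>auto simp: compact_imp_closed borel_closed\<close>)
    also have "\<dots> \<le> ennreal B * ennreal (N * C + N powr (1 - p) * C * (LINT s|lborel. \<bar>?y s\<bar> powr p))"
      by (intro mult_left_mono C(2)[OF Ly N]) auto
    also have "\<dots> = ennreal (B * (N * C + N powr (1 - p) * C * (LINT s|lborel. \<bar>?y s\<bar> powr p)))"
      using B(1) by (simp add: ennreal_mult')
    finally have "(LINT x|lborel. \<bar>ef b ?y x * m x * \<phi> x\<bar>) \<le> B * (N * C + N powr (1 - p) * C * (LINT s|lborel. \<bar>?y s\<bar> powr p))"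
      using R0 by (subst (asm) ennreal_le_iff) auto
    with 1 show ?thesis by linarith
  qed
  show ?thesis
    unfolding LIMSEQ_def
  proof (intro allI impI)
    fix e :: real assume e: "e > 0"
    \<comment> \<open>Makes the part of the bound that does not depend on i at most e / 2.\<close>
    define N where "N = e / (2 * (B * C + 1))"
    have N: "N > 0" using e B(1) C(1) by (simp add: N_def add_nonneg_pos)
    have "B * (N * C) = e / 2 * (B * C / (B * C + 1))" by (simp add: N_def)
    also have "\<dots> \<le> e / 2 * 1"
      using e B(1) C(1) by (intro mult_left_mono) (auto simp: divide_le_eq_1 intro: add_nonneg_pos)
    finally have BN: "B * (N * C) \<le> e / 2" by simp
    have "(\<lambda>i. B * (N powr (1 - p) * C) * (LINT s|lborel. \<bar>zi i s - z s\<bar> powr p)) \<longlonglongrightarrow> B * (N powr (1 - p) * C) * 0"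
      by (intro tendsto_mult_left l)
    then have "\<forall>\<^sub>F i in sequentially. B * (N powr (1 - p) * C) * (LINT s|lborel. \<bar>zi i s - z s\<bar> powr p) < e / 2"
      using e by (intro order_tendstoD) auto
    then obtain n where n: "\<And>i. i \<ge> n \<Longrightarrow> B * (N powr (1 - p) * C) * (LINT s|lborel. \<bar>zi i s - z s\<bar> powr p) < e / 2"
      by (auto simp: eventually_sequentially)
    have "dist (LINT x|lborel. ef b (zi i) x * m x * \<phi> x) (LINT x|lborel. ef b z x * m x * \<phi> x) < e" if "i \<ge> n" for i
    proof -
      have "B * (N * C + N powr (1 - p) * C * (LINT s|lborel. \<bar>zi i s - z s\<bar> powr p)) =
         B * (N * C) + B * (N powr (1 - p) * C) * (LINT s|lborel. \<bar>zi i s - z s\<bar> powr p)"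
        by (simp add: distrib_left mult.assoc)
      with bound[OF N, of i] n[OF that] BN show ?thesis unfolding dist_real_def by linarith
    qed
    then show "\<exists>n. \<forall>i\<ge>n. dist (LINT x|lborel. ef b (zi i) x * m x * \<phi> x) (LINT x|lborel. ef b z x * m x * \<phi> x) < e" by blast
  qed
qed

text \<open>For each v i integration by parts holds classically. Both of its sides converge, one by
  convergence of the profiles and the other by convergence of the l-th links, so the limit z yields
  the weak derivative although it need not be a classical derivative of anything.\<close>

lemma has_weak_nabla_limit:
  fixes u :: "'a::euclidean_space \<Rightarrow> real" and v :: "nat \<Rightarrow> 'a \<Rightarrow> real"
  assumes p: "p > 1" and v: "\<And>i. v i \<in> Ckcr k" and l: "l \<le> k"
    and w: "Lp p w" "(\<lambda>i. LINT s|lborel. \<bar>ef_profile a (v i) s - w s\<bar> powr p) \<longlonglongrightarrow> 0"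
    and z: "Lp p z" "(\<lambda>i. LINT s|lborel. \<bar>ef_chain DIM('a) a l (ef_profile a (v i)) s - z s\<bar> powr p) \<longlonglongrightarrow> 0"
    and um: "u \<in> borel_measurable borel" and u: "\<And>x. x \<noteq> 0 \<Longrightarrow> u x = ef a w x"
  shows "has_weak_nabla l u (\<lambda>x. ef (a + real l) z x *\<^sub>R ef_dir l x)"
proof -
  have vk: "Ck k (v i)" "radial (v i)" "v i \<in> Ckc k" for i using v by (auto simp: Ckcr_def Ckc_iff)
  let ?Z = "\<lambda>i. ef_chain DIM('a) a l (ef_profile a (v i))"
  have LZ: "Lp p (ef_chain DIM('a) a l' (ef_profile a (v i)))" if "l' \<le> k" for i l'
  proof -
    have "admissible DIM('a) a k (ef_profile a (v i))" by (rule admissible_profile[OF v])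
    then show ?thesis using that p unfolding admissible_def by (metis Lp_cont_cs zero_less_one less_trans)
  qed
  have Lw: "Lp p (ef_profile a (v i))" for i using LZ[of 0 i] by simp
  have ne: "AE x in lborel. x \<noteq> (0::'a)" by (rule AE_lborel_singleton)
  have um' [measurable]: "u \<in> borel_measurable borel" by (rule um)
  have wm [measurable]: "w \<in> borel_measurable borel" "z \<in> borel_measurable borel" using w z by (auto simp: Lp_def)
  have lu: "locally_integrable_punctured u"
    unfolding locally_integrable_punctured_def set_integrable_def
  proof (intro allI impI)
    fix K :: "'a set" assume K: "compact K \<and> 0 \<notin> K"
    have "integrable lborel (\<lambda>x. indicator K x *\<^sub>R ef a w x)"
      using ef_locally_integrable[OF w(1) p, of a] K by (auto simp: locally_integrable_punctured_def set_integrable_def)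
    moreover have "indicator K x *\<^sub>R ef a w x = indicator K x *\<^sub>R u x" for x
      using u[of x] K by (cases "x = 0") (auto simp: indicator_def)
    ultimately show "integrable lborel (\<lambda>x. indicator K x *\<^sub>R u x)" by (simp only:)
  qed
  let ?G = "\<lambda>x. ef (a + real l) z x *\<^sub>R ef_dir l x :: real \<times> 'a"
  have lG: "locally_integrable_punctured ?G"
    unfolding locally_integrable_punctured_def set_integrable_def
  proof (intro allI impI)
    fix K :: "'a set" assume K: "compact K \<and> 0 \<notin> K"
    then have [measurable]: "K \<in> sets borel" by (auto simp: compact_imp_closed borel_closed)
    have i: "integrable lborel (\<lambda>x. indicator K x *\<^sub>R ef (a + real l) z x)"
      using ef_locally_integrable[OF z(1) p, of "a + real l"] K by (auto simp: locally_integrable_punctured_def set_integrable_def)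
    show "integrable lborel (\<lambda>x. indicator K x *\<^sub>R ?G x)"
    proof (rule Bochner_Integration.integrable_bound[OF i])
      show "(\<lambda>x. indicator K x *\<^sub>R ?G x) \<in> borel_measurable lborel" by measurable
      show "AE x in lborel. norm (indicator K x *\<^sub>R ?G x) \<le> norm (indicator K x *\<^sub>R ef (a + real l) z x)"
        using ne by eventually_elim (simp add: norm_ef_dir)
    qed
  qed
  have u_lim: "(\<lambda>i. LINT x|lborel. v i x * \<phi> x) \<longlonglongrightarrow> (LINT x|lborel. u x * \<phi> x)"
    if \<phi>: "continuous_on UNIV \<phi>" and K: "compact K" "0 \<notin> K" "vanishes_off K \<phi>" for \<phi> :: "'a \<Rightarrow> real" and K
  proof -
    have [measurable]: "\<phi> \<in> borel_measurable borel" using \<phi> by (rule borel_measurable_continuous_onI)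
    have "v i x * \<phi> x = ef a (ef_profile a (v i)) x * 1 * \<phi> x" for i x
      using radial_eq_ef[OF vk(2), of x i a] K by (cases "x = 0") (auto simp: vanishes_off_def)
    moreover have "u x * \<phi> x = ef a w x * 1 * \<phi> x" for x
      using u[of x] K by (cases "x = 0") (auto simp: vanishes_off_def)
    moreover have "(\<lambda>i. LINT x|lborel. ef a (ef_profile a (v i)) x * 1 * \<phi> x) \<longlonglongrightarrow>
        (LINT x|lborel. ef a w x * 1 * \<phi> x)"
      by (rule ef_pairing_tendsto[OF p Lw w _ _ \<phi> K]) auto
    ultimately show ?thesis by (simp only:)
  qed
  have Z_lim: "(\<lambda>i. LINT x|lborel. T (nabla l (v i) x) * \<phi> x) \<longlonglongrightarrow> (LINT x|lborel. T (?G x) * \<phi> x)"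
    if \<phi>: "continuous_on UNIV \<phi>" and K: "compact K" "0 \<notin> K" "vanishes_off K \<phi>" and T: "bounded_linear T"
      and T1: "\<And>y. \<bar>T y\<bar> \<le> norm y" for \<phi> :: "'a \<Rightarrow> real" and K and T :: "real \<times> 'a \<Rightarrow> real"
  proof -
    have Tm [measurable]: "T \<in> borel_measurable borel"
      using linear_continuous_on[OF T] by (rule borel_measurable_continuous_onI)
    have Ts: "T (c *\<^sub>R y) = c * T y" for c y using linear_cmul[OF bounded_linear.linear[OF T]] by simp
    define m where "m x = (if x = 0 then 0 else T (ef_dir l x))" for x :: 'a
    have mm: "m \<in> borel_measurable borel" unfolding m_def[abs_def] by measurable
    have m1: "\<bar>m x\<bar> \<le> 1" for x using T1[of "ef_dir l x"] norm_ef_dir[of x l] by (auto simp: m_def)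
    have "T (nabla l (v i) x) * \<phi> x = ef (a + real l) (?Z i) x * m x * \<phi> x" for i x
      using nabla_ef_chain[OF vk(1)[of i] vk(2)[of i] l, of x a] K by (cases "x = 0") (auto simp: vanishes_off_def Ts m_def ef_def)
    moreover have "T (?G x) * \<phi> x = ef (a + real l) z x * m x * \<phi> x" for x
      using K by (cases "x = 0") (auto simp: vanishes_off_def Ts m_def)
    ultimately show ?thesis
      using ef_pairing_tendsto[OF p LZ[OF l] z mm m1 \<phi> K, of "a + real l"] by (simp only:)
  qed
  define M where "M = l div 2"
  have wn: "has_weak_nabla l (v i) (nabla l (v i))" for i by (rule has_weak_nabla_nabla[OF vk(3) l])
  show ?thesis
  proof (cases "even l")
    case True
    have "(LINT x|lborel. u x * (laplacian ^^ M) \<phi> x) = (LINT x|lborel. fst (?G x) * \<phi> x)"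
      if \<phi>: "\<phi> \<in> test_functions" for \<phi>
    proof (rule LIMSEQ_unique)
      obtain K where K: "compact K" "0 \<notin> K" "vanishes_off K \<phi>" and s: "\<And>k. Ck k \<phi>"
        using \<phi> unfolding test_function_iff by blast
      show "(\<lambda>i. LINT x|lborel. v i x * (laplacian ^^ M) \<phi> x) \<longlonglongrightarrow> (LINT x|lborel. u x * (laplacian ^^ M) \<phi> x)"
        using K by (intro u_lim[of _ K] Ck_imp_continuous[of 0] Ck_laplacian_iter s vanishes_off_laplacian_iter)
          (auto simp: compact_imp_closed)
      have "(LINT x|lborel. v i x * (laplacian ^^ M) \<phi> x) = (LINT x|lborel. fst (nabla l (v i) x) * \<phi> x)" for i
        using wn[of i] True \<phi> by (simp add: has_weak_nabla_def M_def)
      moreover have "(\<lambda>i. LINT x|lborel. fst (nabla l (v i) x) * \<phi> x) \<longlonglongrightarrow> (LINT x|lborel. fst (?G x) * \<phi> x)"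
      proof (rule Z_lim[OF _ K bounded_linear_fst])
        show "continuous_on UNIV \<phi>" using s[of 0] by simp
        show "\<bar>fst y\<bar> \<le> norm y" for y :: "real \<times> 'a" using norm_fst_le[of "fst y" "snd y"] by simp
      qed
      ultimately show "(\<lambda>i. LINT x|lborel. v i x * (laplacian ^^ M) \<phi> x) \<longlonglongrightarrow> (LINT x|lborel. fst (?G x) * \<phi> x)" by simp
    qed
    with lu lG True show ?thesis by (simp add: has_weak_nabla_def M_def ef_dir_def)
  next
    case False
    have "(LINT x|lborel. u x * (laplacian ^^ M) (partial b \<phi>) x) = - (LINT x|lborel. (snd (?G x) \<bullet> b) * \<phi> x)"
      if b: "b \<in> Basis" and \<phi>: "\<phi> \<in> test_functions" for b \<phi>
    proof (rule LIMSEQ_unique)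
      obtain K where K: "compact K" "0 \<notin> K" "vanishes_off K \<phi>" and s: "\<And>k. Ck k \<phi>"
        using \<phi> unfolding test_function_iff by blast
      show "(\<lambda>i. LINT x|lborel. v i x * (laplacian ^^ M) (partial b \<phi>) x) \<longlonglongrightarrow>
          (LINT x|lborel. u x * (laplacian ^^ M) (partial b \<phi>) x)"
        using K by (intro u_lim[of _ K] Ck_imp_continuous[of 0] Ck_laplacian_iter Ck_partial[OF s b]
          vanishes_off_laplacian_iter vanishes_off_partial) (auto simp: compact_imp_closed)
      have "(LINT x|lborel. v i x * (laplacian ^^ M) (partial b \<phi>) x) = - (LINT x|lborel. (snd (nabla l (v i) x) \<bullet> b) * \<phi> x)" for i
        using wn[of i] False \<phi> b by (simp add: has_weak_nabla_def M_def)
      moreover have "(\<lambda>i. LINT x|lborel. (snd (nabla l (v i) x) \<bullet> b) * \<phi> x) \<longlonglongrightarrow> (LINT x|lborel. (snd (?G x) \<bullet> b) * \<phi> x)"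
      proof (rule Z_lim[OF _ K])
        show "continuous_on UNIV \<phi>" using s[of 0] by simp
        show "bounded_linear (\<lambda>y::real \<times> 'a. snd y \<bullet> b)"
          by (intro bounded_linear_compose[OF bounded_linear_inner_left bounded_linear_snd])
        show "\<bar>snd y \<bullet> b\<bar> \<le> norm y" for y :: "real \<times> 'a"
          using norm_snd_le[of "snd y" "fst y"] Basis_le_norm[OF b, of "snd y"] by simp
      qed
      ultimately show "(\<lambda>i. LINT x|lborel. v i x * (laplacian ^^ M) (partial b \<phi>) x) \<longlonglongrightarrow> - (LINT x|lborel. (snd (?G x) \<bullet> b) * \<phi> x)"
        by (simp add: tendsto_minus)
    qed
    with lu lG False show ?thesis by (simp add: has_weak_nabla_def M_def ef_dir_def)
  qed
qed

text \<open>The compact annuli exhaust the punctured space. This gives measurability of the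
  derivative picked by \<open>weak_nabla\<close>, about which only the defining property is
  known.\<close>

lemma locally_integrable_measurable:
  fixes G :: "'a::euclidean_space \<Rightarrow> 'b::{banach, second_countable_topology}"
  assumes "locally_integrable_punctured G"
  shows "G \<in> borel_measurable borel"
proof -
  define K :: "nat \<Rightarrow> 'a set" where "K n = cball 0 (real n) - ball 0 (1 / (real n + 1))" for n
  have K: "compact (K n)" "0 \<notin> K n" for n unfolding K_def by (auto intro: compact_diff)
  have m: "(\<lambda>x. indicator (K n) x *\<^sub>R G x) \<in> borel_measurable borel" for n
    using assms K[of n] by (auto simp: locally_integrable_punctured_def set_integrable_def)
  have "(\<lambda>n. indicator (K n) x *\<^sub>R G x) \<longlonglongrightarrow> indicator (- {0}) x *\<^sub>R G x" for x
  proof (cases "x = 0")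
    case False
    obtain n1 :: nat where n1: "norm x \<le> real n1" using real_arch_simple by blast
    obtain n2 :: nat where n2: "1 / norm x \<le> real n2" using real_arch_simple by blast
    show ?thesis
    proof (rule tendsto_eventually)
      show "\<forall>\<^sub>F n in sequentially. indicator (K n) x *\<^sub>R G x = indicator (- {0}) x *\<^sub>R G x"
        using eventually_ge_at_top[of "max n1 n2"]
      proof eventually_elim
        case (elim n)
        have "norm x \<le> real n" using n1 elim by auto
        moreover have "1 / norm x \<le> real n + 1" using n2 elim by auto
        then have "1 / (real n + 1) \<le> norm x" using False by (simp add: field_simps)
        ultimately show ?case using False by (simp add: K_def)
      qed
    qed
  qed (simp add: K_def)
  then have m0: "(\<lambda>x. indicator (- {0}) x *\<^sub>R G x) \<in> borel_measurable borel"
    by (rule borel_measurable_LIMSEQ_metric[OF m])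
  have "G = (\<lambda>x. if x = 0 then G 0 else indicator (- {0}) x *\<^sub>R G x)" by (auto simp: fun_eq_iff)
  also have "\<dots> \<in> borel_measurable borel" using m0 by measurable
  finally show ?thesis .
qed

lemma weighted_int_weak_nabla:
  fixes u :: "'a::euclidean_space \<Rightarrow> real"
  assumes G: "has_weak_nabla l u G"
  shows "weighted_int c r (weak_nabla l u) = weighted_int c r G"
proof -
  have W: "has_weak_nabla l u (weak_nabla l u)" unfolding weak_nabla_def using G by (rule someI[where P="has_weak_nabla l u"])
  have [measurable]: "weak_nabla l u \<in> borel_measurable borel" "G \<in> borel_measurable borel"
    using W G by (auto simp: has_weak_nabla_def intro: locally_integrable_measurable)
  have "AE x in lborel. weak_nabla l u x = G x" by (rule has_weak_nabla_unique[OF W G])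
  then show ?thesis
    unfolding weighted_int_def by (intro integral_cong_AE) (auto elim!: eventually_mono)
qed

section \<open>The minimisation problem\<close>

lemma ops_vanishes:
  "f \<in> smooth_cs \<Longrightarrow> (\<And>s. \<bar>s\<bar> > N \<Longrightarrow> f s = 0) \<Longrightarrow> \<bar>s\<bar> > N \<Longrightarrow> ops \<Lambda> f s = 0"
proof (induction \<Lambda> arbitrary: f s)
  case (Cons \<mu> \<Lambda>)
  have "deriv f s = 0" if "\<bar>s\<bar> > N" for s
  proof (rule DERIV_imp_deriv)
    have "((\<lambda>_. 0) has_real_derivative 0) (at s)" by simp
    then show "(f has_real_derivative 0) (at s)"
      by (rule has_field_derivative_transform_within_open[where S="- {-N..N}"])
        (use that Cons.prems(2) in \<open>auto simp: abs_less_iff\<close>)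
  qed
  then have "deriv f s - \<mu> * f s = 0" if "\<bar>s\<bar> > N" for s using that Cons.prems(2) by simp
  then show ?case using Cons.IH[OF smooth_cs_step[OF Cons.prems(1)]] Cons.prems(3) by simp
qed simp

lemma Ckc_diff:
  assumes "u \<in> Ckc k" "v \<in> Ckc k"
  shows "(\<lambda>x. u x - v x) \<in> Ckc k"
proof -
  obtain K L where K: "compact K" "0 \<notin> K" "vanishes_off K u" and L: "compact L" "0 \<notin> L" "vanishes_off L v"
    using assms unfolding Ckc_iff by blast
  have "vanishes_off (K \<union> L) (\<lambda>x. u x - v x)" using K L by (auto simp: vanishes_off_def)
  moreover have "compact (K \<union> L)" "0 \<notin> K \<union> L" using K L by auto
  ultimately show ?thesis using assms Ck_diff unfolding Ckc_iff by blast
qed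

lemma Ckcr_diff: "u \<in> Ckcr k \<Longrightarrow> v \<in> Ckcr k \<Longrightarrow> (\<lambda>x. u x - v x) \<in> Ckcr k"
  unfolding Ckcr_def using Ckc_diff by (auto simp: radial_def)

lemma ef_profile_diff: "ef_profile a (\<lambda>x. u x - v x) = (\<lambda>s. ef_profile a u s - ef_profile a v s)"
  by (auto simp: ef_profile_def algebra_simps)

lemma ef_profile_measurable:
  assumes "u \<in> borel_measurable borel"
  shows "ef_profile a u \<in> borel_measurable borel"
  unfolding ef_profile_def[abs_def]
  by (intro borel_measurable_times measurable_compose[OF _ assms] borel_measurable_continuous_onI continuous_intros)

lemma admissible_diff_chain:
  assumes "admissible n a k w" "admissible n a k w'" "l \<le> k"
  shows "ef_chain n a l (\<lambda>s. w s - w' s) = (\<lambda>s. ef_chain n a l w s - ef_chain n a l w' s)"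
  using assms by (intro ef_chain_diff[of k]) (auto simp: admissible_def)

lemma admissible_Lp: "p > 0 \<Longrightarrow> admissible n a k w \<Longrightarrow> l \<le> k \<Longrightarrow> Lp p (ef_chain n a l w)"
  unfolding admissible_def by (metis Lp_cont_cs)

section \<open>Transfer between the punctured space and the line\<close>

locale radial_setting =
  fixes T :: "'a::euclidean_space itself" and k :: nat and \<alpha> p a :: real
  assumes p: "1 < p" and a_def: "a = (real DIM('a) + \<alpha>) / p - real k" and pos: "best_constant TYPE('a) \<alpha> k p > 0"
begin

lemma p0: "p > 0" using p by simp

lemma pa: "p * a = real DIM('a) + \<alpha> - real k * p"
  using p by (simp add: a_def field_simps)

lemma inequality:
  obtains c where "c > 0" "\<And>u :: 'a \<Rightarrow> real. u \<in> Ckcr k \<Longrightarrow>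
    c * weighted_int (\<alpha> - real k * p) p u \<le> weighted_int \<alpha> p (nabla k u)"
proof -
  let ?S = "{c. 0 \<le> c \<and> (\<forall>u \<in> (Ckcr k :: ('a \<Rightarrow> real) set).
                c * weighted_int (\<alpha> - real k * p) p u \<le> weighted_int \<alpha> p (nabla k u))}"
  have "\<exists>c\<in>?S. c > 0"
  proof (rule ccontr)
    assume "\<not> (\<exists>c\<in>?S. c > 0)"
    then have "?S \<subseteq> {0}" by (force simp: not_less)
    moreover have "0 \<in> ?S" by (auto simp: weighted_int_def intro!: integral_nonneg_AE)
    ultimately have "?S = {0}" by blast
    then have "best_constant TYPE('a) \<alpha> k p = 0" unfolding best_constant_def by simp
    with pos show False by simp
  qed
  then show thesis using that by blast
qed

lemma weighted_int_ef:
  fixes G :: "'a \<Rightarrow> 'b::{real_normed_vector,second_countable_topology}"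
  assumes "z \<in> borel_measurable borel" "G \<in> borel_measurable borel"
    and "\<And>x. x \<noteq> 0 \<Longrightarrow> norm (G x) = \<bar>ef (a + real l) z x\<bar>" and "c + real DIM('a) = (a + real l) * r"
  shows "weighted_int c r G = sphere_area TYPE('a) * (LINT s|lborel. \<bar>z s\<bar> powr r)"
    and "integrable lborel (\<lambda>x. norm x powr c * norm (G x) powr r) \<longleftrightarrow> integrable lborel (\<lambda>s. \<bar>z s\<bar> powr r)"
proof -
  have "AE x in lborel. norm (G x) = norm x powr - (a + real l) * \<bar>z (ln (norm x))\<bar>"
    using AE_lborel_singleton[of "0::'a"]
    by eventually_elim (simp add: assms(3) ef_def abs_mult)
  note * = weighted_int_radial[OF assms(1,2) this assms(4)]
  show "weighted_int c r G = sphere_area TYPE('a) * (LINT s|lborel. \<bar>z s\<bar> powr r)"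
    "integrable lborel (\<lambda>x. norm x powr c * norm (G x) powr r) \<longleftrightarrow> integrable lborel (\<lambda>s. \<bar>z s\<bar> powr r)"
    using * by auto
qed

lemma weight0: "\<alpha> - real k * p + real DIM('a) = (a + real 0) * p"
  using pa by (simp add: mult.commute)

lemma weightk: "\<alpha> + real DIM('a) = (a + real k) * p"
  using pa by (simp add: algebra_simps)

lemma weighted_int_nabla:
  fixes v :: "'a \<Rightarrow> real"
  assumes "v \<in> Ckcr k"
  shows "weighted_int \<alpha> p (nabla k v) = sphere_area TYPE('a) * (LINT s|lborel. \<bar>ef_chain DIM('a) a k (ef_profile a v) s\<bar> powr p)"
proof (rule weighted_int_ef(1)[OF _ _ _ weightk])
  have v: "Ck k v" "radial v" using assms by (auto simp: Ckcr_def Ckc_iff)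
  show "ef_chain DIM('a) a k (ef_profile a v) \<in> borel_measurable borel"
    by (rule borel_measurable_continuous_onI[OF ef_chain_continuous[OF v]]) simp
  show "nabla k v \<in> borel_measurable borel"
    by (rule borel_measurable_continuous_onI[OF continuous_nabla[OF v(1)]]) simp
  show "norm (nabla k v x) = \<bar>ef (a + real k) (ef_chain DIM('a) a k (ef_profile a v)) x\<bar>" if "x \<noteq> 0" for x
    using nabla_ef_chain[OF v _ that, of k a] that by (simp add: norm_ef_dir ef_def)
qed

lemma weighted_int_0:
  fixes u :: "'a \<Rightarrow> real"
  assumes "u \<in> borel_measurable borel" "w \<in> borel_measurable borel" "\<And>x. x \<noteq> 0 \<Longrightarrow> u x = ef a w x"
  shows "weighted_int (\<alpha> - real k * p) p u = sphere_area TYPE('a) * (LINT s|lborel. \<bar>w s\<bar> powr p)"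
    and "integrable lborel (\<lambda>x. norm x powr (\<alpha> - real k * p) * norm (u x) powr p) \<longleftrightarrow> integrable lborel (\<lambda>s. \<bar>w s\<bar> powr p)"
  by (intro weighted_int_ef[where l=0, OF assms(2,1) _ weight0], simp add: assms(3))+

lemma Ckcr_measurable: "v \<in> Ckcr k \<Longrightarrow> v \<in> borel_measurable (borel :: 'a measure)"
  by (auto simp: Ckcr_def Ckc_iff intro: borel_measurable_continuous_onI Ck_imp_continuous)

text \<open>If a root vanishes, the dilations \<open>\<psi>(s / R)\<close> violate the weighted inequality as \<open>R \<rightarrow> \<infinity>\<close>.\<close>

lemma root_nonzero:
  assumes l: "l < k"
  shows "ef_root DIM('a) a l \<noteq> 0"
proof
  assume z: "ef_root DIM('a) a l = 0"
  obtain c where c: "c > 0" "\<And>u :: 'a \<Rightarrow> real. u \<in> Ckcr k \<Longrightarrow>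
    c * weighted_int (\<alpha> - real k * p) p u \<le> weighted_int \<alpha> p (nabla k u)"
    by (rule inequality) blast
  obtain \<psi> where \<psi>: "\<psi> \<in> smooth_cs" "\<And>s. 0 \<le> \<psi> s" "\<And>s. \<bar>s\<bar> < 1 \<Longrightarrow> 0 < \<psi> s"
    using ex_bump by blast
  obtain M0 where M0: "\<And>s. \<bar>s\<bar> > M0 \<Longrightarrow> \<psi> s = 0" using \<psi>(1) by (auto simp: smooth_cs_def)
  define M where "M = \<bar>M0\<bar> + 1"
  have M: "M > 0" "\<And>s. \<bar>s\<bar> > M \<Longrightarrow> \<psi> s = 0" using M0 by (auto simp: M_def)
  define \<Lambda> where "\<Lambda> = map (ef_root DIM('a) a) [0..<k]"
  have "0 \<in> set \<Lambda>" using z l by (force simp: \<Lambda>_def image_iff)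
  with ops_dilation_bound[OF \<psi>(1), of \<Lambda>] obtain D where D: "D \<ge> 0"
    "\<And>R s. R \<ge> 1 \<Longrightarrow> \<bar>ops \<Lambda> (\<lambda>s. \<psi> (1 / R * s + 0)) s\<bar> \<le> D / R" by blast
  define I where "I = (LINT s|lborel. \<bar>\<psi> s\<bar> powr p)"
  have I: "I > 0" unfolding I_def
  proof (rule integral_pos_of_pos_near_0)
    show "integrable lborel (\<lambda>s. \<bar>\<psi> s\<bar> powr p)" using Lp_smooth_cs[OF p0 \<psi>(1)] by (simp add: Lp_def)
    show "0 < \<bar>\<psi> s\<bar> powr p" if "\<bar>s\<bar> < 1" for s using \<psi>(3)[OF that] by simp
  qed simp
  \<comment> \<open>The p-th power integral of the dilated profile is R * I. Applying the operators
    gives a function bounded by D / R on an interval of length 2 M R. After division by R the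
    right-hand side keeps the factor R^(-p), which tends to 0.\<close>
  have key: "c * I \<le> 2 * M * D powr p * R powr (- p)" if R: "R \<ge> 1" for R
  proof -
    define w where "w = (\<lambda>s. \<psi> (1 / R * s + 0))"
    have w: "w \<in> smooth_cs" unfolding w_def using R by (intro smooth_cs_shift \<psi>(1)) auto
    let ?u = "ef a w :: 'a \<Rightarrow> real"
    have u: "?u \<in> Ckcr k" by (rule ef_in_Ckcr[OF w])
    have wz: "w s = 0" if "\<bar>s\<bar> > M * R" for s
      unfolding w_def using that R M(1) by (intro M(2)) (auto simp: field_simps abs_mult)
    have "weighted_int (\<alpha> - real k * p) p ?u = sphere_area TYPE('a) * (LINT s|lborel. \<bar>w s\<bar> powr p)"
      using smooth_csD(3)[OF w] by (intro weighted_int_0 Ckcr_measurable u borel_measurable_continuous_onI) auto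
    also have "(LINT s|lborel. \<bar>w s\<bar> powr p) = R * I"
      using lborel_integral_real_affine[of "1 / R" "\<lambda>s. \<bar>\<psi> s\<bar> powr p" 0] R
      by (simp add: w_def I_def)
    finally have 1: "weighted_int (\<alpha> - real k * p) p ?u = sphere_area TYPE('a) * (R * I)" .
    have ch: "ef_chain DIM('a) a k w = ops \<Lambda> w" by (simp add: \<Lambda>_def ops_ef_chain)
    have W: "weighted_int \<alpha> p (nabla k ?u) = sphere_area TYPE('a) * (LINT s|lborel. \<bar>ops \<Lambda> w s\<bar> powr p)"
      using weighted_int_nabla[OF u] by (simp add: ef_profile_ef ch)
    have le:  "(LINT s|lborel. \<bar>ops \<Lambda> w s\<bar> powr p) \<le> (LINT s|lborel. (D / R) powr p * indicator {- (M * R)..M * R} s)"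
    proof (rule integral_mono)
      show "integrable lborel (\<lambda>s. \<bar>ops \<Lambda> w s\<bar> powr p)"
        using Lp_smooth_cs[OF p0 ops_smooth_cs[OF w]] by (simp add: Lp_def)
      show "integrable lborel (\<lambda>s. (D / R) powr p * indicator {- (M * R)..M * R} s)"
        using emeasure_compact_finite[of "{- (M * R)..M * R}"] by (intro integrable_mult_right integrable_real_indicator) auto
      show "\<bar>ops \<Lambda> w s\<bar> powr p \<le> (D / R) powr p * indicator {- (M * R)..M * R} s" for s
      proof (cases "s \<in> {- (M * R)..M * R}")
        case True
        then show ?thesis using D(2)[OF R, of s] p0 by (auto simp: w_def intro!: powr_mono2)
      next
        case False
        then have "\<bar>s\<bar> > M * R" by auto
        then show ?thesis using ops_vanishes[OF w wz, where \<Lambda>=\<Lambda> and s=s] p0 False by simp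
      qed
    qed
    have "c * (sphere_area TYPE('a) * (R * I)) \<le> sphere_area TYPE('a) * (LINT s|lborel. \<bar>ops \<Lambda> w s\<bar> powr p)"
      using c(2)[OF u] unfolding 1 W .
    also have "\<dots> \<le> sphere_area TYPE('a) * (LINT s|lborel. (D / R) powr p * indicator {- (M * R)..M * R} s)"
      using le sphere_area_pos[where 'a='a] by (intro mult_left_mono) auto
    also have "(LINT s|lborel. (D / R) powr p * indicator {- (M * R)..M * R} s) = (D / R) powr p * (2 * M * R)"
      using M(1) R by simp
    finally have "c * (sphere_area TYPE('a) * (R * I)) \<le> sphere_area TYPE('a) * ((D / R) powr p * (2 * M * R))" .
    then have "sphere_area TYPE('a) * R * (c * I) \<le> sphere_area TYPE('a) * R * ((D / R) powr p * (2 * M))" by (simp add: mult_ac)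
    then have "c * I \<le> (D / R) powr p * (2 * M)"
      using sphere_area_pos[where 'a='a] R by (subst (asm) mult_le_cancel_left_pos) auto
    also have "(D / R) powr p = D powr p * R powr (- p)"
      using D(1) R by (simp add: powr_divide powr_minus field_simps)
    finally show ?thesis by (simp add: mult_ac)
  qed
  have "((\<lambda>R. 2 * M * D powr p * R powr (- p)) \<longlongrightarrow> 2 * M * D powr p * 0) at_top"
    using p0 by (intro tendsto_mult_left tendsto_neg_powr filterlim_ident) auto
  then have "\<forall>\<^sub>F R in at_top. 2 * M * D powr p * R powr (- p) < c * I"
    using c(1) I by (intro order_tendstoD) auto
  then have "\<forall>\<^sub>F R in at_top. (2 * M * D powr p * R powr (- p) < c * I) \<and> R \<ge> (1::real)"
    using eventually_ge_at_top[of 1] by eventually_elim simp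
  then obtain R :: real where "2 * M * D powr p * R powr (- p) < c * I" "R \<ge> 1"
    by (auto dest: eventually_happens)
  with key[of R] show False by simp
qed

text \<open>An element u of the completion with an approximating sequence v, its profile w and the
  L^p limit z of the k-th links. Here z stands for P_k(D) w, which need not exist
  classically.\<close>

definition limit_data :: "('a \<Rightarrow> real) \<Rightarrow> (nat \<Rightarrow> 'a \<Rightarrow> real) \<Rightarrow> (real \<Rightarrow> real) \<Rightarrow> (real \<Rightarrow> real) \<Rightarrow> bool" where
  "limit_data u v w z \<longleftrightarrow> (\<forall>i. v i \<in> Ckcr k) \<and> u \<in> borel_measurable borel \<and> (\<forall>x. x \<noteq> 0 \<longrightarrow> u x = ef a w x) \<and>
    Lp p w \<and> (\<lambda>i. LINT s|lborel. \<bar>ef_profile a (v i) s - w s\<bar> powr p) \<longlonglongrightarrow> 0 \<and>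
    Lp p z \<and> (\<lambda>i. LINT s|lborel. \<bar>ef_chain DIM('a) a k (ef_profile a (v i)) s - z s\<bar> powr p) \<longlonglongrightarrow> 0"

text \<open>Up to the constant area of the sphere, the Sobolev distance of the v i is the L^p
  distance of their k-th links, so completeness of L^p on the line supplies z.\<close>

lemma D_space_limit_data:
  assumes u: "u \<in> (D_space \<alpha> k p :: ('a \<Rightarrow> real) set)"
  obtains v w z where "limit_data u v w z"
proof -
  obtain v where v: "\<And>i::nat. v i \<in> Ckcr k"
    and C: "\<And>e. e > 0 \<Longrightarrow> \<exists>N. \<forall>i\<ge>N. \<forall>l\<ge>N. sobolev_norm \<alpha> k p (\<lambda>x. v i x - v l x) < e"
    and L: "(\<lambda>i. weighted_int (\<alpha> - real k * p) p (\<lambda>x. v i x - u x)) \<longlonglongrightarrow> 0"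
    and um: "u \<in> borel_measurable borel"
    and ui: "integrable lborel (\<lambda>x. norm x powr (\<alpha> - real k * p) * norm (u x) powr p)"
    and ur: "radial u"
    using u by (auto simp: D_space_def weighted_Lp_def)
  define w where "w = ef_profile a u"
  have wm: "w \<in> borel_measurable borel" unfolding w_def by (rule ef_profile_measurable[OF um])
  have ue: "u x = ef a w x" if "x \<noteq> 0" for x unfolding w_def by (rule radial_eq_ef[OF ur that])
  have Lw: "Lp p w" using weighted_int_0(2)[OF um wm ue] ui wm by (simp add: Lp_def)
  have adm: "admissible DIM('a) a k (ef_profile a (v i))" for i by (rule admissible_profile[OF v])
  have "weighted_int (\<alpha> - real k * p) p (\<lambda>x. v i x - u x) =
      sphere_area TYPE('a) * (LINT s|lborel. \<bar>ef_profile a (v i) s - w s\<bar> powr p)" for i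
  proof (rule weighted_int_0)
    have vm: "v i \<in> borel_measurable borel" by (rule Ckcr_measurable[OF v])
    show "(\<lambda>x. v i x - u x) \<in> borel_measurable borel" using vm um by measurable
    show "(\<lambda>s. ef_profile a (v i) s - w s) \<in> borel_measurable borel"
      using ef_profile_measurable[OF vm] wm by measurable
    have "radial (v i)" using v by (auto simp: Ckcr_def)
    then show "v i x - u x = ef a (\<lambda>s. ef_profile a (v i) s - w s) x" if "x \<noteq> 0" for x
      using radial_eq_ef[of "v i" x a] ue[OF that] that by (simp add: ef_def algebra_simps)
  qed
  with L have "(\<lambda>i. 1 / sphere_area TYPE('a) * (sphere_area TYPE('a) * (LINT s|lborel. \<bar>ef_profile a (v i) s - w s\<bar> powr p))) \<longlonglongrightarrow> 1 / sphere_area TYPE('a) * 0"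
    by (intro tendsto_mult_left) simp
  then have wl: "(\<lambda>i. LINT s|lborel. \<bar>ef_profile a (v i) s - w s\<bar> powr p) \<longlonglongrightarrow> 0"
    using sphere_area_pos[where 'a='a] by simp
  have "\<exists>z. Lp p z \<and> (\<lambda>i. LINT s|lborel. \<bar>ef_chain DIM('a) a k (ef_profile a (v i)) s - z s\<bar> powr p) \<longlonglongrightarrow> 0"
  proof (rule Lp_complete[OF p0])
    show "Lp p (ef_chain DIM('a) a k (ef_profile a (v i)))" for i by (rule admissible_Lp[OF p0 adm]) simp
    fix e :: real assume e: "e > 0"
    define d where "d = (sphere_area TYPE('a) * e) powr (1 / p)"
    have d: "d > 0" using e sphere_area_pos[where 'a='a] by (simp add: d_def)
    obtain N where N: "\<And>i l. i \<ge> N \<Longrightarrow> l \<ge> N \<Longrightarrow> sobolev_norm \<alpha> k p (\<lambda>x. v i x - v l x) < d"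
      using C[OF d] by blast
    have "(LINT s|lborel. \<bar>ef_chain DIM('a) a k (ef_profile a (v i)) s - ef_chain DIM('a) a k (ef_profile a (v l)) s\<bar> powr p) < e"
      if "i \<ge> N" "l \<ge> N" for i l
    proof -
      define X where "X = (LINT s|lborel. \<bar>ef_chain DIM('a) a k (ef_profile a (v i)) s - ef_chain DIM('a) a k (ef_profile a (v l)) s\<bar> powr p)"
      have "weighted_int \<alpha> p (nabla k (\<lambda>x. v i x - v l x)) = sphere_area TYPE('a) * X"
        unfolding weighted_int_nabla[OF Ckcr_diff[OF v v]] ef_profile_diff X_def
        by (simp add: admissible_diff_chain[OF adm adm])
      then have "(sphere_area TYPE('a) * X) powr (1 / p) < (sphere_area TYPE('a) * e) powr (1 / p)"
        using N[OF that] by (simp add: sobolev_norm_def d_def)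
      then have "sphere_area TYPE('a) * X < sphere_area TYPE('a) * e"
        using p0 e sphere_area_pos[where 'a='a] by (meson not_less powr_mono2 less_imp_le mult_pos_pos divide_nonneg_pos zero_le_one)
      then show ?thesis using sphere_area_pos[where 'a='a] by (simp add: X_def)
    qed
    then show "\<exists>N. \<forall>i\<ge>N. \<forall>l\<ge>N. (LINT s|lborel. \<bar>ef_chain DIM('a) a k (ef_profile a (v i)) s - ef_chain DIM('a) a k (ef_profile a (v l)) s\<bar> powr p) < e"
      by blast
  qed
  then obtain z where "Lp p z" "(\<lambda>i. LINT s|lborel. \<bar>ef_chain DIM('a) a k (ef_profile a (v i)) s - z s\<bar> powr p) \<longlonglongrightarrow> 0" by blast
  with v um ue Lw wl have "limit_data u v w z" unfolding limit_data_def by blast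
  then show thesis by (rule that)
qed

lemma chain_dist_le:
  assumes G: "kernel G A B C" and \<epsilon>: "\<bar>\<epsilon>\<bar> = 1"
    and rep: "\<And>w s. admissible DIM('a) a k w \<Longrightarrow> ef_chain DIM('a) a l w s = \<epsilon> * conv G (ef_chain DIM('a) a k w) s"
    and w: "admissible DIM('a) a k w" and z: "Lp p z"
  shows "(LINT s|lborel. \<bar>ef_chain DIM('a) a l w s - \<epsilon> * conv G z s\<bar> powr p) \<le>
    A powr p * (LINT s|lborel. \<bar>ef_chain DIM('a) a k w s - z s\<bar> powr p)"
proof -
  interpret G: kernel G A B C by fact
  let ?y = "ef_chain DIM('a) a k w"
  have Lk: "Lp p ?y" by (rule admissible_Lp[OF p0 w]) simp
  have "\<bar>ef_chain DIM('a) a l w s - \<epsilon> * conv G z s\<bar> = \<bar>conv G (\<lambda>s. ?y s - z s) s\<bar>" for s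
  proof -
    have "conv G (\<lambda>s. ?y s - z s) s = conv G ?y s - conv G z s"
      unfolding conv_def right_diff_distrib
      by (rule Bochner_Integration.integral_diff[OF G.integrable_Lp[OF Lk p] G.integrable_Lp[OF z p]])
    then have "ef_chain DIM('a) a l w s - \<epsilon> * conv G z s = \<epsilon> * conv G (\<lambda>s. ?y s - z s) s"
      using rep[OF w, of s] by (simp add: right_diff_distrib)
    then show ?thesis using \<epsilon> by (simp add: abs_mult)
  qed
  then show ?thesis using G.conv_Lp(2)[OF Lp_diff[OF p0 Lk z] p] by simp
qed

text \<open>Convolution with G is bounded on L^p, so the representation of the lower links carries
  over to the limit: the l-th derivative of u corresponds to a signed G * z.\<close>

lemma chain_limit:
  assumes d: "limit_data u v w z" and G: "kernel G A B C" and \<epsilon>: "\<bar>\<epsilon>\<bar> = 1"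
    and rep: "\<And>w s. admissible DIM('a) a k w \<Longrightarrow> ef_chain DIM('a) a l w s = \<epsilon> * conv G (ef_chain DIM('a) a k w) s"
  shows "Lp p (\<lambda>s. \<epsilon> * conv G z s)"
    and "(\<lambda>i. LINT s|lborel. \<bar>ef_chain DIM('a) a l (ef_profile a (v i)) s - \<epsilon> * conv G z s\<bar> powr p) \<longlonglongrightarrow> 0"
proof -
  interpret G: kernel G A B C by fact
  have v: "v i \<in> Ckcr k" for i using d by (simp add: limit_data_def)
  have z: "Lp p z" and zl: "(\<lambda>i. LINT s|lborel. \<bar>ef_chain DIM('a) a k (ef_profile a (v i)) s - z s\<bar> powr p) \<longlonglongrightarrow> 0"
    using d by (auto simp: limit_data_def)
  show "Lp p (\<lambda>s. \<epsilon> * conv G z s)" by (rule Lp_cmult[OF G.conv_Lp(1)[OF z p]])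
  show "(\<lambda>i. LINT s|lborel. \<bar>ef_chain DIM('a) a l (ef_profile a (v i)) s - \<epsilon> * conv G z s\<bar> powr p) \<longlonglongrightarrow> 0"
  proof (rule tendsto_sandwich[OF _ _ tendsto_const])
    show "(\<lambda>i. A powr p * (LINT s|lborel. \<bar>ef_chain DIM('a) a k (ef_profile a (v i)) s - z s\<bar> powr p)) \<longlonglongrightarrow> 0"
      using tendsto_mult_left[OF zl, of "A powr p"] by simp
  qed (use chain_dist_le[OF G \<epsilon> rep admissible_profile[OF v] z] in auto)
qed

lemma weighted_int_weak_nabla_limit:
  assumes d: "limit_data u v w z" and l: "l \<le> k" and y: "Lp p y"
    and yl: "(\<lambda>i. LINT s|lborel. \<bar>ef_chain DIM('a) a l (ef_profile a (v i)) s - y s\<bar> powr p) \<longlonglongrightarrow> 0"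
    and c: "c + real DIM('a) = (a + real l) * r"
  shows "weighted_int c r (weak_nabla l u) = sphere_area TYPE('a) * (LINT s|lborel. \<bar>y s\<bar> powr r)"
    and "has_weak_nabla l u (\<lambda>x. ef (a + real l) y x *\<^sub>R ef_dir l x)"
proof -
  let ?G = "\<lambda>x::'a. ef (a + real l) y x *\<^sub>R ef_dir l x"
  show W: "has_weak_nabla l u ?G"
    using d unfolding limit_data_def by (intro has_weak_nabla_limit[OF p _ l _ _ y yl]) blast+
  have ym [measurable]: "y \<in> borel_measurable borel" using y by (simp add: Lp_def)
  have "weighted_int c r ?G = sphere_area TYPE('a) * (LINT s|lborel. \<bar>y s\<bar> powr r)"
  proof (rule weighted_int_ef(1)[OF ym _ _ c])
    show "?G \<in> borel_measurable borel" by measurable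
    show "norm (?G x) = \<bar>ef (a + real l) y x\<bar>" if "x \<noteq> 0" for x using norm_ef_dir[OF that] by simp
  qed
  then show "weighted_int c r (weak_nabla l u) = sphere_area TYPE('a) * (LINT s|lborel. \<bar>y s\<bar> powr r)"
    using weighted_int_weak_nabla[OF W] by simp
qed

lemma LINT_powr_eq_0_iff: "Lp r f \<Longrightarrow> (LINT s|lborel. \<bar>f s\<bar> powr r) = 0 \<longleftrightarrow> (AE s in lborel. f s = 0)"
  by (subst integral_nonneg_eq_0_iff_AE) (auto simp: Lp_def)

lemma limit_data_zero:
  assumes d: "limit_data u v w z" and w: "AE s in lborel. w s = 0"
  shows "AE x in lborel. u x = 0"
proof -
  have [measurable]: "u \<in> borel_measurable borel" "w \<in> borel_measurable borel"
    using d by (auto simp: limit_data_def Lp_def)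
  have "(LINT s|lborel. \<bar>w s\<bar> powr p) = 0" using d w LINT_powr_eq_0_iff by (auto simp: limit_data_def)
  then have 0: "weighted_int (\<alpha> - real k * p) p u = 0"
    using weighted_int_0(1)[of u w] d by (auto simp: limit_data_def)
  have "integrable lborel (\<lambda>x. norm x powr (\<alpha> - real k * p) * norm (u x) powr p)"
    using weighted_int_0(2)[of u w] d by (auto simp: limit_data_def Lp_def)
  then have "AE x in lborel. norm x powr (\<alpha> - real k * p) * norm (u x) powr p = 0"
    using 0 unfolding weighted_int_def by (subst (asm) integral_nonneg_eq_0_iff_AE) auto
  then show ?thesis using AE_lborel_singleton[of "0::'a"] by eventually_elim auto
qed

text \<open>Surjectivity onto continuous L^p functions: approximate f by k-th links of smooth
  compactly supported profiles, and let the inverse of P_k(D) applied to f be the profile of u.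
  Bounded inversion makes the approximating profiles converge to it.\<close>

lemma limit_data_exists:
  assumes k: "k > 0" and f: "continuous_on UNIV f" "Lp p f"
  obtains u v w where "u \<in> (D_space \<alpha> k p :: ('a \<Rightarrow> real) set)" "limit_data u v w f"
proof -
  obtain G A B C \<epsilon> where G: "kernel G A B C" "\<bar>\<epsilon>\<bar> = (1::real)"
    "\<And>w s. admissible DIM('a) a k w \<Longrightarrow> ef_chain DIM('a) a 0 w s = \<epsilon> * conv G (ef_chain DIM('a) a k w) s"
    using ef_chain_representation[of 0 k "DIM('a)" a] root_nonzero k by metis
  have "\<forall>i. \<exists>y. y \<in> smooth_cs \<and> (LINT s|lborel. \<bar>ef_chain DIM('a) a k y s - f s\<bar> powr p) < 1 / (real i + 1)"
    using ef_chain_range_dense[OF p0 root_nonzero f] by (metis add_pos_nonneg add.commute of_nat_0_le_iff zero_less_divide_iff zero_less_one)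
  then obtain y where y: "\<And>i. y i \<in> smooth_cs" "\<And>i. (LINT s|lborel. \<bar>ef_chain DIM('a) a k (y i) s - f s\<bar> powr p) < 1 / (real i + 1)"
    by metis
  define v where "v i = (ef a (y i) :: 'a \<Rightarrow> real)" for i
  have v: "v i \<in> Ckcr k" for i unfolding v_def by (rule ef_in_Ckcr[OF y(1)])
  have pv: "ef_profile a (v i) = y i" for i unfolding v_def by (rule ef_profile_ef)
  have fl: "(\<lambda>i. LINT s|lborel. \<bar>ef_chain DIM('a) a k (ef_profile a (v i)) s - f s\<bar> powr p) \<longlonglongrightarrow> 0"
  proof (rule tendsto_sandwich[OF _ _ tendsto_const])
    show "(\<lambda>i. 1 / (real i + 1)) \<longlonglongrightarrow> 0"
      using LIMSEQ_inverse_real_of_nat by (simp add: inverse_eq_divide add.commute)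
  qed (use y(2) pv less_imp_le in \<open>auto intro!: always_eventually\<close>)
  define w where "w s = \<epsilon> * conv G f s" for s
  interpret G: kernel G A B C by fact
  have Lw: "Lp p w" unfolding w_def[abs_def] by (rule Lp_cmult[OF G.conv_Lp(1)[OF f(2) p]])
  have wm [measurable]: "w \<in> borel_measurable borel" using Lw by (simp add: Lp_def)
  define u where "u = (ef a w :: 'a \<Rightarrow> real)"
  have um [measurable]: "u \<in> borel_measurable borel" unfolding u_def by measurable
  have adm: "admissible DIM('a) a k (ef_profile a (v i))" for i by (rule admissible_profile[OF v])
  have Lk: "Lp p (ef_chain DIM('a) a k (ef_profile a (v i)))" for i by (rule admissible_Lp[OF p0 adm]) simp
  have wl: "(\<lambda>i. LINT s|lborel. \<bar>ef_profile a (v i) s - w s\<bar> powr p) \<longlonglongrightarrow> 0"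
  proof (rule tendsto_sandwich[OF _ _ tendsto_const])
    show "(\<lambda>i. A powr p * (LINT s|lborel. \<bar>ef_chain DIM('a) a k (ef_profile a (v i)) s - f s\<bar> powr p)) \<longlonglongrightarrow> 0"
      using tendsto_mult_left[OF fl, of "A powr p"] by simp
  qed (use chain_dist_le[OF G adm f(2)] in \<open>auto simp: w_def\<close>)
  have ue: "u x = ef a w x" for x by (simp add: u_def)
  have ld: "limit_data u v w f" unfolding limit_data_def using v um ue Lw wl f(2) fl by blast
  have "u \<in> weighted_Lp (\<alpha> - real k * p) p"
    unfolding weighted_Lp_def using weighted_int_0(2)[OF um wm ue] Lw by (simp add: Lp_def)
  moreover have "radial u" unfolding u_def by (auto simp: radial_def ef_def)
  moreover have "\<exists>N. \<forall>i\<ge>N. \<forall>l\<ge>N. sobolev_norm \<alpha> k p (\<lambda>x. v i x - v l x) < e" if e: "e > 0" for e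
  proof -
    \<comment> \<open>Two distances below d add up, through the quasi-triangle inequality and the
      area of the sphere, to less than \<open>e powr p\<close>.\<close>
    define d where "d = e powr p / (sphere_area TYPE('a) * (2 powr p * 2))"
    have d: "d > 0" using e sphere_area_pos[where 'a='a] by (simp add: d_def)
    obtain N where N: "\<And>i. i \<ge> N \<Longrightarrow> (LINT s|lborel. \<bar>ef_chain DIM('a) a k (ef_profile a (v i)) s - f s\<bar> powr p) < d"
      using order_tendstoD(2)[OF fl d] by (auto simp: eventually_sequentially)
    have "sobolev_norm \<alpha> k p (\<lambda>x. v i x - v l x) < e" if i: "i \<ge> N" and l: "l \<ge> N" for i l
    proof -
      define X where "X = (LINT s|lborel. \<bar>ef_chain DIM('a) a k (ef_profile a (v i)) s - ef_chain DIM('a) a k (ef_profile a (v l)) s\<bar> powr p)"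
      have "X \<le> 2 powr p * ((LINT s|lborel. \<bar>ef_chain DIM('a) a k (ef_profile a (v i)) s - f s\<bar> powr p) +
          (LINT s|lborel. \<bar>f s - ef_chain DIM('a) a k (ef_profile a (v l)) s\<bar> powr p))"
        unfolding X_def by (rule Lp_dist_triangle[OF p0 Lk f(2) Lk])
      also have "\<dots> < 2 powr p * (d + d)"
        using N[OF i] N[OF l] by (intro mult_strict_left_mono add_strict_mono) (auto simp: abs_minus_commute)
      finally have "sphere_area TYPE('a) * X < sphere_area TYPE('a) * (2 powr p * (d + d))" using sphere_area_pos[where 'a='a] by simp
      also have "\<dots> = e powr p" using sphere_area_pos[where 'a='a] by (simp add: d_def)
      finally have lt: "sphere_area TYPE('a) * X < e powr p" .
      have X0: "0 \<le> sphere_area TYPE('a) * X" using sphere_area_pos[where 'a='a] by (simp add: X_def)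
      have "weighted_int \<alpha> p (nabla k (\<lambda>x. v i x - v l x)) = sphere_area TYPE('a) * X"
        unfolding weighted_int_nabla[OF Ckcr_diff[OF v v]] ef_profile_diff X_def
        by (simp add: admissible_diff_chain[OF adm adm])
      then have "sobolev_norm \<alpha> k p (\<lambda>x. v i x - v l x) = (sphere_area TYPE('a) * X) powr (1 / p)" by (simp add: sobolev_norm_def)
      also have "\<dots> < (e powr p) powr (1 / p)" using X0 lt p0 by (intro powr_less_mono2) auto
      also have "\<dots> = e" using e p0 by (simp add: powr_powr)
      finally show ?thesis .
    qed
    then show ?thesis by blast
  qed
  moreover have "(\<lambda>i. weighted_int (\<alpha> - real k * p) p (\<lambda>x. v i x - u x)) \<longlonglongrightarrow> 0"
  proof -
    have "weighted_int (\<alpha> - real k * p) p (\<lambda>x. v i x - u x) =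
        sphere_area TYPE('a) * (LINT s|lborel. \<bar>ef_profile a (v i) s - w s\<bar> powr p)" for i
    proof (rule weighted_int_0)
      have vm: "v i \<in> borel_measurable borel" by (rule Ckcr_measurable[OF v])
      show "(\<lambda>x. v i x - u x) \<in> borel_measurable borel" using vm by measurable
      show "(\<lambda>s. ef_profile a (v i) s - w s) \<in> borel_measurable borel"
        using ef_profile_measurable[OF vm] by measurable
      show "v i x - u x = ef a (\<lambda>s. ef_profile a (v i) s - w s) x" if "x \<noteq> 0" for x
        using that unfolding pv by (simp add: v_def u_def ef_def algebra_simps)
    qed
    then show ?thesis using tendsto_mult_left[OF wl, of "sphere_area TYPE('a)"] by simp
  qed
  ultimately have "u \<in> D_space \<alpha> k p" using v unfolding D_space_def by blast
  then show thesis using that ld by blast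
qed

theorem quotient_attained:
  assumes q: "p < q" and j: "j < k"
  shows "S_const TYPE('a) \<alpha> k p q j > 0 \<and>
    (\<exists>u \<in> (D_nonzero \<alpha> k p :: ('a \<Rightarrow> real) set).
       sobolev_quotient \<alpha> k p q j u = S_const TYPE('a) \<alpha> k p q j)"
proof -
  note pq = p q
  obtain G A B C \<epsilon> where G: "kernel G A B C" "A > 0" "\<bar>\<epsilon>\<bar> = (1::real)"
    "\<And>w s. admissible DIM('a) a k w \<Longrightarrow> ef_chain DIM('a) a j w s = \<epsilon> * conv G (ef_chain DIM('a) a k w) s"
    using ef_chain_representation[of j k "DIM('a)" a] root_nonzero j by metis
  interpret G: kernel G A B C by fact
  define M where "M = G.opt_val p q"
  have M: "M > 0" unfolding M_def by (rule G.opt_val_pos[OF pq G(2)])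
  have s: "sphere_area TYPE('a) > 0" by (rule sphere_area_pos)
  have weightj: "- beta DIM('a) \<alpha> p (k - j) q + real DIM('a) = (a + real j) * q"
  proof -
    have "(real DIM('a) - real (k - j) * p + \<alpha>) / p = a + real j"
      using p0 j by (simp add: a_def of_nat_diff field_simps)
    then show ?thesis by (simp add: beta_def mult.commute)
  qed
  have quot: "sobolev_quotient \<alpha> k p q j u =
      (sphere_area TYPE('a) * (LINT s|lborel. \<bar>z s\<bar> powr p)) / (sphere_area TYPE('a) * (LINT s|lborel. \<bar>conv G z s\<bar> powr q)) powr (p / q)"
    if d: "limit_data u v w z" for u v w z
  proof -
    have z: "Lp p z" "(\<lambda>i. LINT s|lborel. \<bar>ef_chain DIM('a) a k (ef_profile a (v i)) s - z s\<bar> powr p) \<longlonglongrightarrow> 0"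
      using d by (auto simp: limit_data_def)
    note y = chain_limit[OF d G(1,3,4)]
    have "(LINT s|lborel. \<bar>\<epsilon> * conv G z s\<bar> powr q) = (LINT s|lborel. \<bar>conv G z s\<bar> powr q)"
      using G(3) by (simp add: abs_mult)
    then show ?thesis
      using weighted_int_weak_nabla_limit(1)[OF d _ z weightk]
        weighted_int_weak_nabla_limit(1)[OF d _ y weightj] j by (simp add: sobolev_quotient_def)
  qed
  \<comment> \<open>The quotient at an extremal z of norm 1. The area of the sphere does not cancel,
    because the denominator carries it to the power p / q.\<close>
  define S where "S = sphere_area TYPE('a) / (sphere_area TYPE('a) * M) powr (p / q)"
  have S: "S > 0" using s M by (simp add: S_def)
  have lower: "S \<le> sobolev_quotient \<alpha> k p q j u" if u: "u \<in> (D_nonzero \<alpha> k p :: ('a \<Rightarrow> real) set)" for u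
  proof -
    have uD: "u \<in> D_space \<alpha> k p" and u0: "\<not> (AE x in lborel. u x = 0)" using u by (auto simp: D_nonzero_def)
    obtain v w z where d: "limit_data u v w z" using D_space_limit_data[OF uD] by blast
    have z: "Lp p z" using d by (simp add: limit_data_def)
    define X where "X = (LINT s|lborel. \<bar>z s\<bar> powr p)"
    define Y where "Y = (LINT s|lborel. \<bar>conv G z s\<bar> powr q)"
    note op = G.conv_le_opt_val[OF pq z]
    have YX: "Y \<le> M * X powr (q / p)" using op(2) by (simp add: Y_def X_def M_def)
    \<comment> \<open>If Y were 0, the quotient would take the default value 0 and the lower bound
      would fail. In that case the j-th links tend to 0, and inverting the first j factors forces w
      = 0, hence u = 0.\<close>
    have "Y \<noteq> 0"
    proof
      assume "Y = 0"
      then have cz: "AE s in lborel. conv G z s = 0"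
        unfolding Y_def by (subst (asm) LINT_powr_eq_0_iff[OF op(1)])
      have "AE s in lborel. w s = 0"
      proof -
        have v: "v i \<in> Ckcr k" for i using d by (simp add: limit_data_def)
        have adm: "admissible DIM('a) a k (ef_profile a (v i))" for i by (rule admissible_profile[OF v])
        have Lw: "Lp p w" and wl: "(\<lambda>i. LINT s|lborel. \<bar>ef_profile a (v i) s - w s\<bar> powr p) \<longlonglongrightarrow> 0"
          using d by (auto simp: limit_data_def)
        have Lj: "Lp p (ef_chain DIM('a) a l (ef_profile a (v i)))" if "l \<le> k" for i l
          by (rule admissible_Lp[OF p0 adm that])
        have [measurable]: "conv G z \<in> borel_measurable borel" using op(1) by (simp add: Lp_def)
        have [measurable]: "ef_chain DIM('a) a j (ef_profile a (v i)) \<in> borel_measurable borel" for i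
          using Lj[of j i] j by (simp add: Lp_def)
        have "(LINT s|lborel. \<bar>ef_chain DIM('a) a j (ef_profile a (v i)) s - \<epsilon> * conv G z s\<bar> powr p) =
            (LINT s|lborel. \<bar>ef_chain DIM('a) a j (ef_profile a (v i)) s\<bar> powr p)" for i
          using cz by (intro integral_cong_AE) (auto elim!: eventually_mono)
        with chain_limit(2)[OF d G(1,3,4)]
        have jl: "(\<lambda>i. LINT s|lborel. \<bar>ef_chain DIM('a) a j (ef_profile a (v i)) s\<bar> powr p) \<longlonglongrightarrow> 0" by simp
        \<comment> \<open>Inverting the first j factors bounds the profile by its j-th link,
          uniformly in i. For j = 0 the two coincide and there is no factor to invert.\<close>
        have "\<exists>c. \<forall>i. (LINT s|lborel. \<bar>ef_profile a (v i) s\<bar> powr p) \<le> c * (LINT s|lborel. \<bar>ef_chain DIM('a) a j (ef_profile a (v i)) s\<bar> powr p)"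
        proof (cases "j = 0")
          case True
          then show ?thesis by (intro exI[of _ 1]) simp
        next
          case False
          obtain H A' B' C' \<epsilon>' where H: "kernel H A' B' C'" "\<bar>\<epsilon>'\<bar> = (1::real)"
            "\<And>w s. admissible DIM('a) a j w \<Longrightarrow> ef_chain DIM('a) a 0 w s = \<epsilon>' * conv H (ef_chain DIM('a) a j w) s"
            using ef_chain_representation[of 0 j "DIM('a)" a] root_nonzero j False
            by (metis less_trans not_gr_zero)
          interpret H: kernel H A' B' C' by fact
          have admj: "admissible DIM('a) a j (ef_profile a (v i))" for i
            using adm[of i] j unfolding admissible_def by (meson less_imp_le less_trans order_trans)
          have "(LINT s|lborel. \<bar>ef_profile a (v i) s\<bar> powr p) = (LINT s|lborel. \<bar>conv H (ef_chain DIM('a) a j (ef_profile a (v i))) s\<bar> powr p)" for i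
            using H(3)[OF admj, of i] H(2) by (simp add: abs_mult)
          then show ?thesis using H.conv_Lp(2)[OF Lj p] j by (intro exI[of _ "A' powr p"]) auto
        qed
        then obtain c where c: "\<And>i. (LINT s|lborel. \<bar>ef_profile a (v i) s\<bar> powr p) \<le> c * (LINT s|lborel. \<bar>ef_chain DIM('a) a j (ef_profile a (v i)) s\<bar> powr p)"
          by blast
        have L0: "Lp p (ef_profile a (v i))" for i using Lj[of 0 i] by simp
        have le: "(LINT s|lborel. \<bar>w s\<bar> powr p) \<le> 2 powr p * ((LINT s|lborel. \<bar>ef_profile a (v i) s - w s\<bar> powr p) +
            c * (LINT s|lborel. \<bar>ef_chain DIM('a) a j (ef_profile a (v i)) s\<bar> powr p))" for i
        proof -
          have "(LINT s|lborel. \<bar>w s - 0\<bar> powr p) \<le> 2 powr p * ((LINT s|lborel. \<bar>w s - ef_profile a (v i) s\<bar> powr p) +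
            (LINT s|lborel. \<bar>ef_profile a (v i) s - 0\<bar> powr p))"
            using Lp_dist_triangle[OF p0 Lw L0, of "\<lambda>s. 0" i] by (simp add: Lp_def)
          also have "\<dots> \<le> 2 powr p * ((LINT s|lborel. \<bar>ef_profile a (v i) s - w s\<bar> powr p) +
            c * (LINT s|lborel. \<bar>ef_chain DIM('a) a j (ef_profile a (v i)) s\<bar> powr p))"
            using c[of i] by (intro mult_left_mono add_mono) (auto simp: abs_minus_commute)
          finally show ?thesis by simp
        qed
        have lim: "(\<lambda>i. 2 powr p * ((LINT s|lborel. \<bar>ef_profile a (v i) s - w s\<bar> powr p) +
            c * (LINT s|lborel. \<bar>ef_chain DIM('a) a j (ef_profile a (v i)) s\<bar> powr p))) \<longlonglongrightarrow> 2 powr p * (0 + c * 0)"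
          by (intro tendsto_intros wl jl)
        have "(LINT s|lborel. \<bar>w s\<bar> powr p) \<le> 2 powr p * (0 + c * 0)"
          by (rule LIMSEQ_le_const[OF lim]) (use le in blast)
        moreover have "0 \<le> (LINT s|lborel. \<bar>w s\<bar> powr p)" by simp
        ultimately have "(LINT s|lborel. \<bar>w s\<bar> powr p) = 0" by (intro antisym) auto
        then show ?thesis by (subst (asm) LINT_powr_eq_0_iff[OF Lw])
      qed
      with limit_data_zero[OF d] u0 show False by blast
    qed
    then have Y: "Y > 0" by (simp add: Y_def less_le)
    have X: "X > 0"
    proof -
      have "X \<noteq> 0" using YX Y by auto
      then show ?thesis by (simp add: X_def less_le)
    qed
    have "(sphere_area TYPE('a) * Y) powr (p / q) \<le> (sphere_area TYPE('a) * (M * X powr (q / p))) powr (p / q)"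
      using YX Y s p q by (intro powr_mono2 mult_left_mono) auto
    also have "\<dots> = (sphere_area TYPE('a) * M) powr (p / q) * X"
      using s M X p q by (simp add: powr_mult powr_powr mult.assoc)
    finally have le: "(sphere_area TYPE('a) * Y) powr (p / q) \<le> (sphere_area TYPE('a) * M) powr (p / q) * X" .
    have "S = sphere_area TYPE('a) * X / ((sphere_area TYPE('a) * M) powr (p / q) * X)" using X by (simp add: S_def)
    also have "\<dots> \<le> sphere_area TYPE('a) * X / (sphere_area TYPE('a) * Y) powr (p / q)"
      using le s X Y M by (intro divide_left_mono mult_pos_pos) auto
    also have "\<dots> = sobolev_quotient \<alpha> k p q j u" using quot[OF d] by (simp add: X_def Y_def)
    finally show ?thesis .
  qed
  obtain f where f: "\<And>t. 0 \<le> f t" "continuous_on UNIV f" "Lp p f"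
    "(LINT t|lborel. \<bar>f t\<bar> powr p) = 1" "(LINT s|lborel. \<bar>conv G f s\<bar> powr q) = M"
    unfolding M_def by (rule G.conv_extremal[OF pq G(2)]) blast
  obtain u v w where uD: "u \<in> (D_space \<alpha> k p :: ('a \<Rightarrow> real) set)" and d: "limit_data u v w f"
    using limit_data_exists[OF _ f(2,3)] j by (metis gr_implies_not0 not_gr_zero)
  have qS: "sobolev_quotient \<alpha> k p q j u = S" using quot[OF d] f(4,5) by (simp add: S_def)
  \<comment> \<open>A null function has weak derivative 0, and uniqueness of weak derivatives would
    make the integral of |f|^p vanish, although it is 1.\<close>
  have "\<not> (AE x in lborel. u x = 0)"
  proof
    assume u0: "AE x in lborel. u x = 0"
    have fl: "(\<lambda>i. LINT s|lborel. \<bar>ef_chain DIM('a) a k (ef_profile a (v i)) s - f s\<bar> powr p) \<longlonglongrightarrow> 0"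
      and um: "u \<in> borel_measurable borel"
      using d by (auto simp: limit_data_def)
    note W = weighted_int_weak_nabla_limit[OF d order_refl f(3) fl weightk]
    have lu: "locally_integrable_punctured u" using W(2) by (simp add: has_weak_nabla_def)
    have z: "(LINT x|lborel. u x * g x) = 0" for g
      using u0 by (intro integral_eq_zero_AE) (auto elim!: eventually_mono)
    have "has_weak_nabla k u (\<lambda>x. 0)"
      unfolding has_weak_nabla_def using lu z
      by (auto simp: locally_integrable_punctured_def set_integrable_def)
    then have "weighted_int \<alpha> p (weak_nabla k u) = weighted_int \<alpha> p (\<lambda>x::'a. 0 :: real \<times> 'a)"
      by (rule weighted_int_weak_nabla)
    also have "\<dots> = 0" using p0 by (simp add: weighted_int_def)
    finally show False using W(1) f(4) s by simp
  qed
  with uD have uN: "u \<in> D_nonzero \<alpha> k p" by (simp add: D_nonzero_def)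
  have "S_const TYPE('a) \<alpha> k p q j = S"
    unfolding S_const_def
  proof (rule cInf_eq_minimum)
    show "S \<in> sobolev_quotient \<alpha> k p q j ` (D_nonzero \<alpha> k p :: ('a \<Rightarrow> real) set)" using uN qS by force
    show "S \<le> x" if "x \<in> sobolev_quotient \<alpha> k p q j ` (D_nonzero \<alpha> k p :: ('a \<Rightarrow> real) set)" for x
      using that lower by auto
  qed
  with S qS uN show ?thesis by auto
qed

end

theorem theorem1p3:
  fixes k j :: nat and \<alpha> p q :: real
  assumes "DIM('a::euclidean_space) \<ge> 2" and "k \<ge> 1" and "p > 1"
    and "best_constant TYPE('a) \<alpha> k p > 0"
    and "q > p" and "j < k"
  shows "S_const TYPE('a) \<alpha> k p q j > 0 \<and>
    (\<exists>u \<in> (D_nonzero \<alpha> k p :: ('a \<Rightarrow> real) set).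
       sobolev_quotient \<alpha> k p q j u = S_const TYPE('a) \<alpha> k p q j)"
proof -
  interpret radial_setting "TYPE('a)" k \<alpha> p "(real DIM('a) + \<alpha>) / p - real k"
    using assms by unfold_locales auto
  show ?thesis using assms by (intro quotient_attained)
qed

end
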